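(* Let $q$ be a prime power and let $\mathcal{X}$ be a maximal curve over $\mathbb{F}_{q^2}$ defined by the equation $y^\beta=A(x)$, where $A(x)$ is an additive and separable polynomial (over $\mathbb{F}_{q^2}$) of degree $\alpha$. For any integers $t_1,t_2\ge 0$ with $t_1\leq\beta-2$ and $t_2\leq\alpha-2$, there exists a locally recoverable code over $\mathbb{F}_{q^2}$ with parameters $$[\,n,\ (t_1+1)(t_2+1),\ d\geq n-\alpha t_1-\beta t_2;\ t_2+1,\ t_1+1\,],$$ where $n=q^2+(\alpha-1)(\beta-1)q-\alpha$.
   Context: By a curve is meant a smooth, projective, absolutely irreducible curve; a curve given by an affine equation means the smooth projective model of the absolutely irreducible curve given by that equation. A curve $\mathcal{X}$ of genus $g$ over $\mathbb{F}_{q^2}$ is maximal over $\mathbb{F}_{q^2}$ if $\#\mathcal{X}(\mathbb{F}_{q^2})=q^2+1+2gq$. A polynomial $A(x)$ over a field of characteristic $p$ is additive if $A(a+b)=A(a)+A(b)$ identically, i.e. $A(x)=\sum_i a_i x^{p^i}$. Locally recoverable codes (LRCs): let $C\subseteq\mathbb{F}_\ell^n$ be a linear code over the finite field $\mathbb{F}_\ell$ ($\ell$ a prime power). For $\gamma\in\mathbb{F}_\ell$ and $i\in\{1,\dots,n\}$ let $C(i,\gamma)=\{c\in C: c_i=\gamma\}$, and for nonempty $I\subseteq\{1,\dots,n\}\setminus\{i\}$ let $C_I(i,\gamma)$ be the projection of $C(i,\gamma)$ to $\mathbb{F}_\ell^I$. The set $I$ is a recovery set for coordinate $i$ if $C_I(i,\gamma)\cap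 C_I(i,\gamma')=\emptyset$ for all $\gamma\neq\gamma'$ in $\mathbb{F}_\ell$. An $[n,k,d;r_1,\dots,r_t]$ LRC over $\mathbb{F}_\ell$ is a linear code $C\subseteq\mathbb{F}_\ell^n$ of length $n$, dimension $k$ and minimum (Hamming) distance $d$ such that every coordinate $i$ has $t$ pairwise disjoint recovery sets, of cardinalities $r_1,\dots,r_t$ respectively. Writing "$d\ge D$" in the parameters means the minimum distance is at least $D$.
   Formalization: The degree α of A and the exponent β are additionally assumed coprime (the characteristic does not divide β); without this the claim fails, e.g. for the rational curve y^9 = x^3 + x over F_9 with t_1 = 1, t_2 = 0. *)

theory Defs
  imports
    "HOL-Algebra.Algebraic_Closure_Type"
    "HOL-Library.Function_Algebras"
    "HOL-Number_Theory.Prime_Powers"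
    "HOL-Computational_Algebra.Computational_Algebra"
begin

section \<open>Additive and separable polynomials\<close>

text \<open>
  The identity \<open>A(X + Y) = A(X) + A(Y)\<close> in \<open>k[X][Y]\<close>. Here \<open>[:[:0, 1:], 1:]\<close> is \<open>X + Y\<close>,
  \<open>[:A:]\<close> is \<open>A(X)\<close>, and mapping coefficients to constants gives \<open>A(Y)\<close>. (Over a finite field
  this is stronger than additivity of the function \<open>poly A\<close>.)
\<close>

definition additive_poly :: "'k::field poly \<Rightarrow> bool" where
  "additive_poly A \<longleftrightarrow>
     pcompose (map_poly (\<lambda>c. [:c:]) A) [:[:0, 1:], 1:] = [:A:] + map_poly (\<lambda>c. [:c:]) A"

definition separable_poly :: "'k::field poly \<Rightarrow> bool" where
  "separable_poly A \<longleftrightarrow> coprime A (pderiv A)"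


section \<open>Curves and their function fields\<close>

text \<open>
  A bivariate polynomial \<open>f(X, Y)\<close> over \<open>k\<close> is an element of \<open>k[X][Y]\<close>: the outer variable is
  \<open>Y\<close>, the coefficients are polynomials in \<open>X\<close>.
\<close>

definition separated_curve_poly :: "nat \<Rightarrow> 'k::field poly \<Rightarrow> 'k poly poly" where
  "separated_curve_poly b A = Polynomial.monom 1 b - [:A:]"

definition absolutely_irreducible :: "'k::field poly poly \<Rightarrow> bool" where
  "absolutely_irreducible f \<longleftrightarrow> irreducible (map_poly (map_poly to_ac) f)"

definition eval_bivariate ::
    "('k::field \<Rightarrow> 'f::field) \<Rightarrow> 'f \<Rightarrow> 'f \<Rightarrow> 'k poly poly \<Rightarrow> 'f" where
  "eval_bivariate \<iota> x y f = poly (map_poly (\<lambda>c. poly (map_poly \<iota> c) x) f) y"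

definition field_embedding :: "('k::field \<Rightarrow> 'f::field) \<Rightarrow> bool" where
  "field_embedding \<iota> \<longleftrightarrow>
     \<iota> 1 = 1 \<and> (\<forall>a b. \<iota> (a + b) = \<iota> a + \<iota> b) \<and> (\<forall>a b. \<iota> (a * b) = \<iota> a * \<iota> b)"

text \<open>
  The field \<open>'f\<close>, with the embedding \<open>\<iota>\<close> of the constants and the elements \<open>x\<close>, \<open>y\<close>, is the
  fraction field of \<open>k[X, Y]/(f)\<close>. A smooth projective curve is represented by its function
  field: the smooth projective model of \<open>f = 0\<close> is the one with function field \<open>'f\<close>.
\<close>

definition is_function_field_of ::
    "'k::field poly poly \<Rightarrow> ('k \<Rightarrow> 'f::field) \<Rightarrow> 'f \<Rightarrow> 'f \<Rightarrow> bool" where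
  "is_function_field_of f \<iota> x y \<longleftrightarrow>
     field_embedding \<iota> \<and>
     (\<forall>g. eval_bivariate \<iota> x y g = 0 \<longleftrightarrow> f dvd g) \<and>
     (\<forall>z. \<exists>g h. eval_bivariate \<iota> x y h \<noteq> 0 \<and>
        z = eval_bivariate \<iota> x y g / eval_bivariate \<iota> x y h)"

text \<open>
  The closed points of the smooth projective model correspond to the places of the function
  field, that is, to its normalized discrete valuations trivial on the constants. The value of
  \<open>v\<close> at 0 should be infinite; it is set to the dummy value 0 to make \<open>v\<close> unique as a function,
  and 0 is treated separately wherever valuations are used.
\<close>

definition places :: "('k::field \<Rightarrow> 'f::field) \<Rightarrow> ('f \<Rightarrow> int) set" where
  "places \<iota> = {v.
     v 0 = 0 \<and>
     (\<forall>a b. a \<noteq> 0 \<longrightarrow> b \<noteq> 0 \<longrightarrow> v (a * b) = v a + v b) \<and>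
     (\<forall>a b. a \<noteq> 0 \<longrightarrow> b \<noteq> 0 \<longrightarrow> a + b \<noteq> 0 \<longrightarrow> v (a + b) \<ge> min (v a) (v b)) \<and>
     (\<forall>c. c \<noteq> 0 \<longrightarrow> v (\<iota> c) = 0) \<and>
     v ` (UNIV - {0}) = UNIV}"

definition valuation_ring :: "('f::field \<Rightarrow> int) \<Rightarrow> 'f set" where
  "valuation_ring v = {z. z = 0 \<or> v z \<ge> 0}"

definition valuation_ideal :: "('f::field \<Rightarrow> int) \<Rightarrow> 'f set" where
  "valuation_ideal v = {z. z = 0 \<or> v z > 0}"

abbreviation const_scale :: "('k::field \<Rightarrow> 'f::field) \<Rightarrow> 'k \<Rightarrow> 'f \<Rightarrow> 'f" where
  "const_scale \<iota> \<equiv> (\<lambda>c z. \<iota> c * z)"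

text \<open>
  The degree of the residue field over \<open>k\<close>: the dimension of the quotient of the valuation
  ring by its maximal ideal is the least size of a set of representatives that generates it.
\<close>

definition place_degree :: "('k::field \<Rightarrow> 'f::field) \<Rightarrow> ('f \<Rightarrow> int) \<Rightarrow> nat" where
  "place_degree \<iota> v = (LEAST d. \<exists>B. finite B \<and> card B = d \<and> B \<subseteq> valuation_ring v \<and>
     valuation_ring v \<subseteq> module.span (const_scale \<iota>) (B \<union> valuation_ideal v))"

definition divisors :: "('k::field \<Rightarrow> 'f::field) \<Rightarrow> (('f \<Rightarrow> int) \<Rightarrow> int) set" where
  "divisors \<iota> = {D. finite {v. D v \<noteq> 0} \<and> {v. D v \<noteq> 0} \<subseteq> places \<iota>}"

definition divisor_degree ::
    "('k::field \<Rightarrow> 'f::field) \<Rightarrow> (('f \<Rightarrow> int) \<Rightarrow> int) \<Rightarrow> int" where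
  "divisor_degree \<iota> D = (\<Sum>v | D v \<noteq> 0. D v * int (place_degree \<iota> v))"

definition riemann_roch_space ::
    "('k::field \<Rightarrow> 'f::field) \<Rightarrow> (('f \<Rightarrow> int) \<Rightarrow> int) \<Rightarrow> 'f set" where
  "riemann_roch_space \<iota> D = {z. z = 0 \<or> (\<forall>v\<in>places \<iota>. v z + D v \<ge> 0)}"

definition riemann_roch_dim ::
    "('k::field \<Rightarrow> 'f::field) \<Rightarrow> (('f \<Rightarrow> int) \<Rightarrow> int) \<Rightarrow> nat" where
  "riemann_roch_dim \<iota> D =
     vector_space.dim (const_scale \<iota>) (riemann_roch_space \<iota> D)"

text \<open>
  The genus is the maximum of \<open>deg D - l(D) + 1\<close> over all divisors \<open>D\<close>; it exists by Riemann's
  theorem. It is defined as a relation to avoid a default value for a maximum not known to exist.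
\<close>

definition has_genus :: "('k::field \<Rightarrow> 'f::field) \<Rightarrow> nat \<Rightarrow> bool" where
  "has_genus \<iota> g \<longleftrightarrow>
     (\<exists>D\<in>divisors \<iota>. divisor_degree \<iota> D - int (riemann_roch_dim \<iota> D) + 1 = int g) \<and>
     (\<forall>D\<in>divisors \<iota>. divisor_degree \<iota> D - int (riemann_roch_dim \<iota> D) + 1 \<le> int g)"

text \<open>The \<open>k\<close>-rational points of the smooth projective model are the places of degree one.\<close>

definition rational_places :: "('k::field \<Rightarrow> 'f::field) \<Rightarrow> ('f \<Rightarrow> int) set" where
  "rational_places \<iota> = {v \<in> places \<iota>. place_degree \<iota> v = 1}"

text \<open>The field of constants \<open>'k\<close> is meant to have \<open>q\<^sup>2\<close> elements.\<close>

definition maximal_curve :: "('k::field \<Rightarrow> 'f::field) \<Rightarrow> nat \<Rightarrow> bool" where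
  "maximal_curve \<iota> q \<longleftrightarrow>
     (\<exists>g. has_genus \<iota> g \<and> finite (rational_places \<iota>) \<and>
        card (rational_places \<iota>) = q\<^sup>2 + 1 + 2 * g * q)"


section \<open>Locally recoverable codes\<close>

text \<open>
  Words of length \<open>n\<close> are functions on \<open>nat\<close> vanishing outside the set of coordinates
  \<open>{..<n}\<close>, with pointwise addition.
\<close>

definition words :: "nat \<Rightarrow> (nat \<Rightarrow> 'k::field) set" where
  "words n = {c. \<forall>i\<ge>n. c i = 0}"

abbreviation word_scale :: "'k::field \<Rightarrow> (nat \<Rightarrow> 'k) \<Rightarrow> nat \<Rightarrow> 'k" where
  "word_scale \<equiv> (\<lambda>a c i. a * c i)"

definition linear_code :: "nat \<Rightarrow> (nat \<Rightarrow> 'k::field) set \<Rightarrow> bool" where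
  "linear_code n C \<longleftrightarrow> C \<subseteq> words n \<and> module.subspace word_scale C"

definition code_dim :: "(nat \<Rightarrow> 'k::field) set \<Rightarrow> nat" where
  "code_dim C = vector_space.dim word_scale C"

definition hamming_dist :: "nat \<Rightarrow> (nat \<Rightarrow> 'k) \<Rightarrow> (nat \<Rightarrow> 'k) \<Rightarrow> nat" where
  "hamming_dist n c c' = card {i. i < n \<and> c i \<noteq> c' i}"

text \<open>The least value is attained, so the distance is undefined for a code with one word only.\<close>

definition has_min_dist :: "nat \<Rightarrow> (nat \<Rightarrow> 'k) set \<Rightarrow> nat \<Rightarrow> bool" where
  "has_min_dist n C d \<longleftrightarrow>
     (\<exists>c\<in>C. \<exists>c'\<in>C. c \<noteq> c' \<and> hamming_dist n c c' = d) \<and>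
     (\<forall>c\<in>C. \<forall>c'\<in>C. c \<noteq> c' \<longrightarrow> d \<le> hamming_dist n c c')"

definition projected_fibre ::
    "(nat \<Rightarrow> 'k) set \<Rightarrow> nat set \<Rightarrow> nat \<Rightarrow> 'k \<Rightarrow> (nat \<Rightarrow> 'k) set" where
  "projected_fibre C I i \<gamma> = (\<lambda>c. restrict c I) ` {c \<in> C. c i = \<gamma>}"

definition recovery_set :: "nat \<Rightarrow> (nat \<Rightarrow> 'k) set \<Rightarrow> nat \<Rightarrow> nat set \<Rightarrow> bool" where
  "recovery_set n C i I \<longleftrightarrow>
     I \<noteq> {} \<and> I \<subseteq> {..<n} - {i} \<and>
     (\<forall>\<gamma> \<gamma>'. \<gamma> \<noteq> \<gamma>' \<longrightarrow> projected_fibre C I i \<gamma> \<inter> projected_fibre C I i \<gamma>' = {})"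

text \<open>An \<open>[n, k, d; r\<^sub>1, \<dots>, r\<^sub>t]\<close> locally recoverable code, where \<open>rs\<close> lists the \<open>r\<^sub>j\<close>.\<close>

definition is_lrc ::
    "nat \<Rightarrow> nat \<Rightarrow> nat \<Rightarrow> nat list \<Rightarrow> (nat \<Rightarrow> 'k::field) set \<Rightarrow> bool" where
  "is_lrc n k d rs C \<longleftrightarrow>
     linear_code n C \<and> code_dim C = k \<and> has_min_dist n C d \<and>
     (\<forall>i<n. \<exists>R :: nat \<Rightarrow> nat set.
        (\<forall>j<length rs. recovery_set n C i (R j) \<and> card (R j) = rs ! j) \<and>
        disjoint_family_on R {..<length rs})"

end

theory Submission
  imports Defs "HOL-Analysis.Convex" "HOL-Library.Cardinality"
begin

text \<open>
  The code consists of the values of the polynomials \<open>\<Sum> u\<^sub>i\<^sub>j x\<^sup>i y\<^sup>j\<close> with \<open>i \<le> t\<^sub>2\<close> and \<open>j \<le> t\<^sub>1\<close> at the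
  affine rational points with \<open>y \<noteq> 0\<close>. On a line \<open>y = b\<close> such a polynomial has degree at most
  \<open>t\<^sub>2\<close> in \<open>x\<close>, on a line \<open>x = a\<close> it has degree at most \<open>t\<^sub>1\<close> in \<open>y\<close>, so a lost value can be
  interpolated along either line. This works if the lines carry enough points: the line \<open>y = b\<close>
  through \<open>(a, b)\<close> carries the points \<open>(a + w, b)\<close> with \<open>A(w) = 0\<close>, the line \<open>x = a\<close> carries
  the points \<open>(a, z b)\<close> with \<open>z\<^sup>\<beta> = 1\<close>. So the point is to show that \<open>A\<close> and
  \<open>z\<^sup>\<beta> - 1\<close> have \<open>\<alpha>\<close> and \<open>\<beta>\<close> distinct roots in the field of constants \<open>k\<close>.

  This is where maximality enters, through two opposite estimates for the number \<open>N\<close> of affine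
  rational points. Let \<open>w\<close> be the number of roots of \<open>A\<close> in \<open>k\<close> and \<open>\<kappa>\<close> the number of roots
  of \<open>z\<^sup>\<beta> - 1\<close> in \<open>k\<close>. An elementary form of the bound for Gauss sums gives \<open>N \<le> q\<^sup>2 + (w - 1)(\<kappa> - 1) q\<close>
  (\<open>card_power_eq_additive_le\<close>). In the other direction every rational place is either the unique
  place at infinity or determined by its centre, an affine rational point; hence there are at
  most \<open>N + 1\<close> of them (\<open>card_rational_places_le\<close>). As the genus \<open>g\<close> satisfies
  \<open>2 g \<ge> (\<alpha> - 1)(\<beta> - 1)\<close> (\<open>genus_lower_bound\<close>), maximality gives
  \<open>N \<ge> q\<^sup>2 + (\<alpha> - 1)(\<beta> - 1) q\<close>. Since \<open>w \<le> \<alpha>\<close> and \<open>\<kappa> \<le> \<beta>\<close>, equality holds everywhere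
  (\<open>maximal_curve_structure\<close>).

  All facts about the curve are obtained by counting in the spaces \<open>V m\<close> spanned by the monomials
  \<open>x\<^sup>i y\<^sup>j\<close> of weight \<open>\<beta> i + \<alpha> j \<le> m\<close>. The weight is the pole order at infinity, the
  monomials with \<open>j < \<beta>\<close> have distinct weights because \<open>\<alpha>\<close> and \<open>\<beta>\<close> are coprime, and
  \<open>dim V m = m + 1 - (\<alpha> - 1)(\<beta> - 1)/2\<close> for large \<open>m\<close>. The genus estimate follows once the
  space \<open>L(m P)\<close> at the place \<open>P\<close> at infinity is known to lie in \<open>V m\<close>, that is, once a function
  without poles outside \<open>P\<close> is known to be a polynomial in \<open>x\<close> and \<open>y\<close>
  (\<open>regular_outside_infinity\<close>); for this the places are produced from embeddings of the function
  field into Laurent series over the algebraic closure of \<open>k\<close>. The same spaces bound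
  the number of zeros of a function in \<open>V s\<close> by \<open>s\<close> (\<open>card_zeros_le\<close>), which is the estimate for
  the minimum distance.
\<close>

section \<open>Points of \<open>y\<^sup>\<beta> = L(x)\<close> for an additive map \<open>L\<close>\<close>

lemma sum_translate:
  fixes g :: "'k::{ab_group_add, finite} \<Rightarrow> real"
  shows "(\<Sum>u\<in>UNIV. g (u + c)) = (\<Sum>u\<in>UNIV. g u)"
  by (rule sum.reindex_bij_witness[of _ "\<lambda>u. u - c" "\<lambda>u. u + c"]) auto

lemma card_nonzero_power_fibre:
  fixes y :: "'k::{field, finite}"
  assumes "y \<noteq> 0"
  shows "card {z. z ^ n = y ^ n} = card {z::'k. z ^ n = 1}"
  by (rule bij_betw_same_card[of "\<lambda>z. z / y"], rule bij_betw_byWitness[of _ "\<lambda>z. z * y"])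
     (use assms in \<open>auto simp: power_divide power_mult_distrib\<close>)

lemma card_nonzero_power_image:
  fixes \<beta> :: nat
  assumes "\<beta> > 0"
  shows "card ((\<lambda>y. y ^ \<beta>) ` (UNIV - {0 :: 'k::{field, finite}})) * card {z::'k. z ^ \<beta> = 1}
           = card (UNIV :: 'k set) - 1"
proof -
  let ?G = "(\<lambda>y. y ^ \<beta>) ` (UNIV - {0 :: 'k})"
  have fibre: "card {z \<in> UNIV - {0}. z ^ \<beta> = g} = card {z::'k. z ^ \<beta> = 1}" if "g \<in> ?G" for g
  proof -
    from that obtain y where "y \<noteq> 0" "g = y ^ \<beta>" by auto
    moreover from this have "{z \<in> UNIV - {0}. z ^ \<beta> = g} = {z. z ^ \<beta> = y ^ \<beta>}"
      using assms by (auto simp: zero_power)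
    ultimately show ?thesis using card_nonzero_power_fibre[of y \<beta>] by simp
  qed
  have "card (UNIV - {0::'k}) = (\<Sum>z\<in>UNIV - {0::'k}. 1)" by simp
  also have "\<dots> = (\<Sum>g\<in>?G. \<Sum>z\<in>{z \<in> UNIV - {0::'k}. z ^ \<beta> = g}. 1)"
    by (rule sum.group[symmetric]) auto
  also have "\<dots> = (\<Sum>g\<in>?G. card {z \<in> UNIV - {0}. z ^ \<beta> = g})" by simp
  also have "\<dots> = card ?G * card {z::'k. z ^ \<beta> = 1}"
    using fibre by simp
  finally show ?thesis by (simp add: card_Diff_singleton)
qed

text \<open>
  The operators \<open>T\<^sub>a f(u) = \<Sum>\<^sub>y f(u + a y\<^sup>\<beta>)\<close> replace Gauss sums, which are their eigenvalues.
  Their second moment over \<open>a \<noteq> 0\<close> is computed exactly: after expanding the square, a pair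
  \<open>(y, z)\<close> contributes the sum of the autocorrelation of \<open>f\<close> over all nonzero multiples of
  \<open>z\<^sup>\<beta> - y\<^sup>\<beta>\<close>, which depends only on whether this difference is zero.
\<close>

lemma sum_power_correlation:
  fixes f :: "'k::{field, finite} \<Rightarrow> real" and \<beta> :: nat
  defines "Q \<equiv> real (card (UNIV :: 'k set))"
    and "\<kappa> \<equiv> real (card {z::'k. z ^ \<beta> = 1})"
  assumes mean: "(\<Sum>u\<in>UNIV. f u) = 0" and "\<beta> > 0"
  shows "(\<Sum>a\<in>UNIV - {0}. \<Sum>u\<in>UNIV. (\<Sum>y\<in>UNIV. f (u + a * y ^ \<beta>))\<^sup>2)
           = Q * (Q - 1) * (\<kappa> - 1) * (\<Sum>u\<in>UNIV. (f u)\<^sup>2)"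
proof -
  define R where "R t = (\<Sum>u\<in>UNIV. f u * f (u + t))" for t
  let ?S = "\<Sum>u\<in>UNIV. (f u)\<^sup>2"
  have R0: "R 0 = ?S" by (simp add: R_def power2_eq_square)
  have "(\<Sum>t\<in>UNIV. R t) = (\<Sum>u\<in>UNIV. f u * (\<Sum>t\<in>UNIV. f (t + u)))"
    unfolding R_def by (subst sum.swap) (simp add: sum_distrib_left add.commute)
  also have "\<dots> = 0" by (simp add: sum_translate mean)
  finally have "(\<Sum>t\<in>UNIV. R t) = 0" .
  then have Rn: "(\<Sum>t\<in>UNIV - {0}. R t) = - ?S"
    by (simp add: sum_diff1 R0)
  have inner: "(\<Sum>u\<in>UNIV. (\<Sum>y\<in>UNIV. f (u + a * y ^ \<beta>))\<^sup>2)
      = (\<Sum>y\<in>UNIV. \<Sum>z\<in>UNIV. R (a * (z ^ \<beta> - y ^ \<beta>)))" for a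
  proof -
    have "(\<Sum>u\<in>UNIV. (\<Sum>y\<in>UNIV. f (u + a * y ^ \<beta>))\<^sup>2)
       = (\<Sum>u\<in>UNIV. \<Sum>y\<in>UNIV. \<Sum>z\<in>UNIV. f (u + a * y ^ \<beta>) * f (u + a * z ^ \<beta>))"
      by (simp add: power2_eq_square sum_product)
    also have "\<dots> = (\<Sum>y\<in>UNIV. \<Sum>u\<in>UNIV. \<Sum>z\<in>UNIV. f (u + a * y ^ \<beta>) * f (u + a * z ^ \<beta>))"
      by (rule sum.swap)
    also have "\<dots> = (\<Sum>y\<in>UNIV. \<Sum>z\<in>UNIV. \<Sum>u\<in>UNIV. f (u + a * y ^ \<beta>) * f (u + a * z ^ \<beta>))"
      by (intro sum.cong refl sum.swap)
    also have "\<dots> = (\<Sum>y\<in>UNIV. \<Sum>z\<in>UNIV. R (a * (z ^ \<beta> - y ^ \<beta>)))"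
    proof (intro sum.cong refl)
      fix y z :: 'k
      have "R (a * (z ^ \<beta> - y ^ \<beta>))
          = (\<Sum>u\<in>UNIV. f (u + a * y ^ \<beta>) * f (u + a * y ^ \<beta> + a * (z ^ \<beta> - y ^ \<beta>)))"
        unfolding R_def
        by (rule sum_translate[of "\<lambda>u. f u * f (u + a * (z ^ \<beta> - y ^ \<beta>))", symmetric])
      then show "(\<Sum>u\<in>UNIV. f (u + a * y ^ \<beta>) * f (u + a * z ^ \<beta>)) = R (a * (z ^ \<beta> - y ^ \<beta>))"
        by (simp add: algebra_simps)
    qed
    finally show ?thesis .
  qed
  have pair: "(\<Sum>a\<in>UNIV - {0}. R (a * c)) = (if c = 0 then (Q - 1) * ?S else - ?S)" for c
  proof (cases "c = 0")
    case False
    then have "(\<Sum>a\<in>UNIV - {0}. R (a * c)) = (\<Sum>t\<in>UNIV - {0}. R t)"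
      by (intro sum.reindex_bij_witness[of _ "\<lambda>t. t / c" "\<lambda>a. a * c"]) auto
    with False show ?thesis by (simp add: Rn)
  next
    case True
    then show ?thesis by (simp add: R0 Q_def card_Diff_singleton of_nat_diff card_gt_0_iff Suc_leI)
  qed
  have count: "(\<Sum>z\<in>UNIV. if z ^ \<beta> - y ^ \<beta> = 0 then (Q - 1) * ?S else - ?S)
      = Q * ?S * real (card {z. z ^ \<beta> = y ^ \<beta>}) - Q * ?S" for y :: 'k
  proof -
    have "(\<Sum>z\<in>UNIV. if z ^ \<beta> - y ^ \<beta> = 0 then (Q - 1) * ?S else - ?S)
       = (\<Sum>z\<in>UNIV. (if z ^ \<beta> = y ^ \<beta> then Q * ?S else 0) - ?S)"
      by (intro sum.cong) (auto simp: algebra_simps)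
    also have "\<dots> = Q * ?S * real (card {z. z ^ \<beta> = y ^ \<beta>}) - Q * ?S"
      by (simp add: sum_subtractf Q_def flip: sum.inter_filter)
    finally show ?thesis .
  qed
  have c0: "card {z::'k. z ^ \<beta> = 0 ^ \<beta>} = 1"
  proof -
    have "{z::'k. z ^ \<beta> = 0 ^ \<beta>} = {0}" using \<open>\<beta> > 0\<close> by (auto simp: zero_power)
    then show ?thesis by simp
  qed
  have "(\<Sum>y\<in>(UNIV::'k set). real (card {z. z ^ \<beta> = y ^ \<beta>}))
      = real (card {z::'k. z ^ \<beta> = 0 ^ \<beta>}) + (\<Sum>y\<in>UNIV - {0::'k}. real (card {z. z ^ \<beta> = y ^ \<beta>}))"
    by (rule sum.remove) auto
  also have "\<dots> = 1 + (\<Sum>y\<in>UNIV - {0::'k}. \<kappa>)"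
    unfolding \<kappa>_def c0 by (simp add: card_nonzero_power_fibre)
  also have "\<dots> = 1 + (Q - 1) * \<kappa>"
    by (simp add: Q_def card_Diff_singleton of_nat_diff card_gt_0_iff Suc_leI)
  finally have E: "(\<Sum>y\<in>(UNIV::'k set). real (card {z. z ^ \<beta> = y ^ \<beta>})) = 1 + (Q - 1) * \<kappa>" .
  have "(\<Sum>a\<in>UNIV - {0}. \<Sum>u\<in>UNIV. (\<Sum>y\<in>UNIV. f (u + a * y ^ \<beta>))\<^sup>2)
      = (\<Sum>y\<in>UNIV. \<Sum>a\<in>UNIV - {0}. \<Sum>z\<in>UNIV. R (a * (z ^ \<beta> - y ^ \<beta>)))"
    unfolding inner by (rule sum.swap)
  also have "\<dots> = (\<Sum>y\<in>UNIV. \<Sum>z\<in>UNIV. \<Sum>a\<in>UNIV - {0}. R (a * (z ^ \<beta> - y ^ \<beta>)))"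
    by (intro sum.cong refl sum.swap)
  also have "\<dots> = (\<Sum>y\<in>(UNIV::'k set). Q * ?S * real (card {z. z ^ \<beta> = y ^ \<beta>}) - Q * ?S)"
    unfolding pair count ..
  also have "\<dots> = Q * ?S * (1 + (Q - 1) * \<kappa>) - Q * (Q * ?S)"
    unfolding sum_subtractf E[symmetric] sum_distrib_left by (simp add: Q_def sum_distrib_left)
  finally show ?thesis by (simp add: algebra_simps)
qed

text \<open>
  For \<open>a \<noteq> 0\<close> the operator \<open>T\<^sub>a\<close> depends only on the class of \<open>a\<close> modulo \<open>\<beta>\<close>-th powers.
  There are \<open>\<kappa>\<close> classes of equal size, and the sum of their operators vanishes on functions of mean zero. Thus \<open>T\<^sub>1\<close> is minus
  the sum of the \<open>\<kappa> - 1\<close> others, and the Cauchy-Schwarz inequality turns the second moment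
  into a bound for \<open>T\<^sub>1\<close> alone.
\<close>

lemma power_sum_operator_bound:
  fixes f :: "'k::{field, finite} \<Rightarrow> real" and \<beta> :: nat
  defines "Q \<equiv> real (card (UNIV :: 'k set))"
    and "\<kappa> \<equiv> real (card {z::'k. z ^ \<beta> = 1})"
  assumes mean: "(\<Sum>u\<in>UNIV. f u) = 0" and "\<beta> > 0"
  shows "(\<Sum>u\<in>UNIV. (\<Sum>y\<in>UNIV. f (u + y ^ \<beta>))\<^sup>2) \<le> (\<kappa> - 1)\<^sup>2 * Q * (\<Sum>u\<in>UNIV. (f u)\<^sup>2)"
proof -
  define T where "T a u = (\<Sum>y\<in>UNIV. f (u + a * y ^ \<beta>))" for a u
  define G where "G = (\<lambda>y. y ^ \<beta>) ` (UNIV - {0 :: 'k})"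
  define \<tau> where "\<tau> = (\<Sum>u\<in>UNIV. (T 1 u)\<^sup>2)"
  let ?S = "\<Sum>u\<in>UNIV. (f u)\<^sup>2"
  let ?g = "real (card G)" and ?B = "UNIV - {0} - G"
  have G0: "G \<subseteq> UNIV - {0}" by (auto simp: G_def)
  have "1 \<in> G" by (auto simp: G_def image_iff intro!: bexI[of _ 1])
  then have g: "?g \<ge> 1" by (metis One_nat_def Suc_leI card_gt_0_iff empty_iff finite of_nat_1 of_nat_mono)
  have "card {z::'k. z ^ \<beta> = 1} \<ge> 1"
    by (metis (mono_tags, lifting) One_nat_def Suc_leI card_gt_0_iff empty_iff finite mem_Collect_eq power_one)
  then have \<kappa>: "\<kappa> \<ge> 1" by (simp add: \<kappa>_def)
  have "?g * \<kappa> = real (card (UNIV :: 'k set) - 1)"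
    unfolding G_def \<kappa>_def using card_nonzero_power_image[OF \<open>\<beta> > 0\<close>, where 'k = 'k]
    by (metis of_nat_mult)
  then have Qg: "Q = ?g * \<kappa> + 1"
    by (simp add: Q_def of_nat_diff card_gt_0_iff Suc_leI)
  \<comment> \<open>multiplying by a nonzero power permutes the powers\<close>
  have TG: "T a = T 1" if "a \<in> G" for a
  proof
    fix u
    from that obtain c where "c \<noteq> 0" "a = c ^ \<beta>" by (auto simp: G_def)
    then show "T a u = T 1 u" unfolding T_def
      by (intro sum.reindex_bij_witness[of _ "\<lambda>y. y / c" "\<lambda>y. c * y"])
         (auto simp: power_mult_distrib power_divide)
  qed
  have sum0: "(\<Sum>a\<in>UNIV - {0}. T a u) = 0" for u
  proof -
    have *: "(\<Sum>a\<in>UNIV - {0}. f (u + a * y ^ \<beta>))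
        = (if y = 0 then (Q - 1) * f u else - f u)" for y
    proof (cases "y = 0")
      case True
      then show ?thesis using \<open>\<beta> > 0\<close>
        by (simp add: zero_power Q_def card_Diff_singleton of_nat_diff card_gt_0_iff Suc_leI)
    next
      case False
      then have "(\<Sum>a\<in>UNIV. f (u + a * y ^ \<beta>)) = (\<Sum>t\<in>UNIV. f t)"
        by (intro sum.reindex_bij_witness[of _ "\<lambda>t. (t - u) / y ^ \<beta>" "\<lambda>a. u + a * y ^ \<beta>"]) auto
      with False show ?thesis by (simp add: sum_diff1 mean)
    qed
    have "(\<Sum>a\<in>UNIV - {0}. T a u) = (\<Sum>y\<in>UNIV. \<Sum>a\<in>UNIV - {0}. f (u + a * y ^ \<beta>))"
      unfolding T_def by (rule sum.swap)
    also have "\<dots> = (\<Sum>y\<in>UNIV. if y = (0::'k) then (Q - 1) * f u else - f u)"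
      unfolding * ..
    also have "\<dots> = (\<Sum>y\<in>UNIV. (if y = (0::'k) then Q * f u else 0) - f u)"
      by (intro sum.cong) (auto simp: algebra_simps)
    also have "\<dots> = 0" by (simp add: sum_subtractf Q_def)
    finally show ?thesis .
  qed
  have split: "(\<Sum>a\<in>UNIV - {0}. h a) = (\<Sum>a\<in>G. h a) + (\<Sum>a\<in>?B. h a)" for h :: "'k \<Rightarrow> real"
    using sum.subset_diff[OF G0, of h] by simp
  have gT: "(?g * T 1 u)\<^sup>2 \<le> ?g * (\<kappa> - 1) * (\<Sum>a\<in>?B. (T a u)\<^sup>2)" for u
  proof -
    have "(\<Sum>a\<in>G. T a u) = ?g * T 1 u" by (simp add: TG)
    then have "?g * T 1 u = - (\<Sum>a\<in>?B. T a u)"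
      using sum0[of u] split[of "\<lambda>a. T a u"] by simp
    then have "(?g * T 1 u)\<^sup>2 = (\<Sum>a\<in>?B. 1 * T a u)\<^sup>2" by simp
    also have "\<dots> \<le> (\<Sum>a\<in>?B. 1\<^sup>2) * (\<Sum>a\<in>?B. (T a u)\<^sup>2)"
      by (rule Cauchy_Schwarz_ineq_sum)
    also have "(\<Sum>a\<in>?B. 1\<^sup>2) = ?g * (\<kappa> - 1)"
    proof -
      have "card ?B = card (UNIV :: 'k set) - 1 - card G"
        using G0 by (simp add: card_Diff_subset card_Diff_singleton)
      moreover have "card G \<le> card (UNIV :: 'k set) - 1"
        using card_mono[OF _ G0] by (simp add: card_Diff_singleton)
      moreover have "card (UNIV :: 'k set) \<ge> 1" by (simp add: card_gt_0_iff Suc_leI)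
      ultimately have "real (card ?B) = Q - 1 - ?g"
        unfolding Q_def by linarith
      then show ?thesis by (simp add: Qg algebra_simps)
    qed
    finally show ?thesis .
  qed
  have "?g\<^sup>2 * \<tau> = (\<Sum>u\<in>UNIV. (?g * T 1 u)\<^sup>2)"
    by (simp add: \<tau>_def power_mult_distrib sum_distrib_left)
  also have "\<dots> \<le> (\<Sum>u\<in>UNIV. ?g * (\<kappa> - 1) * (\<Sum>a\<in>?B. (T a u)\<^sup>2))"
    by (intro sum_mono gT)
  also have "\<dots> = ?g * (\<kappa> - 1) * (\<Sum>a\<in>?B. \<Sum>u\<in>UNIV. (T a u)\<^sup>2)"
    unfolding sum_distrib_left[symmetric] by (subst sum.swap) rule
  also have "(\<Sum>a\<in>?B. \<Sum>u\<in>UNIV. (T a u)\<^sup>2) = Q * (Q - 1) * (\<kappa> - 1) * ?S - ?g * \<tau>"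
  proof -
    have "(\<Sum>a\<in>UNIV - {0}. \<Sum>u\<in>UNIV. (T a u)\<^sup>2) = Q * (Q - 1) * (\<kappa> - 1) * ?S"
      unfolding T_def Q_def \<kappa>_def by (rule sum_power_correlation[OF mean \<open>\<beta> > 0\<close>])
    moreover have "(\<Sum>a\<in>G. \<Sum>u\<in>UNIV. (T a u)\<^sup>2) = ?g * \<tau>" by (simp add: TG \<tau>_def)
    ultimately show ?thesis using split[of "\<lambda>a. \<Sum>u\<in>UNIV. (T a u)\<^sup>2"] by simp
  qed
  finally have "?g\<^sup>2 * (\<kappa> * \<tau>) \<le> ?g\<^sup>2 * (\<kappa> * ((\<kappa> - 1)\<^sup>2 * Q * ?S))"
    by (simp add: Qg algebra_simps power2_eq_square)
  then have "\<kappa> * \<tau> \<le> \<kappa> * ((\<kappa> - 1)\<^sup>2 * Q * ?S)" by (rule mult_left_le_imp_le) (use g in auto)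
  then have "\<tau> \<le> (\<kappa> - 1)\<^sup>2 * Q * ?S" by (rule mult_left_le_imp_le) (use \<kappa> in auto)
  then show ?thesis by (simp add: \<tau>_def T_def)
qed

text \<open>
  The deviation of the number of solutions of \<open>b\<^sup>\<beta> = L a\<close> from \<open>q\<^sup>2\<close> is \<open>T f(0)\<close>, where
  \<open>f(u)\<close> is the number of preimages of \<open>u\<close> under \<open>L\<close>, minus 1. As \<open>f\<close> and hence \<open>T f\<close> are invariant under
  the image of \<open>L\<close>, this single value is recovered from the inner product of \<open>f\<close> and
  \<open>T f\<close>, so that no factor is lost against the norm bound.
\<close>

theorem card_power_eq_additive_le:
  fixes L :: "'k::{field, finite} \<Rightarrow> 'k" and q \<beta> :: nat
  assumes add: "\<And>a b. L (a + b) = L a + L b" and Q: "card (UNIV :: 'k set) = q\<^sup>2" and "\<beta> > 0"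
  shows "real (card {(a, b). b ^ \<beta> = L a})
           \<le> real q ^ 2 + (real (card {w. L w = 0}) - 1) * (real (card {z::'k. z ^ \<beta> = 1}) - 1) * real q"
proof -
  define c where "c u = real (card {a. L a = u})" for u
  define f where "f u = c u - 1" for u
  define T where "T u = (\<Sum>y\<in>UNIV. f (u + y ^ \<beta>))" for u
  let ?Q = "real (card (UNIV :: 'k set))" and ?w = "real (card {w. L w = 0})"
    and ?\<kappa> = "real (card {z::'k. z ^ \<beta> = 1})"
  have Qpos: "?Q > 0" by (simp add: card_gt_0_iff)
  have L0: "L 0 = 0" using add[of 0 0] by (metis add_cancel_right_right)
  have "0 \<in> {w. L w = 0}" by (simp add: L0)
  then have "card {w. L w = 0} \<ge> 1" by (metis One_nat_def Suc_leI card_gt_0_iff empty_iff finite)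
  then have w: "?w \<ge> 1" by simp
  have "1 \<in> {z::'k. z ^ \<beta> = 1}" by simp
  then have "card {z::'k. z ^ \<beta> = 1} \<ge> 1" by (metis One_nat_def Suc_leI card_gt_0_iff empty_iff finite)
  then have \<kappa>: "?\<kappa> \<ge> 1" by simp
  have sum_c: "(\<Sum>u\<in>UNIV. h u * c u) = (\<Sum>a\<in>UNIV. h (L a))" for h :: "'k \<Rightarrow> real"
  proof -
    have "(\<Sum>a\<in>UNIV. h (L a)) = (\<Sum>u\<in>UNIV. \<Sum>a\<in>{a \<in> UNIV. L a = u}. h (L a))"
      by (rule sum.group[symmetric]) auto
    also have "\<dots> = (\<Sum>u\<in>UNIV. h u * c u)"
      by (intro sum.cong refl) (simp add: c_def mult.commute)
    finally show ?thesis by simp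
  qed
  have c_shift: "c (v + L a) = c v" for v a
  proof -
    have "card {b. L b = v + L a} = card {b. L b = v}"
      by (rule bij_betw_same_card[of "\<lambda>b. b - a"], rule bij_betw_byWitness[of _ "\<lambda>b. b + a"])
         (auto simp: add, metis add_diff_cancel_right' add diff_add_cancel)
    then show ?thesis by (simp add: c_def)
  qed
  have cL: "c (L a) = ?w" for a using c_shift[of 0 a] by (simp add: c_def)
  have mean: "(\<Sum>u\<in>UNIV. f u) = 0"
    using sum_c[of "\<lambda>_. 1"] by (simp add: f_def sum_subtractf)
  have sq: "(\<Sum>u\<in>UNIV. (f u)\<^sup>2) = ?Q * (?w - 1)"
  proof -
    have "(\<Sum>u\<in>UNIV. (f u)\<^sup>2) = (\<Sum>u\<in>UNIV. (c u - 2) * c u) + ?Q"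
      by (simp add: f_def power2_eq_square algebra_simps sum.distrib sum_subtractf)
    also have "(\<Sum>u\<in>UNIV. (c u - 2) * c u) = ?Q * (?w - 2)"
      unfolding sum_c by (simp add: cL)
    finally show ?thesis by (simp add: algebra_simps)
  qed
  have "(\<Sum>u\<in>UNIV. T u) = (\<Sum>y\<in>UNIV. \<Sum>u\<in>UNIV. f (u + y ^ \<beta>))"
    unfolding T_def by (rule sum.swap)
  then have T0: "(\<Sum>u\<in>UNIV. T u) = 0" by (simp add: sum_translate mean)
  have TL: "T (L a) = T 0" for a
    unfolding T_def f_def by (simp add: add.commute[of "L a"] c_shift)
  have inner: "(\<Sum>u\<in>UNIV. f u * T u) = ?Q * T 0"
  proof -
    have "(\<Sum>u\<in>UNIV. f u * T u) = (\<Sum>u\<in>UNIV. T u * c u) - (\<Sum>u\<in>UNIV. T u)"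
      by (simp add: f_def algebra_simps sum_subtractf)
    also have "\<dots> = ?Q * T 0" unfolding sum_c T0 by (simp add: TL)
    finally show ?thesis .
  qed
  have "(?Q * T 0)\<^sup>2 \<le> (\<Sum>u\<in>UNIV. (f u)\<^sup>2) * (\<Sum>u\<in>UNIV. (T u)\<^sup>2)"
    unfolding inner[symmetric] by (rule Cauchy_Schwarz_ineq_sum)
  also have "\<dots> \<le> ?Q * (?w - 1) * ((?\<kappa> - 1)\<^sup>2 * ?Q * (?Q * (?w - 1)))"
    using power_sum_operator_bound[OF mean \<open>\<beta> > 0\<close>] w
    by (intro mult_mono) (auto simp: sq T_def intro!: sum_nonneg)
  also have "\<dots> = (?Q * ((?w - 1) * (?\<kappa> - 1) * real q))\<^sup>2"
    by (simp add: Q power2_eq_square algebra_simps)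
  finally have "?Q * T 0 \<le> ?Q * ((?w - 1) * (?\<kappa> - 1) * real q)"
    by (rule power2_le_imp_le) (use w \<kappa> in auto)
  then have bound: "T 0 \<le> (?w - 1) * (?\<kappa> - 1) * real q"
    using Qpos by (simp add: mult_le_cancel_left)
  have "card {(a, b). b ^ \<beta> = L a} = (\<Sum>b\<in>UNIV. card {a. L a = b ^ \<beta>})"
  proof -
    have "{(a, b). b ^ \<beta> = L a} = prod.swap ` (SIGMA b:UNIV. {a. L a = b ^ \<beta>})"
      by (auto simp: image_iff)
    then have "card {(a, b). b ^ \<beta> = L a} = card (SIGMA b:UNIV. {a. L a = b ^ \<beta>})"
      by (simp add: card_image)
    then show ?thesis by simp
  qed
  then have "real (card {(a, b). b ^ \<beta> = L a}) = T 0 + ?Q"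
    by (simp add: T_def f_def c_def sum_subtractf)
  with bound show ?thesis by (simp add: Q)
qed

section \<open>Power series solutions of polynomial equations\<close>

text \<open>
  The predicate \<open>field_embedding\<close> for arbitrary commutative rings: evaluation of polynomials in
  two variables is an iterated evaluation whose inner stage starts from a polynomial ring.
\<close>

definition unital_hom :: "('a::comm_ring_1 \<Rightarrow> 'b::comm_ring_1) \<Rightarrow> bool" where
  "unital_hom \<phi> \<longleftrightarrow>
     \<phi> 1 = 1 \<and> (\<forall>a b. \<phi> (a + b) = \<phi> a + \<phi> b) \<and> (\<forall>a b. \<phi> (a * b) = \<phi> a * \<phi> b)"

lemma unital_hom_one: "unital_hom \<phi> \<Longrightarrow> \<phi> 1 = 1"
  and unital_hom_add: "unital_hom \<phi> \<Longrightarrow> \<phi> (a + b) = \<phi> a + \<phi> b"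
  and unital_hom_mult: "unital_hom \<phi> \<Longrightarrow> \<phi> (a * b) = \<phi> a * \<phi> b"
  by (auto simp: unital_hom_def)

lemma unital_hom_zero: "unital_hom \<phi> \<Longrightarrow> \<phi> 0 = 0"
  using unital_hom_add[of \<phi> 0 0] by (metis add_cancel_right_right)

lemma unital_hom_uminus: "unital_hom \<phi> \<Longrightarrow> \<phi> (- a) = - \<phi> a"
  using unital_hom_add[of \<phi> a "- a"] by (simp add: unital_hom_zero eq_neg_iff_add_eq_0 add.commute)

lemma unital_hom_diff: "unital_hom \<phi> \<Longrightarrow> \<phi> (a - b) = \<phi> a - \<phi> b"
  using unital_hom_add[of \<phi> a "- b"] by (simp add: unital_hom_uminus)

lemma unital_hom_power: "unital_hom \<phi> \<Longrightarrow> \<phi> (a ^ n) = \<phi> a ^ n"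
  by (induction n) (simp_all add: unital_hom_one unital_hom_mult)

lemma unital_hom_sum: "unital_hom \<phi> \<Longrightarrow> \<phi> (sum f S) = (\<Sum>s\<in>S. \<phi> (f s))"
  by (induction S rule: infinite_finite_induct) (simp_all add: unital_hom_zero unital_hom_add)

lemmas unital_hom_simps = unital_hom_one unital_hom_zero unital_hom_add unital_hom_mult
  unital_hom_uminus unital_hom_diff unital_hom_power unital_hom_sum

lemma unital_hom_eq_0_iff:
  fixes \<phi> :: "'a::field \<Rightarrow> 'b::comm_ring_1"
  assumes "unital_hom \<phi>"
  shows "\<phi> a = 0 \<longleftrightarrow> a = 0"
proof
  assume "\<phi> a = 0"
  show "a = 0"
  proof (rule ccontr)
    assume "a \<noteq> 0"
    then have "\<phi> a * \<phi> (inverse a) = 1"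
      using assms by (simp flip: unital_hom_mult add: unital_hom_one)
    with \<open>\<phi> a = 0\<close> show False by simp
  qed
qed (use assms in \<open>simp add: unital_hom_zero\<close>)

lemma unital_hom_inverse:
  fixes \<phi> :: "'a::field \<Rightarrow> 'b::field"
  assumes "unital_hom \<phi>"
  shows "\<phi> (inverse a) = inverse (\<phi> a)"
proof (cases "a = 0")
  case False
  then have "\<phi> a * \<phi> (inverse a) = 1"
    using assms by (simp flip: unital_hom_mult add: unital_hom_one)
  then show ?thesis by (metis inverse_unique)
qed (simp add: assms unital_hom_zero)

lemma field_embedding_unital_hom: "field_embedding \<iota> \<Longrightarrow> unital_hom \<iota>"
  by (simp add: field_embedding_def unital_hom_def)

definition poly_at :: "('a::comm_ring_1 \<Rightarrow> 'b::comm_ring_1) \<Rightarrow> 'b \<Rightarrow> 'a poly \<Rightarrow> 'b" where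
  "poly_at \<phi> z p = poly (map_poly \<phi> p) z"

lemma eval_bivariate_poly_at: "eval_bivariate \<iota> x y g = poly_at (poly_at \<iota> x) y g"
  by (simp add: eval_bivariate_def poly_at_def [abs_def])

lemma poly_at_0 [simp]: "poly_at \<phi> z 0 = 0"
  by (simp add: poly_at_def)

lemma poly_at_pCons: "unital_hom \<phi> \<Longrightarrow> poly_at \<phi> z (pCons a p) = \<phi> a + z * poly_at \<phi> z p"
  by (simp add: poly_at_def map_poly_pCons unital_hom_zero)

lemma poly_at_sum:
  "unital_hom \<phi> \<Longrightarrow> poly_at \<phi> z p = (\<Sum>i\<le>degree p. \<phi> (coeff p i) * z ^ i)"
proof -
  assume "unital_hom \<phi>"
  then have "poly_at \<phi> z p = (\<Sum>i\<le>degree (map_poly \<phi> p). \<phi> (coeff p i) * z ^ i)"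
    by (simp add: poly_at_def poly_altdef coeff_map_poly unital_hom_zero)
  also have "\<dots> = (\<Sum>i\<le>degree p. \<phi> (coeff p i) * z ^ i)"
  proof (rule sum.mono_neutral_left)
    show "\<forall>i\<in>{..degree p} - {..degree (map_poly \<phi> p)}. \<phi> (coeff p i) * z ^ i = 0"
      using \<open>unital_hom \<phi>\<close> coeff_eq_0[of "map_poly \<phi> p"]
      by (auto simp: coeff_map_poly unital_hom_zero)
  qed (auto simp: map_poly_degree_leq)
  finally show ?thesis .
qed

lemma poly_at_add:
  "unital_hom \<phi> \<Longrightarrow> poly_at \<phi> z (p + r) = poly_at \<phi> z p + poly_at \<phi> z r"
  by (induction p r rule: poly_induct2) (simp_all add: poly_at_pCons unital_hom_simps algebra_simps)

lemma poly_at_smult: "unital_hom \<phi> \<Longrightarrow> poly_at \<phi> z (smult c p) = \<phi> c * poly_at \<phi> z p"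
  by (induction p) (simp_all add: poly_at_pCons unital_hom_simps algebra_simps)

lemma poly_at_mult:
  "unital_hom \<phi> \<Longrightarrow> poly_at \<phi> z (p * r) = poly_at \<phi> z p * poly_at \<phi> z r"
  by (induction p) (simp_all add: poly_at_pCons poly_at_add poly_at_smult unital_hom_simps algebra_simps)

lemma poly_at_const [simp]: "unital_hom \<phi> \<Longrightarrow> poly_at \<phi> z [:c:] = \<phi> c"
  by (simp add: poly_at_pCons)

lemma poly_at_monom: "unital_hom \<phi> \<Longrightarrow> poly_at \<phi> z (Polynomial.monom c n) = \<phi> c * z ^ n"
  by (simp add: poly_at_def map_poly_monom unital_hom_zero poly_monom)

lemma unital_hom_poly_at:
  assumes "unital_hom \<phi>" shows "unital_hom (poly_at \<phi> z)"
  using assms poly_at_const[OF assms, of z 1]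
  by (simp add: unital_hom_def poly_at_add[OF assms] poly_at_mult[OF assms] flip: one_pCons)

lemma unital_hom_comp: "unital_hom \<phi> \<Longrightarrow> unital_hom \<psi> \<Longrightarrow> unital_hom (\<lambda>a. \<psi> (\<phi> a))"
  by (simp add: unital_hom_def)

lemma poly_at_comp:
  "unital_hom \<phi> \<Longrightarrow> unital_hom \<psi> \<Longrightarrow> poly_at (\<lambda>a. \<psi> (\<phi> a)) z p = poly_at \<psi> z (map_poly \<phi> p)"
  by (simp add: poly_at_def map_poly_map_poly unital_hom_zero comp_def)

lemma unital_hom_fps_const: "unital_hom (fps_const :: 'a::comm_ring_1 \<Rightarrow> 'a fps)"
  by (simp add: unital_hom_def flip: fps_const_add fps_const_mult)

lemma unital_hom_fps_to_fls: "unital_hom (fps_to_fls :: 'a::comm_ring_1 fps \<Rightarrow> 'a fls)"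
  by (simp add: unital_hom_def fls_times_fps_to_fls)

lemma unital_hom_fls_const: "unital_hom (fls_const :: 'a::comm_ring_1 \<Rightarrow> 'a fls)"
  by (simp add: unital_hom_def fls_plus_const fls_const_mult_const)

lemma unital_hom_to_ac: "unital_hom (to_ac :: 'a::field \<Rightarrow> 'a alg_closure)"
  by (simp add: unital_hom_def)

lemma poly_expand_at:
  fixes p :: "'a::idom poly"
  obtains u where "p = [:poly p a:] + [:- a, 1:] * u" "poly u a = poly (pderiv p) a"
proof -
  let ?u = "synthetic_div p a"
  have eq: "p = [:poly p a:] + [:- a, 1:] * ?u"
    using synthetic_div_correct'[of a p] by (simp add: algebra_simps)
  have "pderiv [:- a, 1:] = 1" by (simp add: pderiv_pCons one_pCons)
  then have "pderiv p = ?u + [:- a, 1:] * pderiv ?u"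
    by (subst eq) (simp add: pderiv_add pderiv_mult pderiv_pCons del: mult_pCons_left mult_pCons_right)
  then have "poly (pderiv p) a = poly ?u a" by simp
  with eq show ?thesis by (intro that[of ?u]) simp_all
qed

text \<open>
  The map \<open>F \<mapsto> C + X P(F)\<close> is a contraction in the \<open>X\<close>-adic topology, since \<open>F - F'\<close>
  divides \<open>P(F) - P(F')\<close>. Both kinds of branches of the curve arise as such fixed points.
\<close>

lemma fps_polynomial_fixpoint:
  fixes P :: "'a::idom fps poly"
  obtains F where "F = C + fps_X * poly P F"
proof -
  define step where "step F = C + fps_X * poly P F" for F
  have contract: "fps_X ^ Suc n dvd step F - step F'" if "fps_X ^ n dvd F - F'" for F F' n
  proof -
    obtain u where "P = [:poly P F':] + [:- F', 1:] * u" by (rule poly_expand_at)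
    then have "poly P F = poly [:poly P F':] F + poly [:- F', 1:] F * poly u F"
      by (metis poly_add poly_mult)
    then have "poly P F - poly P F' = (F - F') * poly u F" by (simp add: algebra_simps)
    then have "step F - step F' = fps_X * ((F - F') * poly u F)"
      by (simp add: step_def flip: right_diff_distrib)
    then show ?thesis using that by (metis dvd_mult2 mult_dvd_mono dvd_refl power_Suc)
  qed
  define s where "s n = (step ^^ n) 0" for n
  have s_Suc: "s (Suc n) = step (s n)" for n by (simp add: s_def)
  have cauchy: "fps_X ^ n dvd s (Suc n) - s n" for n
  proof (induction n)
    case (Suc n)
    from contract[OF this] show ?case by (simp only: s_Suc)
  qed simp
  have nth0: "f $ k = 0" if "fps_X ^ n dvd f" "k < n" for f :: "'a fps" and k n
    using that by (auto simp: fps_X_power_mult_nth elim!: dvdE)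
  have stable: "s (Suc (k + m)) $ k = s (Suc k) $ k" for k m
  proof (induction m)
    case (Suc m)
    from nth0[OF cauchy[of "Suc (k + m)"], of k] Suc show ?case by simp
  qed simp
  define F where "F = Abs_fps (\<lambda>n. s (Suc n) $ n)"
  have lim: "fps_X ^ n dvd F - s n" for n
  proof -
    have "F $ k = s n $ k" if "k < n" for k
      using that stable[of k "n - Suc k"] by (simp add: F_def)
    then have "F - s n = fps_X ^ n * fps_shift n (F - s n)"
      by (intro fps_ext) (simp add: fps_X_power_mult_nth)
    then show ?thesis by (metis dvd_triv_left)
  qed
  have "F = step F"
  proof (rule fps_ext)
    fix k
    have "fps_X ^ Suc k dvd (F - s (Suc k)) - (step F - step (s k))"
      using lim[of "Suc k"] contract[OF lim[of k]] by (rule dvd_diff)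
    from nth0[OF this, of k] show "F $ k = step F $ k" by (simp add: s_Suc)
  qed
  then show ?thesis by (intro that) (simp add: step_def)
qed

text \<open>
  Hensel's lemma at a point where \<open>p\<close> has a simple zero in \<open>x\<close>: writing \<open>x = a + t \<eta>\<close> and
  \<open>y = b + t\<close>, the equation divided by \<open>t\<close> has the linear term \<open>p'(a) \<eta>\<close> and all other
  occurrences of \<open>\<eta>\<close> carry a factor \<open>t\<close>.
\<close>

lemma hensel_branch:
  fixes p :: "'a::field poly"
  assumes "poly p a = b ^ m" and "poly (pderiv p) a \<noteq> 0"
  obtains \<xi> where "\<xi> $ 0 = a" "poly_at fps_const \<xi> p = (fps_const b + fps_X) ^ m"
proof -
  note hom = unital_hom_fps_const[where 'a = 'a]
  define c where "c = poly (pderiv p) a"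
  obtain u where u: "p = [:poly p a:] + [:- a, 1:] * u" "poly u a = c"
    unfolding c_def by (rule poly_expand_at)
  obtain r where r: "u = [:poly u a:] + [:- a, 1:] * r" by (rule poly_expand_at)
  have taylor: "poly_at fps_const z p
      = fps_const (b ^ m) + (z - fps_const a) * (fps_const c + (z - fps_const a) * poly_at fps_const z r)" for z
  proof -
    have "poly_at fps_const z u = fps_const c + (z - fps_const a) * poly_at fps_const z r"
      by (subst r) (simp add: poly_at_add poly_at_mult poly_at_pCons hom u(2) unital_hom_simps del: fps_const_neg mult_pCons_left mult_pCons_right)
    moreover have "poly_at fps_const z p = fps_const (poly p a) + (z - fps_const a) * poly_at fps_const z u"
      by (subst u(1)) (simp add: poly_at_add poly_at_mult poly_at_pCons hom unital_hom_simps del: fps_const_neg mult_pCons_left mult_pCons_right)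
    ultimately show ?thesis by (simp add: assms)
  qed
  define \<sigma> where "\<sigma> = fps_shift 1 ((fps_const b + fps_X) ^ m)"
  have "((fps_const b + fps_X) ^ m) $ 0 = b ^ m" by (simp add: fps_nth_power_0)
  then have \<sigma>: "(fps_const b + fps_X) ^ m = fps_const (b ^ m) + fps_X * \<sigma>"
    unfolding \<sigma>_def by (intro fps_ext) (auto simp: fps_eq_iff)
  obtain \<eta> where \<eta>: "\<eta> = fps_const (inverse c) * \<sigma>
      + fps_X * poly (smult (- fps_const (inverse c))
          ([:0, 1:]\<^sup>2 * pcompose (map_poly fps_const r) [:fps_const a, fps_X:])) \<eta>"
    by (rule fps_polynomial_fixpoint)
  define \<xi> where "\<xi> = fps_const a + fps_X * \<eta>"
  have "\<eta> = fps_const (inverse c) * (\<sigma> - fps_X * (\<eta>\<^sup>2 * poly_at fps_const \<xi> r))"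
    by (subst \<eta>) (simp add: poly_pcompose poly_at_def \<xi>_def algebra_simps del: fps_const_neg)
  then have "fps_const c * \<eta> = \<sigma> - fps_X * (\<eta>\<^sup>2 * poly_at fps_const \<xi> r)"
    using assms(2) by (metis (no_types, lifting) c_def fps_const_1_eq_1 fps_const_mult mult.assoc mult_1 right_inverse)
  then have \<sigma>_eq: "\<sigma> = fps_const c * \<eta> + fps_X * (\<eta>\<^sup>2 * poly_at fps_const \<xi> r)"
    by (simp add: algebra_simps)
  have "poly_at fps_const \<xi> p = (fps_const b + fps_X) ^ m"
    unfolding taylor \<sigma> \<sigma>_eq by (simp add: \<xi>_def algebra_simps power2_eq_square)
  moreover have "\<xi> $ 0 = a" by (simp add: \<xi>_def)
  ultimately show ?thesis by (rule that[rotated])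
qed

text \<open>
  With \<open>a \<beta> - b \<alpha> = 1\<close>, the substitution \<open>x = 1/(G\<^sup>b t\<^sup>\<beta>)\<close>, \<open>y = 1/(G\<^sup>a t\<^sup>\<alpha>)\<close> turns
  \<open>y\<^sup>\<beta> = p(x)\<close>, where \<open>\<alpha> = deg p\<close>, into the equation below. It needs no \<open>\<beta>\<close>-th root of the
  leading coefficient and holds in any characteristic; modulo \<open>t\<close> it says that \<open>G\<close> is the
  inverse of the leading coefficient.
\<close>

lemma branch_at_infinity:
  fixes p :: "'a::field poly"
  assumes "p \<noteq> 0" and "\<beta> > 0"
  obtains G where "G $ 0 \<noteq> 0" "G * poly_at fps_const (G ^ b * fps_X ^ \<beta>) (reflect_poly p) = 1"
proof -
  note hom = unital_hom_fps_const[where 'a = 'a]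
  define l where "l = lead_coeff p"
  have "l \<noteq> 0" using assms by (simp add: l_def)
  obtain l' r where r: "reflect_poly p = pCons l' r" by (metis pCons_cases)
  have "l' = l" by (metis coeff_0_reflect_poly coeff_pCons_0 l_def r)
  define R where "R = map_poly fps_const r"
  obtain G where G: "G = fps_const (inverse l)
      + fps_X * poly (smult (- fps_const (inverse l) * fps_X ^ (\<beta> - 1))
          ([:0, 1:] ^ Suc b * pcompose R (Polynomial.monom (fps_X ^ \<beta>) b))) G"
    by (rule fps_polynomial_fixpoint)
  obtain m where m: "\<beta> = Suc m" using assms(2) by (cases \<beta>) auto
  have "G = fps_const (inverse l) * (1 - G * (G ^ b * fps_X ^ \<beta> * poly R (G ^ b * fps_X ^ \<beta>)))"
    by (subst G) (simp add: m poly_pcompose poly_monom algebra_simps del: fps_const_neg)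
  then have "fps_const l * G = 1 - G * (G ^ b * fps_X ^ \<beta> * poly R (G ^ b * fps_X ^ \<beta>))"
    using \<open>l \<noteq> 0\<close> by (metis (no_types, lifting) fps_const_1_eq_1 fps_const_mult mult.assoc mult_1 right_inverse)
  then have "G * poly_at fps_const (G ^ b * fps_X ^ \<beta>) (reflect_poly p) = 1"
    unfolding r \<open>l' = l\<close> poly_at_pCons[OF hom] by (simp add: poly_at_def R_def algebra_simps)
  moreover have "G $ 0 \<noteq> 0" using \<open>l \<noteq> 0\<close> by (subst G) simp
  ultimately show ?thesis by (rule that[rotated])
qed

lemma alg_closed_transcendental:
  fixes Z :: "'c::alg_closed_field fls"
  assumes "\<And>c. Z \<noteq> fls_const c" and "p \<noteq> 0"
  shows "poly_at fls_const Z p \<noteq> 0"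
  using assms(2)
proof (induction "degree p" arbitrary: p rule: less_induct)
  case (less p)
  note hom = unital_hom_fls_const[where 'a = 'c]
  show ?case
  proof (cases "degree p = 0")
    case True
    then obtain c where "p = [:c:]" by (metis degree_eq_zeroE)
    with less.prems show ?thesis by (simp add: hom)
  next
    case False
    then obtain c where "poly p c = 0" using alg_closed_imp_poly_has_root by blast
    then obtain r where r: "p = [:- c, 1:] * r" by (metis dvdE poly_eq_0_iff_dvd)
    then have "r \<noteq> 0" using less.prems by auto
    moreover have "degree r < degree p" using \<open>r \<noteq> 0\<close> by (subst r, subst degree_mult_eq) auto
    ultimately have "poly_at fls_const Z r \<noteq> 0" by (intro less.hyps)
    moreover have "poly_at fls_const Z [:- c, 1:] \<noteq> 0"
      using assms(1)[of c] by (simp add: poly_at_pCons hom unital_hom_simps)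
    ultimately show ?thesis by (simp add: r poly_at_mult hom del: mult_pCons_left)
  qed
qed

section \<open>The coordinate ring and its weight filtration\<close>

lemma poly_at_closed:
  assumes "unital_hom \<phi>" and "z \<in> U" and "\<And>c. \<phi> c \<in> U"
    and "\<And>a b. a \<in> U \<Longrightarrow> b \<in> U \<Longrightarrow> a + b \<in> U" and "\<And>a b. a \<in> U \<Longrightarrow> b \<in> U \<Longrightarrow> a * b \<in> U"
  shows "poly_at \<phi> z p \<in> U"
proof (induction p)
  case 0
  then show ?case using assms(3)[of 0] by (simp add: unital_hom_zero assms(1))
qed (simp add: poly_at_pCons assms)

lemma dvd_mult_diff_less_imp_eq:
  fixes a b c d :: nat
  assumes "coprime a b" "c < b" "d < b" "int b dvd int a * (int c - int d)"
  shows "c = d"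
proof -
  have "int b dvd int c - int d"
    using assms(1,4) by (metis coprime_commute coprime_dvd_mult_right_iff coprime_int_iff)
  then have "int b \<le> \<bar>int c - int d\<bar>" if "c \<noteq> d"
    using dvd_imp_le_int[of "int c - int d" "int b"] that by simp
  with assms(2,3) show ?thesis by fastforce
qed

text \<open>
  The function field of \<open>y\<^sup>\<beta> = A(x)\<close> with coprime degrees, which makes infinity totally ramified
  over the \<open>x\<close>-line.
\<close>

locale separated_curve =
  fixes A :: "'k::{field, finite} poly" and \<beta> :: nat
    and \<iota> :: "'k \<Rightarrow> 'f::field" and x y :: 'f
  assumes function_field: "is_function_field_of (separated_curve_poly \<beta> A) \<iota> x y"
    and degree_pos: "degree A > 0" and \<beta>_pos: "\<beta> > 0"
    and coprime: "coprime (degree A) \<beta>"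
begin

abbreviation "\<alpha> \<equiv> degree A"
abbreviation "ev \<equiv> eval_bivariate \<iota> x y"

lemma hom_\<iota>: "unital_hom \<iota>"
  using function_field by (simp add: is_function_field_of_def field_embedding_unital_hom)

lemma hom_ev: "unital_hom ev"
  using unital_hom_poly_at[OF unital_hom_poly_at[OF hom_\<iota>]]
  by (simp add: eval_bivariate_poly_at[abs_def])

lemma hom_x: "unital_hom (poly_at \<iota> x)" and hom_y: "unital_hom (poly_at \<iota> y)"
  by (simp_all add: unital_hom_poly_at hom_\<iota>)

lemmas \<iota>_simps = unital_hom_simps[OF hom_\<iota>] unital_hom_eq_0_iff[OF hom_\<iota>]
lemmas ev_simps = unital_hom_simps[OF hom_ev]

lemma ev_const: "ev [:c:] = poly_at \<iota> x c"
  by (simp add: eval_bivariate_poly_at hom_x)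

lemma ev_eq_0_iff: "ev g = 0 \<longleftrightarrow> separated_curve_poly \<beta> A dvd g"
  using function_field by (simp add: is_function_field_of_def)

lemma curve_eq: "y ^ \<beta> = poly_at \<iota> x A"
proof -
  have "ev (separated_curve_poly \<beta> A) = 0" by (simp add: ev_eq_0_iff)
  then show ?thesis
    by (simp add: separated_curve_poly_def ev_simps ev_const)
       (simp add: eval_bivariate_poly_at poly_at_monom hom_x unital_hom_simps[OF hom_x])
qed

lemma card_k_gt_1: "CARD('k) > 1"
proof -
  have "card {0, 1 :: 'k} \<le> CARD('k)" by (intro card_mono) auto
  then show ?thesis by simp
qed

definition weight :: "nat \<times> nat \<Rightarrow> nat" where
  "weight p = \<beta> * fst p + \<alpha> * snd p"

definition mon :: "nat \<times> nat \<Rightarrow> 'f" where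
  "mon p = x ^ fst p * y ^ snd p"

text \<open>
  Exponents of the monomials of weight at most \<open>m\<close> that are left after replacing \<open>y\<^sup>\<beta>\<close> by
  \<open>A(x)\<close>.
\<close>

definition reduced :: "nat \<Rightarrow> (nat \<times> nat) set" where
  "reduced m = {p. snd p < \<beta> \<and> weight p \<le> m}"

definition comb :: "nat \<Rightarrow> (nat \<times> nat \<Rightarrow> 'k) \<Rightarrow> 'f" where
  "comb m c = (\<Sum>p\<in>reduced m. \<iota> (c p) * mon p)"

definition V :: "nat \<Rightarrow> 'f set" where
  "V m = range (comb m)"

lemma finite_reduced [simp]: "finite (reduced m)"
proof (rule finite_subset)
  show "reduced m \<subseteq> {..m} \<times> {..<\<beta>}"
  proof
    fix p assume "p \<in> reduced m"
    then have "snd p < \<beta>" "\<beta> * fst p \<le> m" by (auto simp: reduced_def weight_def)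
    moreover have "fst p \<le> \<beta> * fst p" using \<beta>_pos by simp
    ultimately have "fst p \<le> m" by linarith
    with \<open>snd p < \<beta>\<close> show "p \<in> {..m} \<times> {..<\<beta>}" by (simp add: mem_Times_iff)
  qed
qed simp

lemma inj_on_weight: "inj_on weight {p. snd p < \<beta>}"
proof (rule inj_onI, clarsimp simp: weight_def)
  fix i j i' j' assume *: "j < \<beta>" "j' < \<beta>" "\<beta> * i + \<alpha> * j = \<beta> * i' + \<alpha> * j'"
  have "int \<alpha> * (int j - int j') = int \<beta> * (int i' - int i)"
    using arg_cong[OF *(3), of int] by (simp add: algebra_simps)
  then have "j = j'" using dvd_mult_diff_less_imp_eq[OF coprime *(1,2)] by simp
  with *(3) \<beta>_pos show "i = i' \<and> j = j'" by simp
qed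

lemma V_0: "0 \<in> V m"
  by (auto simp: V_def comb_def \<iota>_simps intro!: image_eqI[of _ _ "\<lambda>_. 0"])

lemma V_add: "u \<in> V m \<Longrightarrow> v \<in> V m \<Longrightarrow> u + v \<in> V m"
proof -
  assume "u \<in> V m" "v \<in> V m"
  then obtain c d where "u = comb m c" "v = comb m d" by (auto simp: V_def)
  then have "u + v = comb m (\<lambda>p. c p + d p)"
    by (simp add: comb_def \<iota>_simps algebra_simps sum.distrib)
  then show ?thesis by (simp add: V_def)
qed

lemma V_scale: "u \<in> V m \<Longrightarrow> \<iota> a * u \<in> V m"
proof -
  assume "u \<in> V m"
  then obtain c where "u = comb m c" by (auto simp: V_def)
  then have "\<iota> a * u = comb m (\<lambda>p. a * c p)"
    by (simp add: comb_def \<iota>_simps algebra_simps sum_distrib_left)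
  then show ?thesis by (simp add: V_def)
qed

lemma V_diff: "u \<in> V m \<Longrightarrow> v \<in> V m \<Longrightarrow> u - v \<in> V m"
  using V_add[of u m "- v"] V_scale[of v m "- 1"] by (simp add: \<iota>_simps)

lemma V_sum: "(\<And>s. s \<in> S \<Longrightarrow> f s \<in> V m) \<Longrightarrow> sum f S \<in> V m"
  by (induction S rule: infinite_finite_induct) (auto intro: V_0 V_add)

text \<open>
  Replacing \<open>y\<^sup>\<beta>\<close> by \<open>A(x)\<close> does not raise the weight, so the restriction to reduced monomials
  in the definition of \<open>V m\<close> is harmless.
\<close>

lemma mon_in_V:
  assumes "weight p \<le> m"
  shows "mon p \<in> V m"
  using assms
proof (induction "snd p" arbitrary: p rule: less_induct)
  case (less p)
  obtain i j where p: "p = (i, j)" by (cases p)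
  show ?case
  proof (cases "j < \<beta>")
    case True
    then have "p \<in> reduced m" using less.prems by (simp add: reduced_def p)
    have "comb m (\<lambda>r. if r = p then 1 else 0) = (\<Sum>r\<in>reduced m. if r = p then mon p else 0)"
      unfolding comb_def by (intro sum.cong) (auto simp: \<iota>_simps)
    with \<open>p \<in> reduced m\<close> have "comb m (\<lambda>r. if r = p then 1 else 0) = mon p" by simp
    then show ?thesis by (metis V_def rangeI)
  next
    case False
    then obtain k where j: "j = \<beta> + k" by (metis le_Suc_ex not_less)
    have "mon p = (\<Sum>l\<le>\<alpha>. \<iota> (coeff A l) * mon (i + l, k))"
      by (simp add: p j mon_def power_add curve_eq poly_at_sum[OF hom_\<iota>] sum_distrib_left
          sum_distrib_right algebra_simps)
    moreover have "\<iota> (coeff A l) * mon (i + l, k) \<in> V m" if "l \<le> \<alpha>" for l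
    proof (intro V_scale less.hyps)
      have "\<beta> * l \<le> \<beta> * \<alpha>" using that by (rule mult_le_mono2)
      moreover have "\<beta> * i + \<beta> * \<alpha> + \<alpha> * k \<le> m"
        using less.prems by (simp add: weight_def p j algebra_simps)
      ultimately show "weight (i + l, k) \<le> m"
        unfolding weight_def fst_conv snd_conv distrib_left by linarith
    qed (simp add: p j \<beta>_pos)
    ultimately show ?thesis by (auto intro: V_sum)
  qed
qed

lemma V_mono: "m \<le> n \<Longrightarrow> V m \<subseteq> V n"
proof
  fix u assume "m \<le> n" "u \<in> V m"
  then obtain c where "u = comb m c" by (auto simp: V_def)
  with \<open>m \<le> n\<close> show "u \<in> V n"
    by (auto simp: comb_def reduced_def intro!: V_sum V_scale mon_in_V)
qed

lemma V_mult: "u \<in> V m \<Longrightarrow> v \<in> V n \<Longrightarrow> u * v \<in> V (m + n)"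
proof -
  assume "u \<in> V m" "v \<in> V n"
  then obtain c d where "u = comb m c" "v = comb n d" by (auto simp: V_def)
  then have "u * v = (\<Sum>p\<in>reduced m. \<Sum>r\<in>reduced n. \<iota> (c p * d r) * mon (fst p + fst r, snd p + snd r))"
    by (simp add: comb_def sum_product \<iota>_simps mon_def power_add mult_ac)
  also have "\<dots> \<in> V (m + n)"
    by (intro V_sum V_scale mon_in_V) (auto simp: reduced_def weight_def algebra_simps)
  finally show ?thesis .
qed

lemma const_in_V: "\<iota> c \<in> V m"
  using V_scale[OF mon_in_V[of "(0, 0)" m], of c] by (simp add: weight_def mon_def)

lemma x_poly_in_V: "\<beta> * degree p \<le> m \<Longrightarrow> poly_at \<iota> x p \<in> V m"
proof -
  assume *: "\<beta> * degree p \<le> m"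
  have "\<iota> (coeff p i) * mon (i, 0) \<in> V m" if "i \<le> degree p" for i
    using that * by (intro V_scale mon_in_V) (auto simp: weight_def intro: order_trans mult_le_mono2)
  then show ?thesis by (auto simp: poly_at_sum[OF hom_\<iota>] mon_def intro!: V_sum)
qed

lemma y_poly_in_V: "\<alpha> * degree p \<le> m \<Longrightarrow> poly_at \<iota> y p \<in> V m"
proof -
  assume *: "\<alpha> * degree p \<le> m"
  have "\<iota> (coeff p i) * mon (0, i) \<in> V m" if "i \<le> degree p" for i
    using that * by (intro V_scale mon_in_V) (auto simp: weight_def intro: order_trans mult_le_mono2)
  then show ?thesis by (auto simp: poly_at_sum[OF hom_\<iota>] mon_def intro!: V_sum)
qed

lemma range_ev: "range ev = (\<Union>m. V m)"
proof (intro equalityI subsetI)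
  fix u assume "u \<in> range ev"
  then obtain g where g: "u = ev g" by auto
  let ?U = "\<Union>m. V m"
  have add: "a + b \<in> ?U" if "a \<in> ?U" "b \<in> ?U" for a b
  proof -
    from that obtain m n where "a \<in> V m" "b \<in> V n" by auto
    then have "a \<in> V (max m n)" "b \<in> V (max m n)" using V_mono[of m "max m n"] V_mono[of n "max m n"] by auto
    then show ?thesis by (auto intro: V_add)
  qed
  have mult: "a * b \<in> ?U" if "a \<in> ?U" "b \<in> ?U" for a b
    using that by (auto intro: V_mult)
  have "mon (1, 0) \<in> ?U" "mon (0, 1) \<in> ?U" by (auto intro: mon_in_V)
  then have "x \<in> ?U" "y \<in> ?U" by (simp_all add: mon_def)
  then show "u \<in> ?U"
    unfolding g eval_bivariate_poly_at
    by (intro poly_at_closed hom_x hom_\<iota> add mult) (use const_in_V in auto)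
next
  have mon: "mon p = ev ([:[:0, 1:]:] ^ fst p * [:0, 1:] ^ snd p)" for p
  proof -
    have "ev [:[:0, 1:]:] = x" "ev [:0, 1:] = y"
      by (simp_all add: ev_const eval_bivariate_poly_at poly_at_pCons hom_\<iota> hom_x \<iota>_simps
          unital_hom_simps[OF hom_x])
    then show ?thesis by (simp add: ev_simps mon_def del: mult_pCons_left mult_pCons_right)
  qed
  fix u assume "u \<in> (\<Union>m. V m)"
  then obtain m c where "u = comb m c" by (auto simp: V_def)
  also have "\<dots> = ev (\<Sum>p\<in>reduced m. [:[:c p:]:] * ([:[:0, 1:]:] ^ fst p * [:0, 1:] ^ snd p))"
    by (simp add: comb_def mon ev_simps ev_const hom_\<iota> del: mult_pCons_left mult_pCons_right)
  finally show "u \<in> range ev" by simp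
qed

text \<open>
  Reduced monomials are linearly independent because a multiple of the defining polynomial, which
  has degree \<open>\<beta>\<close> in \<open>y\<close>, cannot have smaller degree unless it is zero.
\<close>

lemma comb_eq_0:
  assumes "comb m c = 0" "p \<in> reduced m"
  shows "c p = 0"
proof -
  define g where "g = (\<Sum>p\<in>reduced m. Polynomial.monom (Polynomial.monom (c p) (fst p)) (snd p))"
  have "ev g = comb m c"
    by (simp add: g_def comb_def ev_simps mon_def)
       (simp add: eval_bivariate_poly_at poly_at_monom hom_x hom_\<iota> mult.assoc)
  with assms have dvd: "separated_curve_poly \<beta> A dvd g" by (simp add: ev_eq_0_iff)
  have deg_f: "degree (separated_curve_poly \<beta> A) \<ge> \<beta>"
    using \<beta>_pos by (intro le_degree) (simp add: separated_curve_poly_def coeff_pCons split: nat.split)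
  have "degree g < \<beta>"
    unfolding g_def
  proof (rule degree_sum_less)
    fix p assume "p \<in> reduced m"
    then have "snd p < \<beta>" by (simp add: reduced_def)
    then show "degree (Polynomial.monom (Polynomial.monom (c p) (fst p)) (snd p)) < \<beta>"
      using degree_monom_le[of "Polynomial.monom (c p) (fst p)" "snd p"] by linarith
  qed (rule \<beta>_pos)
  with dvd deg_f have "g = 0" by (metis dvd_imp_degree_le leD le_trans)
  moreover have "coeff (coeff g (snd p)) (fst p) = (\<Sum>r\<in>reduced m. if r = p then c p else 0)"
    unfolding g_def coeff_sum
    by (intro sum.cong refl) (auto simp: prod_eq_iff)
  ultimately show ?thesis using assms(2) by simp
qed

lemma card_V: "card (V m) = CARD('k) ^ card (reduced m)"
proof -
  let ?F = "reduced m \<rightarrow>\<^sub>E (UNIV :: 'k set)"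
  have "V m = comb m ` ?F"
  proof -
    have "comb m c = comb m (restrict c (reduced m))" for c
      unfolding comb_def by (rule sum.cong) auto
    then show ?thesis by (fastforce simp: V_def)
  qed
  moreover have "inj_on (comb m) ?F"
  proof (rule inj_onI)
    fix c d assume cd: "c \<in> ?F" "d \<in> ?F" "comb m c = comb m d"
    then have "comb m (\<lambda>p. c p - d p) = 0"
      by (simp add: comb_def \<iota>_simps algebra_simps sum_subtractf)
    then have "c p = d p" if "p \<in> reduced m" for p
      using comb_eq_0[of m "\<lambda>p. c p - d p"] that by auto
    then show "c = d" using cd(1,2) by (intro PiE_ext) auto
  qed
  ultimately show ?thesis by (simp add: card_image card_funcsetE)
qed

lemma finite_V: "finite (V m)"
  using card_V[of m] card_k_gt_1 card_gt_0_iff[of "V m"] by simp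

lemma card_reduced_le: "card (reduced m) \<le> m + 1"
proof -
  have "inj_on weight (reduced m)"
    by (rule inj_on_subset[OF inj_on_weight]) (auto simp: reduced_def)
  moreover have "weight ` reduced m \<subseteq> {..m}" by (auto simp: reduced_def)
  ultimately have "card (reduced m) \<le> card {..m}" by (intro card_inj_on_le) auto
  then show ?thesis by simp
qed

text \<open>
  The weights form the numerical semigroup generated by \<open>\<alpha>\<close> and \<open>\<beta>\<close>, which has
  \<open>(\<alpha> - 1)(\<beta> - 1)/2\<close> gaps, all of them at most \<open>m\<close>.
\<close>

lemma card_reduced:
  assumes "m \<ge> \<alpha> * (\<beta> - 1)"
  shows "2 * card (reduced m) + (\<alpha> - 1) * (\<beta> - 1) = 2 * (m + 1)"
proof -
  have le: "\<alpha> * j \<le> m" if "j < \<beta>" for j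
    using assms that by (metis Suc_pred' \<beta>_pos less_Suc_eq_le mult_le_mono2 order_trans)
  have "reduced m = prod.swap ` (SIGMA j:{..<\<beta>}. {..(m - \<alpha> * j) div \<beta>})"
  proof -
    have "\<beta> * i + \<alpha> * j \<le> m \<longleftrightarrow> i \<le> (m - \<alpha> * j) div \<beta>" if "j < \<beta>" for i j
      using le[OF that] \<beta>_pos by (simp add: less_eq_div_iff_mult_less_eq mult.commute le_diff_conv2)
    then show ?thesis by (force simp: reduced_def weight_def image_iff)
  qed
  then have "card (reduced m) = card (SIGMA j:{..<\<beta>}. {..(m - \<alpha> * j) div \<beta>})"
    by (simp add: card_image)
  then have card: "card (reduced m) = (\<Sum>j<\<beta>. (m - \<alpha> * j) div \<beta>) + \<beta>"
    by (simp add: sum_Suc)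
  \<comment> \<open>as \<open>j\<close> runs through the residues modulo \<open>\<beta>\<close>, so does \<open>m - \<alpha> * j\<close>\<close>
  have "inj_on (\<lambda>j. (m - \<alpha> * j) mod \<beta>) {..<\<beta>}"
  proof (rule inj_onI)
    fix j j' assume j: "j \<in> {..<\<beta>}" "j' \<in> {..<\<beta>}" "(m - \<alpha> * j) mod \<beta> = (m - \<alpha> * j') mod \<beta>"
    then have "int (m - \<alpha> * j) mod int \<beta> = int (m - \<alpha> * j') mod int \<beta>"
      by (metis of_nat_mod)
    then have "int \<beta> dvd int (m - \<alpha> * j') - int (m - \<alpha> * j)"
      by (metis mod_eq_dvd_iff)
    then have "int \<beta> dvd int \<alpha> * (int j - int j')"
      using le j by (simp add: of_nat_diff algebra_simps)
    then show "j = j'" using dvd_mult_diff_less_imp_eq[OF coprime] j by simp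
  qed
  moreover have "(\<lambda>j. (m - \<alpha> * j) mod \<beta>) ` {..<\<beta>} \<subseteq> {..<\<beta>}" using \<beta>_pos by auto
  ultimately have "(\<lambda>j. (m - \<alpha> * j) mod \<beta>) ` {..<\<beta>} = {..<\<beta>}"
    by (intro card_subset_eq) (auto simp: card_image)
  then have mods: "(\<Sum>j<\<beta>. (m - \<alpha> * j) mod \<beta>) = (\<Sum>j<\<beta>. j)"
    using sum.reindex[OF \<open>inj_on _ _\<close>, of id] by simp
  have gauss: "2 * (\<Sum>j<n. j) = n * (n - 1)" for n :: nat
  proof (induction n)
    case (Suc n)
    then show ?case by (cases n) (auto simp: algebra_simps)
  qed simp
  have "(\<Sum>j<\<beta>. m - \<alpha> * j) = (\<Sum>j<\<beta>. \<beta> * ((m - \<alpha> * j) div \<beta>) + (m - \<alpha> * j) mod \<beta>)" by simp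
  also have "\<dots> = \<beta> * (\<Sum>j<\<beta>. (m - \<alpha> * j) div \<beta>) + (\<Sum>j<\<beta>. j)"
    by (simp only: sum.distrib sum_distrib_left mods)
  finally have 1: "(\<Sum>j<\<beta>. m - \<alpha> * j) = \<beta> * (\<Sum>j<\<beta>. (m - \<alpha> * j) div \<beta>) + (\<Sum>j<\<beta>. j)" .
  have "(\<Sum>j<\<beta>. m - \<alpha> * j) + (\<Sum>j<\<beta>. \<alpha> * j) = (\<Sum>j<\<beta>. m)"
    using le by (simp flip: sum.distrib)
  then have 2: "(\<Sum>j<\<beta>. m - \<alpha> * j) + \<alpha> * (\<Sum>j<\<beta>. j) = \<beta> * m"
    by (simp flip: sum_distrib_left)
  from 1 2 have "2 * \<beta> * (\<Sum>j<\<beta>. (m - \<alpha> * j) div \<beta>) + (\<alpha> + 1) * (2 * (\<Sum>j<\<beta>. j)) = 2 * \<beta> * m"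
    by (simp add: algebra_simps)
  then have "\<beta> * (2 * (\<Sum>j<\<beta>. (m - \<alpha> * j) div \<beta>) + (\<alpha> + 1) * (\<beta> - 1)) = \<beta> * (2 * m)"
    unfolding gauss by (simp add: algebra_simps)
  then have 3: "2 * (\<Sum>j<\<beta>. (m - \<alpha> * j) div \<beta>) + (\<alpha> + 1) * (\<beta> - 1) = 2 * m"
    using \<beta>_pos by (simp only: mult_cancel1) simp
  obtain a b where "\<alpha> = Suc a" "\<beta> = Suc b"
    using degree_pos \<beta>_pos by (metis Suc_pred')
  with 3 show ?thesis unfolding card by (simp add: algebra_simps)
qed

lemma card_reduced_add: "m \<ge> \<alpha> * (\<beta> - 1) \<Longrightarrow> card (reduced (m + s)) = card (reduced m) + s"
  using card_reduced[of m] card_reduced[of "m + s"] by simp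

text \<open>
  For large \<open>m\<close>, multiplication by \<open>r \<in> V s\<close> maps \<open>V m\<close> to \<open>V (m + s)\<close>, whose dimension is larger only by
  \<open>s\<close>. The polynomials in \<open>y\<close> of degree at most \<open>s\<close> form a space of dimension \<open>s + 1\<close>, so by
  the pigeonhole principle one of them is a multiple of \<open>r\<close>. This is how denominators in \<open>y\<close>
  alone and nonvanishing under specializations are obtained.
\<close>

lemma divides_y_poly:
  assumes "r \<in> range ev" "r \<noteq> 0"
  obtains r' h where "r' \<in> range ev" "h \<noteq> 0" "r * r' = poly_at \<iota> y h"
proof -
  from assms(1) obtain s where s: "r \<in> V s" by (auto simp: range_ev)
  \<comment> \<open>large enough for the dimension formula and for \<open>y\<^sup>s\<close> to lie in \<open>V (m + s)\<close>\<close>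
  define m where "m = \<alpha> * (\<beta> - 1) + \<alpha> * s"
  let ?P = "{..s} \<rightarrow>\<^sub>E (UNIV :: 'k set)"
  define pol where "pol c = (\<Sum>j\<le>s. Polynomial.monom (c j :: 'k) j)" for c
  define F where "F = (\<lambda>(u, c). r * u + poly_at \<iota> y (pol c))"
  have deg_pol: "degree (pol c) \<le> s" for c
    unfolding pol_def by (intro degree_sum_le) (auto intro: order_trans[OF degree_monom_le])
  have pol_coeff: "coeff (pol c) j = c j" if "j \<le> s" for c j
    using that by (simp add: pol_def coeff_sum)
  have "F ` (V m \<times> ?P) \<subseteq> V (m + s)"
  proof (clarsimp simp: F_def)
    fix u c assume "u \<in> V m"
    then have "r * u \<in> V (m + s)" using V_mult[OF s] by (simp add: add.commute)
    moreover have "\<alpha> * degree (pol c) \<le> m + s"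
      using mult_le_mono2[OF deg_pol[of c], of \<alpha>] unfolding m_def by linarith
    ultimately show "r * u + poly_at \<iota> y (pol c) \<in> V (m + s)" by (intro V_add y_poly_in_V)
  qed
  moreover have "card (V m \<times> ?P) > card (V (m + s))"
  proof -
    have "card (V m \<times> ?P) = CARD('k) ^ (card (reduced m) + s + 1)"
      by (simp add: card_cartesian_product card_V card_funcsetE power_add)
    moreover have "card (V (m + s)) = CARD('k) ^ (card (reduced m) + s)"
      using card_reduced_add[of m s] by (simp add: card_V m_def)
    ultimately show ?thesis using card_k_gt_1 by (simp add: power_strict_increasing)
  qed
  ultimately have "\<not> inj_on F (V m \<times> ?P)"
    using card_inj_on_le[of F "V m \<times> ?P" "V (m + s)"] finite_V by auto
  then obtain u c u' c' where *: "u \<in> V m" "u' \<in> V m" "c \<in> ?P" "c' \<in> ?P" "(u, c) \<noteq> (u', c')"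
    "F (u, c) = F (u', c')"
    by (auto simp: inj_on_def)
  then have eq: "r * (u - u') = poly_at \<iota> y (pol c' - pol c)"
    by (simp add: F_def unital_hom_simps[OF hom_y] algebra_simps)
  have "pol c' - pol c \<noteq> 0"
  proof
    assume "pol c' - pol c = 0"
    then have "c j = c' j" if "j \<le> s" for j using pol_coeff[OF that] by (metis eq_iff_diff_eq_0)
    then have "c = c'" using *(3,4) by (intro PiE_ext) auto
    with eq assms(2) have "u = u'" by (simp add: unital_hom_zero)
    with \<open>c = c'\<close> *(5) show False by simp
  qed
  moreover have "u - u' \<in> range ev" using V_diff[OF *(1,2)] by (auto simp: range_ev)
  ultimately show ?thesis using eq by (intro that)
qed

definition value_at :: "'k \<times> 'k \<Rightarrow> 'k poly poly \<Rightarrow> 'k" where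
  "value_at P g = poly (poly g [:snd P:]) (fst P)"

lemma hom_value_at: "unital_hom (value_at P)"
  by (simp add: unital_hom_def value_at_def)

definition affine_points :: "('k \<times> 'k) set" where
  "affine_points = {(a, b). b ^ \<beta> = poly A a}"

lemma value_at_well_defined:
  assumes "P \<in> affine_points" "ev g = ev h"
  shows "value_at P g = value_at P h"
proof -
  have "ev (g - h) = 0" by (simp add: ev_simps assms)
  then obtain k where k: "g - h = separated_curve_poly \<beta> A * k" by (auto simp: ev_eq_0_iff)
  moreover have "value_at P (separated_curve_poly \<beta> A) = 0"
    using assms(1) by (auto simp: affine_points_def value_at_def separated_curve_poly_def poly_monom)
  ultimately have "value_at P (g - h) = 0"
    by (simp only: k unital_hom_mult[OF hom_value_at] mult_zero_left)
  then show ?thesis by (simp add: unital_hom_simps[OF hom_value_at])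
qed

text \<open>
  For large \<open>m\<close> the values on \<open>Z\<close> of functions in \<open>V m\<close> are arbitrary. The multiples of \<open>g\<close>
  by \<open>V m\<close> vanish on \<open>Z\<close>, so together with interpolating functions they give
  \<open>|V m| \<cdot> |k|\<^bsup>|Z|\<^esup>\<close> distinct elements of \<open>V (m + s)\<close>, whose dimension exceeds that of
  \<open>V m\<close> by \<open>s\<close>.
\<close>

lemma card_zeros_le:
  assumes "ev g \<noteq> 0" "ev g \<in> V s" "Z \<subseteq> affine_points" "\<And>P. P \<in> Z \<Longrightarrow> value_at P g = 0"
  shows "card Z \<le> s"
proof -
  define lagrange where
    "lagrange a = smult (inverse (\<Prod>c\<in>UNIV - {a}. a - c)) (\<Prod>c\<in>UNIV - {a}. [:- c, 1:])" for a :: 'k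
  have lagrange: "poly (lagrange a) b = (if b = a then 1 else 0)" for a b
    by (auto simp: lagrange_def poly_prod prod_zero_iff)
  have deg_lagrange: "degree (lagrange a) \<le> CARD('k)" for a
  proof -
    have "degree (\<Prod>c\<in>UNIV - {a}. [:- c, 1:]) \<le> card (UNIV - {a})"
      using degree_prod_sum_le[of "UNIV - {a}" "\<lambda>c. [:- c, 1:]"] by simp
    also have "\<dots> \<le> CARD('k)" by (intro card_mono) auto
    finally show ?thesis by (auto simp: lagrange_def intro: order_trans[OF degree_smult_le])
  qed
  define \<delta> where "\<delta> P = [:lagrange (fst P):] * map_poly (\<lambda>c. [:c:]) (lagrange (snd P))" for P :: "'k \<times> 'k"
  have \<delta>_value: "value_at Q (\<delta> P) = (if Q = P then 1 else 0)" for P Q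
  proof -
    have "poly (map_poly (\<lambda>c. [:c:]) p) [:b:] = [:poly p b:]" for p and b :: 'k
      by (simp add: pcompose_altdef[symmetric] pcompose_pCons_0)
    then show ?thesis by (auto simp: value_at_def \<delta>_def lagrange prod_eq_iff)
  qed
  have ev_\<delta>: "ev (\<delta> P) = poly_at \<iota> x (lagrange (fst P)) * poly_at \<iota> y (lagrange (snd P))" for P
    unfolding \<delta>_def unital_hom_mult[OF hom_ev] ev_const
    by (simp add: eval_bivariate_poly_at poly_at_def map_poly_map_poly unital_hom_zero[OF hom_x] comp_def)
       (simp flip: poly_at_def add: hom_\<iota>)
  \<comment> \<open>large enough for the dimension formula and for the interpolating functions to lie in \<open>V m\<close>\<close>
  define m where "m = \<alpha> * (\<beta> - 1) + (\<beta> * CARD('k) + \<alpha> * CARD('k))"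
  have ev_\<delta>_in_V: "ev (\<delta> P) \<in> V m" for P
  proof -
    have "ev (\<delta> P) \<in> V (\<beta> * CARD('k) + \<alpha> * CARD('k))"
      unfolding ev_\<delta> by (intro V_mult x_poly_in_V y_poly_in_V mult_le_mono2 deg_lagrange)
    moreover have "V (\<beta> * CARD('k) + \<alpha> * CARD('k)) \<subseteq> V m" by (rule V_mono) (simp add: m_def)
    ultimately show ?thesis by blast
  qed
  define E where "E w = (\<Sum>P\<in>Z. [:[:w P:]:] * \<delta> P)" for w :: "'k \<times> 'k \<Rightarrow> 'k"
  have E_value: "value_at Q (E w) = w Q" if "Q \<in> Z" for Q w
  proof -
    have "value_at Q (E w) = (\<Sum>P\<in>Z. if Q = P then w P else 0)"
      unfolding E_def unital_hom_simps[OF hom_value_at] \<delta>_value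
      by (intro sum.cong) (auto simp: value_at_def)
    then show ?thesis using that by simp
  qed
  have E_V: "ev (E w) \<in> V m" for w
    unfolding E_def ev_simps ev_const poly_at_const[OF hom_\<iota>]
    by (intro V_sum V_scale ev_\<delta>_in_V)
  let ?W = "Z \<rightarrow>\<^sub>E (UNIV :: 'k set)"
  define F where "F = (\<lambda>(u, w). ev g * u + ev (E w))"
  have "inj_on F (V m \<times> ?W)"
  proof (rule inj_onI, clarify)
    fix u w u' w' assume u: "u \<in> V m" "u' \<in> V m" and w: "w \<in> ?W" "w' \<in> ?W"
      and eq: "F (u, w) = F (u', w')"
    from u obtain f f' where f: "u = ev f" "u' = ev f'" using range_ev by blast
    from eq have "ev (g * f + E w) = ev (g * f' + E w')" by (simp add: F_def f ev_simps)
    then have "w P = w' P" if "P \<in> Z" for P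
      using value_at_well_defined[of P "g * f + E w" "g * f' + E w'"] that assms(3,4)
      by (auto simp: unital_hom_simps[OF hom_value_at] E_value)
    then have "w = w'" using w by (intro PiE_ext) auto
    with eq show "u = u' \<and> w = w'" using assms(1) by (simp add: F_def)
  qed
  moreover have "F ` (V m \<times> ?W) \<subseteq> V (m + s)"
  proof (clarsimp simp: F_def)
    fix u w assume "u \<in> V m"
    then have "ev g * u \<in> V (m + s)" using V_mult[OF assms(2)] by (simp add: add.commute)
    moreover have "ev (E w) \<in> V (m + s)" using E_V V_mono[of m "m + s"] by auto
    ultimately show "ev g * u + ev (E w) \<in> V (m + s)" by (rule V_add)
  qed
  ultimately have "card (V m \<times> ?W) \<le> card (V (m + s))"
    using finite_V by (intro card_inj_on_le)
  then have "CARD('k) ^ (card (reduced m) + card Z) \<le> CARD('k) ^ (card (reduced m) + s)"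
    using card_reduced_add[of m s]
    by (simp add: card_cartesian_product card_V card_funcsetE m_def power_add)
  then show ?thesis using card_k_gt_1 by (simp add: power_increasing_iff)
qed

end

section \<open>Places and Laurent series\<close>

text \<open>
  Membership in \<open>val_ge v m\<close> treats 0 as having infinite value and is stable under addition, unlike
  the inequality \<open>v z \<ge> m\<close> with the dummy value \<open>v 0 = 0\<close>.
\<close>

definition val_ge :: "('f::field \<Rightarrow> int) \<Rightarrow> int \<Rightarrow> 'f set" where
  "val_ge v m = {z. z = 0 \<or> v z \<ge> m}"

lemma place_mult: "v \<in> places \<iota> \<Longrightarrow> a \<noteq> 0 \<Longrightarrow> b \<noteq> 0 \<Longrightarrow> v (a * b) = v a + v b"
  and place_add: "v \<in> places \<iota> \<Longrightarrow> a \<noteq> 0 \<Longrightarrow> b \<noteq> 0 \<Longrightarrow> a + b \<noteq> 0 \<Longrightarrow> v (a + b) \<ge> min (v a) (v b)"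
  and place_const: "v \<in> places \<iota> \<Longrightarrow> c \<noteq> 0 \<Longrightarrow> v (\<iota> c) = 0"
  and place_zero: "v \<in> places \<iota> \<Longrightarrow> v 0 = 0"
  by (auto simp: places_def)

lemma place_surj:
  assumes "v \<in> places \<iota>"
  obtains z where "z \<noteq> 0" "v z = n"
proof -
  have "n \<in> v ` (UNIV - {0})" using assms by (auto simp: places_def)
  then show ?thesis using that by auto
qed

lemma place_one: "v \<in> places \<iota> \<Longrightarrow> v 1 = 0"
  using place_mult[of v \<iota> 1 1] by simp

lemma place_uminus: "v \<in> places \<iota> \<Longrightarrow> v (- a) = v a"
proof (cases "a = 0")
  case False
  assume v: "v \<in> places \<iota>"
  have "v (- 1) + v (- 1) = 0" using place_mult[OF v, of "- 1" "- 1"] place_one[OF v] by simp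
  then show ?thesis using place_mult[OF v, of "- 1" a] False by simp
qed simp

lemma place_power: "v \<in> places \<iota> \<Longrightarrow> a \<noteq> 0 \<Longrightarrow> v (a ^ n) = int n * v a"
  by (induction n) (simp_all add: place_one place_mult algebra_simps)

lemma place_divide:
  assumes "v \<in> places \<iota>" "a \<noteq> 0" "b \<noteq> 0"
  shows "v (a / b) = v a - v b"
  using place_mult[OF assms(1), of "a / b" b] assms by simp

lemma val_ge_0 [simp]: "0 \<in> val_ge v m"
  by (simp add: val_ge_def)

lemma val_ge_mono: "m \<le> n \<Longrightarrow> z \<in> val_ge v n \<Longrightarrow> z \<in> val_ge v m"
  by (auto simp: val_ge_def)

lemma val_ge_add:
  assumes v: "v \<in> places \<iota>" and "a \<in> val_ge v m" "b \<in> val_ge v m"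
  shows "a + b \<in> val_ge v m"
  using assms(2,3) place_add[OF v, of a b]
  by (cases "a = 0"; cases "b = 0"; cases "a + b = 0") (auto simp: val_ge_def)

lemma val_ge_mult:
  assumes v: "v \<in> places \<iota>" and "a \<in> val_ge v m" "b \<in> val_ge v n"
  shows "a * b \<in> val_ge v (m + n)"
  using assms(2,3) place_mult[OF v, of a b]
  by (cases "a = 0"; cases "b = 0") (auto simp: val_ge_def)

lemma val_ge_uminus: "v \<in> places \<iota> \<Longrightarrow> a \<in> val_ge v m \<Longrightarrow> - a \<in> val_ge v m"
  by (auto simp: val_ge_def place_uminus)

lemma val_ge_diff: "v \<in> places \<iota> \<Longrightarrow> a \<in> val_ge v m \<Longrightarrow> b \<in> val_ge v m \<Longrightarrow> a - b \<in> val_ge v m"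
  using val_ge_add[of v \<iota> a m "- b"] val_ge_uminus[of v \<iota> b m] by simp

lemma val_ge_sum:
  "v \<in> places \<iota> \<Longrightarrow> (\<And>s. s \<in> S \<Longrightarrow> f s \<in> val_ge v m) \<Longrightarrow> sum f S \<in> val_ge v m"
  by (induction S rule: infinite_finite_induct) (auto intro: val_ge_add)

lemma val_ge_const: "v \<in> places \<iota> \<Longrightarrow> unital_hom \<iota> \<Longrightarrow> \<iota> c \<in> val_ge v 0"
  by (cases "c = 0") (auto simp: val_ge_def place_const unital_hom_zero)

text \<open>
  The strict triangle inequality, in the form in which it is used for sums with one dominant term.
\<close>

lemma place_add_dominant:
  assumes v: "v \<in> places \<iota>" and "a \<noteq> 0" "b \<in> val_ge v (v a + 1)"
  shows "a + b \<noteq> 0" and "v (a + b) = v a"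
proof -
  have na: "a \<notin> val_ge v (v a + 1)" using assms(2) by (simp add: val_ge_def)
  show nz: "a + b \<noteq> 0"
  proof
    assume "a + b = 0"
    then have "a = - b" by (simp add: eq_neg_iff_add_eq_0)
    with na assms(3) val_ge_uminus[OF v] show False by blast
  qed
  have "a + b \<in> val_ge v (v a)"
    using assms(2,3) by (intro val_ge_add[OF v]) (auto simp: val_ge_def)
  moreover have "a + b \<notin> val_ge v (v a + 1)"
    using na val_ge_diff[OF v _ assms(3)] by (metis add_diff_cancel_right')
  ultimately show "v (a + b) = v a" using nz by (auto simp: val_ge_def)
qed

lemma poly_at_val_ge:
  assumes "v \<in> places \<iota>" "unital_hom \<iota>" "z \<in> val_ge v 0"
  shows "poly_at \<iota> z p \<in> val_ge v 0"
  using assms val_ge_mult[OF assms(1), of _ 0 _ 0]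
  by (intro poly_at_closed) (auto intro: val_ge_add val_ge_const)

lemma poly_at_pole:
  assumes v: "v \<in> places \<iota>" and hom: "unital_hom \<iota>" and neg: "v z < 0" and "p \<noteq> 0"
  shows "poly_at \<iota> z p \<noteq> 0" and "v (poly_at \<iota> z p) = int (degree p) * v z"
proof -
  let ?n = "degree p"
  have "z \<noteq> 0" using neg place_zero[OF v] by auto
  have top: "poly_at \<iota> z p = \<iota> (lead_coeff p) * z ^ ?n + (\<Sum>l<?n. \<iota> (coeff p l) * z ^ l)"
    by (simp add: poly_at_sum[OF hom] lessThan_Suc_atMost[symmetric])
  have t: "\<iota> (lead_coeff p) * z ^ ?n \<noteq> 0" "v (\<iota> (lead_coeff p) * z ^ ?n) = int ?n * v z"
    using \<open>p \<noteq> 0\<close> \<open>z \<noteq> 0\<close>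
    by (simp_all add: unital_hom_eq_0_iff[OF hom] place_mult[OF v] place_power[OF v] place_const[OF v])
  have "\<iota> (coeff p l) * z ^ l \<in> val_ge v (int ?n * v z + 1)" if "l < ?n" for l
  proof -
    have "int ?n * v z \<le> (int l + 1) * v z" using that neg by (intro mult_right_mono_neg) auto
    then have "int ?n * v z + 1 \<le> int l * v z" using neg by (simp add: algebra_simps)
    moreover have "z ^ l \<in> val_ge v (int l * v z)"
      by (simp add: val_ge_def place_power[OF v \<open>z \<noteq> 0\<close>])
    ultimately show ?thesis
      using val_ge_mult[OF v val_ge_const[OF v hom, of "coeff p l"], of "z ^ l"]
      by (auto intro: val_ge_mono)
  qed
  then have "(\<Sum>l<?n. \<iota> (coeff p l) * z ^ l) \<in> val_ge v (v (\<iota> (lead_coeff p) * z ^ ?n) + 1)"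
    unfolding t by (intro val_ge_sum[OF v]) auto
  note dominant = place_add_dominant[OF v t(1) this]
  show "poly_at \<iota> z p \<noteq> 0" unfolding top by (rule dominant(1))
  show "v (poly_at \<iota> z p) = int ?n * v z" unfolding top using dominant(2) t(2) by (rule trans)
qed

text \<open>
  The order of a Laurent series restricts to a valuation whose values may form a proper subgroup
  \<open>e\<int>\<close>; division by \<open>e\<close> makes it a place.
\<close>

lemma place_of_laurent_embedding:
  fixes \<Phi> :: "'f::field \<Rightarrow> 'c::field fls" and \<iota> :: "'k::field \<Rightarrow> 'f"
  assumes hom: "unital_hom \<Phi>" and const: "\<And>c. \<Phi> (\<iota> c) = fls_const (\<tau> c)"
    and nontrivial: "fls_subdegree (\<Phi> z0) \<noteq> 0"
  shows "\<exists>v\<in>places \<iota>. \<exists>e>0. \<forall>z. fls_subdegree (\<Phi> z) = e * v z"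
proof -
  define w where "w z = fls_subdegree (\<Phi> z)" for z
  have nz: "\<Phi> z = 0 \<longleftrightarrow> z = 0" for z by (rule unital_hom_eq_0_iff[OF hom])
  have w_mult: "w (a * b) = w a + w b" if "a \<noteq> 0" "b \<noteq> 0" for a b
    using that by (simp add: w_def unital_hom_mult[OF hom] nz)
  have w_inverse: "w (inverse a) = - w a" for a
    by (simp add: w_def unital_hom_inverse[OF hom])
  have w_pow: "w (power_int a n) = n * w a" for a n
    by (simp add: w_def power_int_def unital_hom_simps[OF hom] unital_hom_inverse[OF hom] fls_subdegree_pow)
  have w0: "w 0 = 0" by (simp add: w_def unital_hom_zero[OF hom])
  have z0: "w z0 \<noteq> 0" using nontrivial by (simp add: w_def)
  have "\<exists>n>0. \<exists>z. w z = int n"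
  proof (cases "w z0 > 0")
    case True
    then show ?thesis by (intro exI[of _ "nat (w z0)"]) auto
  next
    case False
    then show ?thesis using z0 w_inverse[of z0]
      by (intro exI[of _ "nat (- w z0)"]) (auto intro!: exI[of _ "inverse z0"])
  qed
  then obtain n where n: "n > 0" "\<exists>z. w z = int n" "\<And>m. m < n \<Longrightarrow> \<not> (m > 0 \<and> (\<exists>z. w z = int m))"
    using exists_least_iff[of "\<lambda>n. n > 0 \<and> (\<exists>z. w z = int n)"] by blast
  then obtain z1 where z1: "w z1 = int n" by blast
  have "z1 \<noteq> 0" using z1 n(1) w0 by auto
  have dvd: "int n dvd w z" for z
  proof (cases "z = 0")
    case False
    let ?z = "z * power_int z1 (- (w z div int n))"
    have "w ?z = w z mod int n"
      using False \<open>z1 \<noteq> 0\<close> by (simp add: w_mult w_pow z1 minus_div_mult_eq_mod)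
    moreover have "nat (w z mod int n) < n" using n(1) by (simp add: nat_less_iff)
    moreover have "w z mod int n \<ge> 0" using n(1) by simp
    ultimately have "\<not> nat (w z mod int n) > 0" using n(3) by (metis int_nat_eq)
    with \<open>w z mod int n \<ge> 0\<close> show ?thesis by auto
  qed (simp add: w0)
  define v where "v z = w z div int n" for z
  have wv: "w z = int n * v z" for z using dvd[of z] by (simp add: v_def)
  have "v \<in> places \<iota>"
    unfolding places_def
  proof (intro CollectI conjI allI impI)
    show "v 0 = 0" by (simp add: v_def w0)
  next
    fix a b :: 'f assume "a \<noteq> 0" "b \<noteq> 0"
    then have "int n * v (a * b) = int n * (v a + v b)"
      using w_mult by (simp add: distrib_left flip: wv)
    then show "v (a * b) = v a + v b" using n(1) by simp
  next
    fix a b :: 'f assume "a \<noteq> 0" "b \<noteq> 0" "a + b \<noteq> 0"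
    then have "w (a + b) \<ge> min (w a) (w b)"
      using fls_plus_subdegree[of "\<Phi> a" "\<Phi> b"] by (simp add: w_def nz flip: unital_hom_add[OF hom])
    then have "int n * v a \<le> int n * v (a + b) \<or> int n * v b \<le> int n * v (a + b)"
      by (simp add: min_le_iff_disj flip: wv)
    then show "v (a + b) \<ge> min (v a) (v b)" using n(1) by (auto simp: mult_le_cancel_left)
  next
    fix c :: 'k assume "c \<noteq> 0"
    show "v (\<iota> c) = 0" by (simp add: v_def w_def const)
  next
    have "v (power_int z1 m) = m" for m using n(1) by (simp add: v_def w_pow z1)
    then show "v ` (UNIV - {0}) = UNIV"
      using \<open>z1 \<noteq> 0\<close> by (auto simp: image_iff power_int_eq_0_iff intro!: bexI[of _ "power_int z1 _"])
  qed
  then show ?thesis using n(1) wv by (intro bexI[of _ v] exI[of _ "int n"]) (auto simp: w_def)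
qed

lemma hom_poly_at:
  assumes "unital_hom \<phi>" "unital_hom \<psi>"
  shows "\<psi> (poly_at \<phi> z p) = poly_at (\<lambda>c. \<psi> (\<phi> c)) (\<psi> z) p"
  by (induction p)
     (simp_all add: poly_at_pCons assms unital_hom_comp unital_hom_simps[OF assms(2)])

context separated_curve
begin

lemma fraction:
  obtains g h where "ev h \<noteq> 0" "z = ev g / ev h"
proof -
  have "\<exists>g h. ev h \<noteq> 0 \<and> z = ev g / ev h"
    using function_field unfolding is_function_field_of_def by blast
  then show ?thesis using that by blast
qed

lemma range_ev_closed:
  "r \<in> range ev \<Longrightarrow> s \<in> range ev \<Longrightarrow> r * s \<in> range ev"
  "r \<in> range ev \<Longrightarrow> s \<in> range ev \<Longrightarrow> r + s \<in> range ev"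
  by (auto simp flip: unital_hom_mult[OF hom_ev] unital_hom_add[OF hom_ev])

lemma const_in_range: "\<iota> c \<in> range ev"
  using const_in_V range_ev by blast

lemma mon_nonzero: "snd p < \<beta> \<Longrightarrow> mon p \<noteq> 0"
proof
  assume "snd p < \<beta>" "mon p = 0"
  then have p: "p \<in> reduced (weight p)" by (simp add: reduced_def)
  have "comb (weight p) (\<lambda>r. if r = p then 1 else 0)
      = (\<Sum>r\<in>reduced (weight p). if r = p then mon p else 0)"
    unfolding comb_def by (intro sum.cong) (auto simp: \<iota>_simps)
  also have "\<dots> = 0" using \<open>mon p = 0\<close> by simp
  finally show False using comb_eq_0[OF _ p] by fastforce
qed

lemma x_nonzero: "x \<noteq> 0"
  using mon_nonzero[of "(1, 0)"] \<beta>_pos by (simp add: mon_def)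

lemma leading_monomial:
  assumes "r \<in> range ev" "r \<noteq> 0"
  obtains p a s where "snd p < \<beta>" "a \<noteq> 0" "r = \<iota> a * mon p + s"
    "s = 0 \<or> weight p > 0 \<and> s \<in> V (weight p - 1)"
proof -
  from assms(1) obtain m c where r: "r = comb m c" by (auto simp: range_ev V_def)
  let ?S = "{p \<in> reduced m. c p \<noteq> 0}"
  have "?S \<noteq> {}"
  proof
    assume "?S = {}"
    then have "r = 0" unfolding r comb_def by (intro sum.neutral) (auto simp: \<iota>_simps)
    with assms(2) show False by simp
  qed
  then have "Max (weight ` ?S) \<in> weight ` ?S" by (intro Max_in) auto
  then obtain p where p: "p \<in> ?S" "weight p = Max (weight ` ?S)" by auto
  define s where "s = (\<Sum>q\<in>reduced m - {p}. \<iota> (c q) * mon q)"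
  have less: "weight q < weight p" if "q \<in> reduced m - {p}" "c q \<noteq> 0" for q
  proof -
    have "weight q \<le> weight p" unfolding p(2) using that by (intro Max_ge) auto
    moreover have "weight q \<noteq> weight p"
      using inj_onD[OF inj_on_weight, of q p] that p(1) by (auto simp: reduced_def)
    ultimately show ?thesis by simp
  qed
  have "s = 0 \<or> weight p > 0 \<and> s \<in> V (weight p - 1)"
  proof (cases "weight p = 0")
    case True
    then have "c q = 0" if "q \<in> reduced m - {p}" for q using less[OF that] by auto
    then have "s = 0" unfolding s_def by (intro sum.neutral) (simp add: \<iota>_simps)
    then show ?thesis ..
  next
    case False
    have "\<iota> (c q) * mon q \<in> V (weight p - 1)" if "q \<in> reduced m - {p}" for q
    proof (cases "c q = 0")
      case False
      with less[OF that False] show ?thesis by (intro V_scale mon_in_V) simp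
    qed (simp add: \<iota>_simps V_0)
    then have "s \<in> V (weight p - 1)" unfolding s_def by (rule V_sum)
    with False show ?thesis by simp
  qed
  moreover have "r = \<iota> (c p) * mon p + s"
    unfolding r comb_def s_def using p(1) by (intro sum.remove) auto
  ultimately show ?thesis using p(1) by (intro that[of p "c p" s]) (auto simp: reduced_def)
qed

text \<open>
  At a pole of \<open>x\<close> the equation of the curve compares \<open>\<beta> v(y)\<close> with \<open>\<alpha> v(x)\<close>, and this leaves one
  free parameter.
\<close>

lemma coprime_scaled_pair:
  fixes a b :: int
  assumes "int \<beta> * b = int \<alpha> * a"
  obtains k where "a = int \<beta> * k" "b = int \<alpha> * k"
proof -
  have "int \<beta> dvd int \<alpha> * a" by (metis assms dvd_triv_left)
  then have "int \<beta> dvd a"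
    using coprime by (metis coprime_commute coprime_dvd_mult_right_iff coprime_int_iff)
  then obtain k where "a = int \<beta> * k" by (elim dvdE)
  moreover from this assms have "b = int \<alpha> * k" using \<beta>_pos by simp
  ultimately show ?thesis by (rule that)
qed

text \<open>
  The terms of a reduced expression have distinct values, since the values are proportional to
  the weights; so the value of \<open>r\<close> is that of its leading monomial, and surjectivity of \<open>v\<close> fixes
  the factor of proportionality. In particular \<open>V m\<close> consists of the functions in the coordinate
  ring whose pole order at infinity is at most \<open>m\<close>.
\<close>

lemma place_at_infinity:
  assumes v: "v \<in> places \<iota>" and neg: "v x < 0"
  shows "v x = - int \<beta>" and "v y = - int \<alpha>" and "y \<noteq> 0"
    and "r \<in> range ev \<Longrightarrow> r \<noteq> 0 \<Longrightarrow> v r \<le> 0"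
    and "r \<in> range ev \<Longrightarrow> r \<noteq> 0 \<Longrightarrow> v r \<ge> - int m \<longleftrightarrow> r \<in> V m"
    and "v (mon p) = - int (weight p)"
proof -
  have a0: "lead_coeff A \<noteq> 0" using degree_pos by auto
  have A: "poly_at \<iota> x A \<noteq> 0" "v (poly_at \<iota> x A) = int \<alpha> * v x"
    using poly_at_pole[OF v hom_\<iota> neg] a0 by auto
  show y0: "y \<noteq> 0" using A(1) \<beta>_pos by (auto simp flip: curve_eq simp: zero_power)
  have "int \<beta> * v y = int \<alpha> * v x"
    using A(2) place_power[OF v y0, of \<beta>] by (simp add: curve_eq)
  then obtain k where k: "v x = int \<beta> * k" "v y = int \<alpha> * k" by (rule coprime_scaled_pair)
  have k0: "k < 0" using neg \<beta>_pos unfolding k by (simp add: mult_less_0_iff)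
  have v_mon: "v (mon p) = k * int (weight p)" for p
    using x_nonzero y0 by (simp add: mon_def place_mult[OF v] place_power[OF v] k weight_def algebra_simps)
  have V_ge: "s \<in> val_ge v (k * int m)" if s: "s \<in> V m" for s m
  proof -
    from s obtain c where "s = comb m c" by (auto simp: V_def)
    moreover have "\<iota> (c p) * mon p \<in> val_ge v (k * int m)" if "p \<in> reduced m" for p
    proof -
      have "k * int m \<le> k * int (weight p)"
        using that k0 by (intro mult_left_mono_neg) (auto simp: reduced_def)
      then have "mon p \<in> val_ge v (k * int m)" by (simp add: val_ge_def v_mon)
      then show ?thesis using val_ge_mult[OF v val_ge_const[OF v hom_\<iota>]] by fastforce
    qed
    ultimately show ?thesis by (auto simp: comb_def intro: val_ge_sum[OF v])
  qed
  have v_lead: "\<exists>p. v r = k * int (weight p) \<and> r \<in> V (weight p)"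
    if "r \<in> range ev" "r \<noteq> 0" for r
  proof -
    from that obtain p a s where p: "snd p < \<beta>" "a \<noteq> 0" "r = \<iota> a * mon p + s"
      and s: "s = 0 \<or> weight p > 0 \<and> s \<in> V (weight p - 1)"
      by (rule leading_monomial)
    have t: "\<iota> a * mon p \<noteq> 0" "v (\<iota> a * mon p) = k * int (weight p)"
      using p mon_nonzero by (simp_all add: \<iota>_simps place_mult[OF v] place_const[OF v] v_mon)
    have "s \<in> val_ge v (k * int (weight p) + 1)"
      using s
    proof
      assume s: "weight p > 0 \<and> s \<in> V (weight p - 1)"
      then have "s \<in> val_ge v (k * int (weight p - 1))" using V_ge by blast
      moreover have "k * int (weight p) + 1 \<le> k * int (weight p - 1)"
        using s k0 by (simp add: of_nat_diff algebra_simps)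
      ultimately show ?thesis by (rule val_ge_mono[rotated])
    qed simp
    then have "v r = k * int (weight p)"
      unfolding p(3) using place_add_dominant(2)[OF v t(1)] t(2) by metis
    moreover have "r \<in> V (weight p)"
    proof -
      have "s \<in> V (weight p)" using s V_mono[of "weight p - 1" "weight p"] V_0 by auto
      then show ?thesis unfolding p(3) by (intro V_add V_scale mon_in_V) auto
    qed
    ultimately show ?thesis by blast
  qed
  have "k = - 1"
  proof -
    obtain z where z: "z \<noteq> 0" "v z = 1" using place_surj[OF v, of 1] .
    obtain g h where gh: "ev h \<noteq> 0" "z = ev g / ev h" by (rule fraction)
    with z have "ev g \<noteq> 0" by auto
    with gh z have "1 = v (ev g) - v (ev h)" by (simp add: place_divide[OF v])
    moreover have "k dvd v (ev g)" "k dvd v (ev h)"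
      using v_lead[of "ev g"] v_lead[of "ev h"] gh(1) \<open>ev g \<noteq> 0\<close> by auto
    ultimately have "k dvd 1" by (metis dvd_diff)
    with k0 show ?thesis by (simp add: zdvd1_eq)
  qed
  then show "v x = - int \<beta>" "v y = - int \<alpha>" using k by simp_all
  show "v (mon p) = - int (weight p)" using v_mon[of p] \<open>k = - 1\<close> by simp
  show "v r \<le> 0" if "r \<in> range ev" "r \<noteq> 0" for r using v_lead[OF that] \<open>k = - 1\<close> by auto
  show "v r \<ge> - int m \<longleftrightarrow> r \<in> V m" if r: "r \<in> range ev" "r \<noteq> 0" for r m
  proof
    assume "v r \<ge> - int m"
    moreover obtain p where "v r = k * int (weight p)" "r \<in> V (weight p)" using v_lead[OF r] by blast
    ultimately show "r \<in> V m" using \<open>k = - 1\<close> V_mono[of "weight p" m] by auto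
  next
    assume "r \<in> V m"
    then show "v r \<ge> - int m" using V_ge[of r m] r \<open>k = - 1\<close> by (simp add: val_ge_def)
  qed
qed

lemma place_eqI:
  assumes v: "v \<in> places \<iota>" and v': "v' \<in> places \<iota>"
    and eq: "\<And>r. r \<in> range ev \<Longrightarrow> r \<noteq> 0 \<Longrightarrow> v r = v' r"
  shows "v = v'"
proof
  fix z
  obtain g h where gh: "ev h \<noteq> 0" "z = ev g / ev h" by (rule fraction)
  show "v z = v' z"
  proof (cases "ev g = 0")
    case True
    then show ?thesis using gh(2) by (simp add: place_zero[OF v] place_zero[OF v'])
  next
    case False
    with gh show ?thesis by (simp add: place_divide[OF v] place_divide[OF v'] eq)
  qed
qed

lemma place_at_infinity_unique:
  assumes v: "v \<in> places \<iota>" "v x < 0" and v': "v' \<in> places \<iota>" "v' x < 0"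
  shows "v = v'"
proof (rule place_eqI[OF v(1) v'(1)])
  fix r assume r: "r \<in> range ev" "r \<noteq> 0"
  have iff: "v r \<ge> - int m \<longleftrightarrow> v' r \<ge> - int m" for m
    using place_at_infinity(5)[OF v r] place_at_infinity(5)[OF v' r] by simp
  have "v r \<le> 0" "v' r \<le> 0"
    using place_at_infinity(4)[OF v r] place_at_infinity(4)[OF v' r] by simp_all
  then show "v r = v' r" using iff[of "nat (- v r)"] iff[of "nat (- v' r)"] by simp
qed

text \<open>
  A point of the curve over a field \<open>'l\<close> whose \<open>y\<close>-coordinate is transcendental over the
  constants is generic: an element of the coordinate ring divides a nonzero polynomial in \<open>y\<close>, so it
  cannot vanish there.
\<close>

lemma extend_to_function_field:
  fixes \<kappa> :: "'k \<Rightarrow> 'l::field"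
  assumes \<kappa>: "unital_hom \<kappa>" and curve: "yL ^ \<beta> = poly_at \<kappa> xL A"
    and transc: "\<And>h. h \<noteq> 0 \<Longrightarrow> poly_at \<kappa> yL h \<noteq> 0"
  obtains \<Phi> where "unital_hom \<Phi>" "\<And>c. \<Phi> (\<iota> c) = \<kappa> c" "\<Phi> x = xL" "\<Phi> y = yL"
proof -
  define E where "E = poly_at (poly_at \<kappa> xL) yL"
  have hX: "unital_hom (poly_at \<kappa> xL)" by (rule unital_hom_poly_at[OF \<kappa>])
  then have E: "unital_hom E" unfolding E_def by (rule unital_hom_poly_at)
  have E_f: "E (separated_curve_poly \<beta> A) = 0"
    unfolding separated_curve_poly_def unital_hom_diff[OF E]
    by (simp add: E_def poly_at_monom hX unital_hom_one[OF hX] curve)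
  have E_eq: "E g = E h" if "ev g = ev h" for g h
  proof -
    have "ev (g - h) = 0" using that by (simp add: ev_simps)
    then obtain k where "g - h = separated_curve_poly \<beta> A * k" by (auto simp: ev_eq_0_iff)
    then have "E (g - h) = 0" by (simp only: unital_hom_mult[OF E] E_f mult_zero_left)
    then show ?thesis by (simp add: unital_hom_diff[OF E])
  qed
  have E_nz: "E g \<noteq> 0" if g: "ev g \<noteq> 0" for g
  proof -
    obtain r' h where r: "r' \<in> range ev" "h \<noteq> 0" "ev g * r' = poly_at \<iota> y h"
      using divides_y_poly[of "ev g"] g by blast
    from r(1) obtain g' where g': "r' = ev g'" by auto
    let ?h = "map_poly (\<lambda>c. [:c:]) h"
    have c: "unital_hom (\<lambda>c::'k. [:c:])" by (simp add: unital_hom_def one_pCons)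
    have "poly_at \<iota> y h = ev ?h"
      by (simp add: eval_bivariate_poly_at hom_\<iota> flip: poly_at_comp[OF c hom_x])
    then have "ev (g * g') = ev ?h" using r(3) by (simp add: g' ev_simps)
    then have "E g * E g' = E ?h" by (metis E_eq unital_hom_mult[OF E])
    also have "\<dots> = poly_at \<kappa> yL h"
      by (simp add: E_def \<kappa> flip: poly_at_comp[OF c hX])
    finally show ?thesis using transc[OF r(2)] by auto
  qed
  define \<Phi> where "\<Phi> z = (SOME u. \<exists>g h. ev h \<noteq> 0 \<and> z = ev g / ev h \<and> u = E g / E h)" for z
  have \<Phi>: "\<Phi> (ev g / ev h) = E g / E h" if h: "ev h \<noteq> 0" for g h
  proof -
    have "\<exists>g' h'. ev h' \<noteq> 0 \<and> ev g / ev h = ev g' / ev h' \<and> \<Phi> (ev g / ev h) = E g' / E h'"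
      unfolding \<Phi>_def by (rule someI[of _ "E g / E h"]) (use h in blast)
    then obtain g' h' where *: "ev h' \<noteq> 0" "ev g / ev h = ev g' / ev h'"
      "\<Phi> (ev g / ev h) = E g' / E h'" by blast
    then have "ev (g * h') = ev (g' * h)" using h by (simp add: ev_simps frac_eq_eq)
    then have "E g * E h' = E g' * E h" by (metis E_eq unital_hom_mult[OF E])
    then show ?thesis using * E_nz h by (simp add: frac_eq_eq)
  qed
  have ev1: "ev 1 \<noteq> 0" by (simp add: ev_simps)
  have \<Phi>_ev: "\<Phi> (ev g) = E g" for g
    using \<Phi>[OF ev1, of g] by (simp add: ev_simps unital_hom_one[OF E])
  have "unital_hom \<Phi>"
    unfolding unital_hom_def
  proof (intro conjI allI)
    show "\<Phi> 1 = 1" using \<Phi>_ev[of 1] by (simp add: ev_simps unital_hom_one[OF E])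
    fix a b
    obtain g h where a: "ev h \<noteq> 0" "a = ev g / ev h" by (rule fraction)
    obtain g' h' where b: "ev h' \<noteq> 0" "b = ev g' / ev h'" by (rule fraction)
    have hh: "ev (h * h') \<noteq> 0" using a b by (simp add: ev_simps)
    have "a + b = ev (g * h' + g' * h) / ev (h * h')" using a b by (simp add: ev_simps add_frac_eq)
    then have "\<Phi> (a + b) = E (g * h' + g' * h) / E (h * h')" using \<Phi>[OF hh] by simp
    then show "\<Phi> (a + b) = \<Phi> a + \<Phi> b"
      using a b E_nz by (simp add: \<Phi> unital_hom_simps[OF E] add_frac_eq)
    have "a * b = ev (g * g') / ev (h * h')" using a b by (simp add: ev_simps)
    then have "\<Phi> (a * b) = E (g * g') / E (h * h')" using \<Phi>[OF hh] by simp
    then show "\<Phi> (a * b) = \<Phi> a * \<Phi> b" using a b by (simp add: \<Phi> unital_hom_simps[OF E])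
  qed
  moreover have "\<Phi> (\<iota> c) = \<kappa> c" for c
    using \<Phi>_ev[of "[:[:c:]:]"] by (simp add: ev_const hom_\<iota>) (simp add: E_def hX \<kappa>)
  moreover have "\<Phi> x = xL"
    using \<Phi>_ev[of "[:[:0, 1:]:]"] by (simp add: ev_const poly_at_pCons hom_\<iota> \<iota>_simps)
      (simp add: E_def hX poly_at_pCons \<kappa> unital_hom_simps[OF \<kappa>])
  moreover have "\<Phi> y = yL"
    using \<Phi>_ev[of "[:0, 1:]"]
    by (simp add: eval_bivariate_poly_at poly_at_pCons hom_x unital_hom_simps[OF hom_x])
      (simp add: E_def hX poly_at_pCons unital_hom_simps[OF hX])
  ultimately show ?thesis by (rule that)
qed

abbreviation "laurent_const \<equiv> (\<lambda>c::'k. fls_const (to_ac c))"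

lemma hom_laurent_const: "unital_hom laurent_const"
  by (rule unital_hom_comp[OF unital_hom_to_ac unital_hom_fls_const])

lemma extend_to_laurent:
  assumes "yL ^ \<beta> = poly_at fls_const xL (map_poly to_ac A)" and "\<And>c. yL \<noteq> fls_const c"
  shows "\<exists>\<Phi>. unital_hom \<Phi> \<and> (\<forall>c. \<Phi> (\<iota> c) = laurent_const c) \<and> \<Phi> x = xL \<and> \<Phi> y = yL"
proof (rule extend_to_function_field[OF hom_laurent_const])
  show "yL ^ \<beta> = poly_at laurent_const xL A"
    using assms(1) by (simp add: poly_at_comp[OF unital_hom_to_ac unital_hom_fls_const])
  fix h :: "'k poly" assume "h \<noteq> 0"
  then have "map_poly to_ac h \<noteq> 0" by (subst map_poly_eq_0_iff) auto
  then show "poly_at laurent_const yL h \<noteq> 0"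
    using alg_closed_transcendental[OF assms(2)]
    by (simp add: poly_at_comp[OF unital_hom_to_ac unital_hom_fls_const])
qed blast

lemma infinite_place_exists:
  obtains v where "v \<in> places \<iota>" "v x < 0"
proof -
  define p where "p = map_poly to_ac A"
  have deg_p: "degree p = \<alpha>" unfolding p_def by (rule degree_map_poly) auto
  then have "p \<noteq> 0" using degree_pos by auto
  have "gcd \<beta> \<alpha> = 1" using coprime by (simp add: coprime_iff_gcd_eq_1 gcd.commute)
  then obtain a b where "\<beta> * a = \<alpha> * b + 1" using bezout_nat[of \<beta> \<alpha>] \<beta>_pos by auto
  then have ab: "a * \<beta> = b * \<alpha> + 1" by (simp add: mult.commute)
  obtain G where G: "G $ 0 \<noteq> 0" "G * poly_at fps_const (G ^ b * fps_X ^ \<beta>) (reflect_poly p) = 1"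
    by (rule branch_at_infinity[OF \<open>p \<noteq> 0\<close> \<beta>_pos])
  define E where "E = fps_to_fls G"
  define U where "U = E ^ b * fls_X ^ \<beta>"
  define xL where "xL = inverse U"
  define yL where "yL = inverse (E ^ a * fls_X ^ \<alpha>)"
  have G0: "G \<noteq> 0" using G(1) by auto
  then have E0: "E \<noteq> 0" by (simp add: E_def)
  then have U0: "U \<noteq> 0" by (simp add: U_def)
  have sub_E: "fls_subdegree E = 0"
    using G(1) G0 by (simp add: E_def fls_subdegree_fls_to_fps subdegree_eq_0_iff)
  have sub_X: "fls_subdegree xL = - int \<beta>"
    using E0 by (simp add: xL_def U_def fls_subdegree_pow sub_E)
  have sub_Y: "fls_subdegree yL = - int \<alpha>"
    using E0 by (simp add: yL_def fls_subdegree_pow sub_E)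
  have "fps_to_fls (G * poly_at fps_const (G ^ b * fps_X ^ \<beta>) (reflect_poly p)) = 1"
    using G(2) by simp
  then have "E * poly_at fls_const U (reflect_poly p) = 1"
    by (simp add: fls_times_fps_to_fls hom_poly_at[OF unital_hom_fps_const unital_hom_fps_to_fls]
        E_def U_def fps_to_fls_power fps_X_to_fls)
  moreover have "map_poly fls_const (reflect_poly p) = reflect_poly (map_poly fls_const p)"
    by (rule poly_eqI) (simp add: coeff_map_poly coeff_reflect_poly degree_map_poly)
  ultimately have "E * (U ^ \<alpha> * poly_at fls_const xL p) = 1"
    using poly_reflect_poly_nz[OF U0, of "map_poly fls_const p"]
    by (simp add: poly_at_def xL_def degree_map_poly deg_p)
  then have "poly_at fls_const xL p = inverse (E * U ^ \<alpha>)"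
    by (metis inverse_unique mult.assoc)
  also have "E * U ^ \<alpha> = (E ^ a * fls_X ^ \<alpha>) ^ \<beta>"
    by (simp add: U_def power_mult_distrib ab mult.commute[of \<alpha> \<beta>] flip: power_mult)
  finally have curve: "yL ^ \<beta> = poly_at fls_const xL (map_poly to_ac A)"
    by (simp only: yL_def p_def power_inverse)
  have Yc: "yL \<noteq> fls_const c" for c
    using sub_Y degree_pos by (metis fls_const_subdegree neg_equal_0_iff_equal of_nat_0_eq_iff less_irrefl)
  from extend_to_laurent[OF curve Yc]
  obtain \<Phi> where "unital_hom \<Phi>" "\<forall>c. \<Phi> (\<iota> c) = laurent_const c" "\<Phi> x = xL"
    by (elim exE conjE)
  note \<Phi> = this(1) this(2)[rule_format] this(3)
  have "fls_subdegree (\<Phi> x) \<noteq> 0" using \<beta>_pos by (simp add: \<Phi>(3) sub_X)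
  from place_of_laurent_embedding[where \<iota> = \<iota> and \<tau> = to_ac, OF \<Phi>(1,2) this]
  obtain v e where v: "v \<in> places \<iota>" "e > 0" "\<forall>z. fls_subdegree (\<Phi> z) = e * v z"
    by (elim bexE exE conjE)
  have "e * v x < 0" using v(3)[rule_format, of x] \<beta>_pos by (simp add: \<Phi>(3) sub_X)
  then have "v x < 0" using v(2) by (simp add: mult_less_0_iff)
  with v(1) show ?thesis by (rule that)
qed

lemma affine_branch:
  assumes "poly (map_poly to_ac A) a = b ^ \<beta>" and "poly (pderiv (map_poly to_ac A)) a \<noteq> 0"
  shows "\<exists>\<Phi> \<xi>. unital_hom \<Phi> \<and> (\<forall>c. \<Phi> (\<iota> c) = laurent_const c) \<and>
    \<Phi> x = fps_to_fls \<xi> \<and> \<xi> $ 0 = a \<and> \<Phi> y = fps_to_fls (fps_const b + fps_X)"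
proof -
  obtain \<xi> where \<xi>: "\<xi> $ 0 = a" "poly_at fps_const \<xi> (map_poly to_ac A) = (fps_const b + fps_X) ^ \<beta>"
    by (rule hensel_branch[OF assms])
  have curve: "fps_to_fls (fps_const b + fps_X) ^ \<beta> = poly_at fls_const (fps_to_fls \<xi>) (map_poly to_ac A)"
    using arg_cong[OF \<xi>(2), of fps_to_fls]
    by (simp add: hom_poly_at[OF unital_hom_fps_const unital_hom_fps_to_fls] fps_to_fls_power)
  have nonconst: "fps_to_fls (fps_const b + fps_X) \<noteq> fls_const c" for c
  proof
    assume "fps_to_fls (fps_const b + fps_X) = fls_const c"
    then have "fls_nth (fps_to_fls (fps_const b + fps_X)) 1 = fls_nth (fls_const c) 1" by (rule arg_cong)
    then show False by simp
  qed
  from extend_to_laurent[OF curve nonconst]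
  show ?thesis using \<xi>(1) by (elim exE conjE) (intro exI conjI)
qed

end

section \<open>Functions without poles outside infinity\<close>

text \<open>
  Differentiating \<open>A(X + Y) = A(X) + A(Y)\<close> with respect to \<open>Y\<close> and setting \<open>Y = 0\<close>.
\<close>

lemma additive_poly_pderiv:
  assumes "additive_poly A"
  shows "pderiv A = [:coeff A 1:]"
proof -
  let ?C = "map_poly (\<lambda>c::'a. [:c:])" and ?XY = "[:[:0, 1 :: 'a:], 1:]"
  have pd: "pderiv (?C B) = ?C (pderiv B)" for B
    by (rule poly_eqI) (simp add: coeff_pderiv coeff_map_poly of_nat_poly)
  have "pderiv ?XY = 1" by (simp add: pderiv_pCons one_pCons)
  moreover have "pderiv (pcompose (?C A) ?XY) = pderiv ([:A:] + ?C A)"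
    using assms by (simp add: additive_poly_def)
  ultimately have "pcompose (?C (pderiv A)) ?XY = ?C (pderiv A)"
    by (simp add: pderiv_pcompose pderiv_add pderiv_pCons pd)
  then have "poly (pcompose (?C (pderiv A)) ?XY) 0 = poly (?C (pderiv A)) 0" by simp
  then have "pderiv A = [:coeff (pderiv A) 0:]"
    by (simp add: poly_pcompose poly_0_coeff_0 coeff_map_poly flip: pcompose_altdef)
  then show ?thesis by (simp add: coeff_pderiv)
qed

lemma additive_poly_add:
  assumes "additive_poly A"
  shows "poly A (r + s) = poly A r + poly A s"
proof -
  let ?C = "map_poly (\<lambda>c::'a. [:c:])" and ?XY = "[:[:0, 1 :: 'a:], 1:]"
  have "poly (poly (pcompose (?C A) ?XY) [:s:]) r = poly (poly ([:A:] + ?C A) [:s:]) r"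
    using assms by (simp add: additive_poly_def)
  then show ?thesis
    by (simp add: poly_pcompose pcompose_pCons_0 add.commute flip: pcompose_altdef)
qed

lemma card_simple_roots:
  fixes p :: "'c::alg_closed_field poly"
  assumes "p \<noteq> 0" and "\<And>a. poly p a = 0 \<Longrightarrow> poly (pderiv p) a \<noteq> 0"
  shows "card {a. poly p a = 0} = degree p"
  using assms
proof (induction "degree p" arbitrary: p rule: less_induct)
  case (less p)
  show ?case
  proof (cases "degree p = 0")
    case True
    then obtain c where "p = [:c:]" by (metis degree_eq_zeroE)
    with less.prems(1) show ?thesis by simp
  next
    case False
    then obtain c where c: "poly p c = 0" using alg_closed_imp_poly_has_root by blast
    obtain r where r: "p = [:poly p c:] + [:- c, 1:] * r" "poly r c = poly (pderiv p) c"
      by (rule poly_expand_at)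
    have p: "p = [:- c, 1:] * r" using r(1) c by simp
    then have "r \<noteq> 0" using less.prems(1) by auto
    then have deg: "degree p = Suc (degree r)" by (subst p, subst degree_mult_eq) auto
    have rc: "poly r c \<noteq> 0" using r(2) less.prems(2)[OF c] by simp
    have "pderiv [:- c, 1:] = 1" by (simp add: pderiv_pCons one_pCons)
    then have pd: "pderiv p = [:- c, 1:] * pderiv r + r"
      by (subst p) (simp add: pderiv_mult del: mult_pCons_left)
    have "card {a. poly r a = 0} = degree r"
    proof (rule less.hyps)
      fix a assume a: "poly r a = 0"
      then have "poly p a = 0" by (subst p) simp
      from less.prems(2)[OF this] show "poly (pderiv r) a \<noteq> 0" using a by (auto simp: pd)
    qed (use deg \<open>r \<noteq> 0\<close> in auto)
    moreover have "poly p a = (a - c) * poly r a" for a by (subst p) (simp add: algebra_simps)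
    then have "{a. poly p a = 0} = insert c {a. poly r a = 0}" by auto
    ultimately show ?thesis using rc deg poly_roots_finite[OF \<open>r \<noteq> 0\<close>] by simp
  qed
qed

text \<open>
  Additivity makes the derivative of \<open>A\<close> a constant, and separability makes it nonzero. Hence
  every affine point is smooth and unramified over the \<open>y\<close>-line.
\<close>

locale additive_curve = separated_curve A \<beta> \<iota> x y
  for A :: "'k::{field, finite} poly" and \<beta> and \<iota> :: "'k \<Rightarrow> 'f::field" and x y +
  assumes additive: "additive_poly A" and separable: "separable_poly A"
begin

lemma pderiv_A: "pderiv A = [:coeff A 1:]"
  by (rule additive_poly_pderiv[OF additive])

lemma coeff_1_nonzero: "coeff A 1 \<noteq> 0"
proof
  assume "coeff A 1 = 0"
  then have "is_unit A" using separable pderiv_A by (simp add: separable_poly_def)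
  then show False using degree_pos is_unit_iff_degree[of A] by (cases "A = 0") auto
qed

text \<open>
  The coordinate ring as the free module over the polynomials in \<open>y\<close> with basis
  \<open>1, x, \<dots>, x\<^bsup>\<alpha> - 1\<^esup>\<close>. Over the \<open>y\<close>-line the curve is unramified, which makes this basis better suited to
  local arguments at affine points than the reduced monomials.
\<close>

definition ycomb :: "(nat \<Rightarrow> 'k poly) \<Rightarrow> 'f" where
  "ycomb G = (\<Sum>i<\<alpha>. poly_at \<iota> y (G i) * x ^ i)"

lemma ycomb_add: "u \<in> range ycomb \<Longrightarrow> v \<in> range ycomb \<Longrightarrow> u + v \<in> range ycomb"
proof -
  assume "u \<in> range ycomb" "v \<in> range ycomb"
  then obtain F G where "u = ycomb F" "v = ycomb G" by auto
  then have "u + v = ycomb (\<lambda>i. F i + G i)"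
    by (simp add: ycomb_def unital_hom_add[OF hom_y] algebra_simps sum.distrib)
  then show ?thesis by simp
qed

lemma ycomb_scale: "u \<in> range ycomb \<Longrightarrow> poly_at \<iota> y h * u \<in> range ycomb"
proof -
  assume "u \<in> range ycomb"
  then obtain F where "u = ycomb F" by auto
  then have "poly_at \<iota> y h * u = ycomb (\<lambda>i. h * F i)"
    by (simp add: ycomb_def unital_hom_mult[OF hom_y] algebra_simps sum_distrib_left)
  then show ?thesis by simp
qed

lemma ycomb_sum: "(\<And>s. s \<in> S \<Longrightarrow> f s \<in> range ycomb) \<Longrightarrow> sum f S \<in> range ycomb"
proof (induction S rule: infinite_finite_induct)
  have "0 = ycomb (\<lambda>_. 0)" by (simp add: ycomb_def)
  then have "0 \<in> range ycomb" by (metis rangeI)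
  then show "sum f {} \<in> range ycomb" "infinite B \<Longrightarrow> sum f B \<in> range ycomb" for B by simp_all
qed (auto intro: ycomb_add)

lemma x_power_ycomb: "x ^ i \<in> range ycomb"
proof (induction i rule: less_induct)
  case (less i)
  show ?case
  proof (cases "i < \<alpha>")
    case True
    have "ycomb (\<lambda>l. if l = i then 1 else 0) = (\<Sum>l<\<alpha>. if l = i then x ^ i else 0)"
      unfolding ycomb_def by (intro sum.cong) (auto simp: unital_hom_one[OF hom_y])
    with True have "ycomb (\<lambda>l. if l = i then 1 else 0) = x ^ i" by simp
    then show ?thesis by (metis rangeI)
  next
    case False
    define a where "a = lead_coeff A"
    have "a \<noteq> 0" using degree_pos by (auto simp: a_def)
    obtain j where i: "i = \<alpha> + j" using False by (metis le_Suc_ex not_less)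
    have "y ^ \<beta> = \<iota> a * x ^ \<alpha> + (\<Sum>l<\<alpha>. \<iota> (coeff A l) * x ^ l)"
      by (simp add: curve_eq poly_at_sum[OF hom_\<iota>] lessThan_Suc_atMost[symmetric] a_def)
    then have "\<iota> a * x ^ i = y ^ \<beta> * x ^ j - (\<Sum>l<\<alpha>. \<iota> (coeff A l) * x ^ (l + j))"
      by (simp add: i power_add algebra_simps sum_distrib_right sum_distrib_left)
    then have "\<iota> (inverse a) * (\<iota> a * x ^ i)
        = \<iota> (inverse a) * (y ^ \<beta> * x ^ j - (\<Sum>l<\<alpha>. \<iota> (coeff A l) * x ^ (l + j)))"
      by (rule arg_cong)
    also have "\<dots> = \<iota> (inverse a) * (y ^ \<beta> * x ^ j)
        + (\<Sum>l<\<alpha>. \<iota> (- inverse a * coeff A l) * x ^ (l + j))"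
      by (simp add: \<iota>_simps algebra_simps sum_distrib_left sum_negf)
    finally have "\<iota> (inverse a) * (\<iota> a * x ^ i) = \<iota> (inverse a) * (y ^ \<beta> * x ^ j)
        + (\<Sum>l<\<alpha>. \<iota> (- inverse a * coeff A l) * x ^ (l + j))" .
    moreover have "\<iota> (inverse a) * (\<iota> a * x ^ i) = x ^ i"
      using \<open>a \<noteq> 0\<close> by (simp add: mult.assoc[symmetric] \<iota>_simps flip: unital_hom_mult[OF hom_\<iota>])
    moreover have "\<iota> (inverse a) * (y ^ \<beta> * x ^ j) \<in> range ycomb"
      using ycomb_scale[OF less.IH[of j], of "Polynomial.monom (inverse a) \<beta>"] degree_pos
      by (simp add: i poly_at_monom hom_\<iota> mult.assoc)
    moreover have "\<iota> (- inverse a * coeff A l) * x ^ (l + j) \<in> range ycomb" if "l < \<alpha>" for l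
      using ycomb_scale[OF less.IH[of "l + j"], of "[:- inverse a * coeff A l:]"] that
      by (simp add: i hom_\<iota>)
    ultimately show ?thesis by (auto intro!: ycomb_add ycomb_sum)
  qed
qed

lemma range_ev_ycomb: "range ev \<subseteq> range ycomb"
proof
  fix r assume "r \<in> range ev"
  then obtain m c where "r = comb m c" by (auto simp: range_ev V_def)
  moreover have "\<iota> (c p) * mon p \<in> range ycomb" for p
    using ycomb_scale[OF x_power_ycomb, of "Polynomial.monom (c p) (snd p)" "fst p"]
    by (simp add: poly_at_monom hom_\<iota> mon_def algebra_simps)
  ultimately show "r \<in> range ycomb" by (auto simp: comb_def intro: ycomb_sum)
qed

lemma x_power_in_range: "x ^ i \<in> range ev" and y_poly_in_range: "poly_at \<iota> y h \<in> range ev"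
  using mon_in_V[of "(i, 0)"] y_poly_in_V[of h] by (auto simp: range_ev mon_def)

lemma ycomb_in_range: "ycomb G \<in> range ev"
proof -
  have sum: "sum f S \<in> range ev" if "\<And>s. s \<in> S \<Longrightarrow> f s \<in> range ev" for f and S :: "nat set"
    using that const_in_range[of 0]
    by (induction S rule: infinite_finite_induct) (auto simp: \<iota>_simps intro: range_ev_closed)
  then show ?thesis
    unfolding ycomb_def by (intro sum range_ev_closed x_power_in_range y_poly_in_range) 
qed

lemma y_poly_nonzero:
  assumes "h \<noteq> 0"
  shows "poly_at \<iota> y h \<noteq> 0"
proof -
  obtain v where v: "v \<in> places \<iota>" "v x < 0" by (rule infinite_place_exists)
  have "v y < 0" using place_at_infinity(2)[OF v] degree_pos by simp
  then show ?thesis by (rule poly_at_pole(1)[OF v(1) hom_\<iota> _ assms])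
qed

text \<open>
  Write \<open>z = (\<Sum> G\<^sub>i(y) x\<^sup>i)/h(y)\<close> with \<open>i < \<alpha>\<close> and \<open>h\<close> of least degree. If \<open>h\<close> had a
  root \<open>b\<close> in the algebraic closure, then at each of the \<open>\<alpha>\<close> distinct points \<open>(a, b)\<close>
  regularity of \<open>z\<close> would force \<open>\<Sum> G\<^sub>i(b) a\<^sup>i = 0\<close>. A polynomial of degree less than \<open>\<alpha>\<close>
  with \<open>\<alpha>\<close> roots is zero, so \<open>b\<close> would be a common root of \<open>h\<close> and all \<open>G\<^sub>i\<close>, and its minimal
  polynomial could be cancelled.
\<close>

lemma regular_outside_infinity:
  assumes reg: "\<And>v. v \<in> places \<iota> \<Longrightarrow> \<not> v x < 0 \<Longrightarrow> z \<in> val_ge v 0"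
  shows "z \<in> range ev"
proof -
  define denom where "denom h \<longleftrightarrow> h \<noteq> 0 \<and> z * poly_at \<iota> y h \<in> range ycomb" for h
  have "\<exists>h. denom h"
  proof -
    obtain g k where gk: "ev k \<noteq> 0" "z = ev g / ev k" by (rule fraction)
    obtain r' h where r: "r' \<in> range ev" "h \<noteq> 0" "ev k * r' = poly_at \<iota> y h"
      using divides_y_poly[of "ev k"] gk(1) by blast
    have "z * poly_at \<iota> y h = ev g * r'" using gk by (simp flip: r(3))
    also have "\<dots> \<in> range ev" using r(1) by (intro range_ev_closed) auto
    finally have "z * poly_at \<iota> y h \<in> range ycomb" using range_ev_ycomb by blast
    with r(2) show ?thesis unfolding denom_def by blast
  qed
  then obtain h where h: "denom h" and min: "\<And>h'. denom h' \<Longrightarrow> degree h \<le> degree h'"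
    using ex_has_least_nat[of denom _ degree] by blast
  then obtain G where G: "z * poly_at \<iota> y h = ycomb G" and "h \<noteq> 0" by (auto simp: denom_def)
  have "degree h = 0"
  proof (rule ccontr)
    assume "degree h \<noteq> 0"
    moreover have "degree (map_poly to_ac h) = degree h" by (rule degree_map_poly) auto
    ultimately obtain b where b: "poly (map_poly to_ac h) b = 0"
      using alg_closed_imp_poly_has_root[of "map_poly to_ac h"] by auto
    let ?A = "map_poly to_ac A"
    have degA: "degree ?A = \<alpha>" by (rule degree_map_poly) auto
    have pdA: "pderiv ?A = [:to_ac (coeff A 1):]"
    proof -
      have "pderiv ?A = map_poly to_ac (pderiv A)"
        by (rule poly_eqI) (simp add: coeff_pderiv coeff_map_poly)
      then show ?thesis by (simp add: pderiv_A map_poly_pCons)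
    qed
    define Ab where "Ab = ?A - [:b ^ \<beta>:]"
    have degAb: "degree Ab = \<alpha>"
      using degree_add_eq_left[of "- [:b ^ \<beta>:]" ?A] degree_pos
      by (simp add: Ab_def degA del: minus_pCons)
    have card_roots: "card {a. poly Ab a = 0} = \<alpha>"
    proof -
      have "pderiv Ab = [:to_ac (coeff A 1):]" by (simp add: Ab_def pderiv_diff pdA pderiv_pCons)
      then show ?thesis
        using card_simple_roots[of Ab] degAb degree_pos coeff_1_nonzero by fastforce
    qed
    \<comment> \<open>the numerator on the line \<open>y = b\<close>; the Laurent expansions at the points of this line
        show that it has \<open>\<alpha>\<close> roots\<close>
    define N where "N = (\<Sum>i<\<alpha>. Polynomial.monom (poly (map_poly to_ac (G i)) b) i)"
    have root: "poly N a = 0" if a: "poly Ab a = 0" for a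
    proof -
      have on_curve: "poly ?A a = b ^ \<beta>" using a by (simp add: Ab_def)
      have simple: "poly (pderiv ?A) a \<noteq> 0" using coeff_1_nonzero by (simp add: pdA)
      from affine_branch[OF on_curve simple] obtain \<Phi> \<xi> where "unital_hom \<Phi>" "\<forall>c. \<Phi> (\<iota> c) = laurent_const c"
        "\<Phi> x = fps_to_fls \<xi>" "\<xi> $ 0 = a" "\<Phi> y = fps_to_fls (fps_const b + fps_X)"
        by (elim exE conjE)
      note \<Phi> = this(1) this(2)[rule_format] this(3-5)
      have "fls_subdegree (\<Phi> z) \<ge> 0"
      proof (rule ccontr)
        assume neg: "\<not> fls_subdegree (\<Phi> z) \<ge> 0"
        then have nz: "fls_subdegree (\<Phi> z) \<noteq> 0" by simp
        from place_of_laurent_embedding[where \<iota> = \<iota> and \<tau> = to_ac, OF \<Phi>(1,2) nz]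
        obtain v e where "v \<in> places \<iota>" "e > 0" "\<forall>z. fls_subdegree (\<Phi> z) = e * v z"
          by (elim bexE exE conjE)
        note v = this(1,2) this(3)[rule_format]
        have "e * v x \<ge> 0" by (simp add: \<Phi>(3) fls_subdegree_fls_to_fps flip: v(3))
        then have "\<not> v x < 0" using v(2) by (simp add: zero_le_mult_iff)
        then have "z \<in> val_ge v 0" by (rule reg[OF v(1)])
        moreover have "e * v z < 0" using neg v(3)[of z] by simp
        then have "v z < 0" using v(2) by (simp add: mult_less_0_iff)
        ultimately have "z = 0" by (simp add: val_ge_def)
        with \<open>v z < 0\<close> show False by (simp add: place_zero[OF v(1)])
      qed
      then have "\<Phi> z = fps_to_fls (fls_regpart (\<Phi> z))" by simp
      then obtain \<zeta> where \<zeta>: "\<Phi> z = fps_to_fls \<zeta>" by blast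
      let ?Y = "fps_const b + fps_X"
      have \<Phi>y: "\<Phi> (poly_at \<iota> y p) = fps_to_fls (poly_at fps_const ?Y (map_poly to_ac p))" for p
        by (simp add: hom_poly_at[OF hom_\<iota> \<Phi>(1)] hom_poly_at[OF unital_hom_fps_const unital_hom_fps_to_fls] \<Phi>
            poly_at_comp[OF unital_hom_to_ac unital_hom_fls_const])
      have nth0: "poly_at fps_const F p $ 0 = poly p (F $ 0)" for F :: "'k alg_closure fps" and p
        by (induction p) (simp_all add: poly_at_pCons unital_hom_fps_const)
      have "fps_to_fls (\<zeta> * poly_at fps_const ?Y (map_poly to_ac h))
          = \<Phi> (z * poly_at \<iota> y h)"
        by (simp add: unital_hom_mult[OF \<Phi>(1)] \<Phi>y \<zeta> fls_times_fps_to_fls)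
      also have "\<dots> = fps_to_fls (\<Sum>i<\<alpha>. poly_at fps_const ?Y (map_poly to_ac (G i)) * \<xi> ^ i)"
        unfolding G ycomb_def
        by (simp add: unital_hom_simps[OF \<Phi>(1)] \<Phi>y \<Phi>(3) unital_hom_simps[OF unital_hom_fps_to_fls])
      finally have "\<zeta> * poly_at fps_const ?Y (map_poly to_ac h)
          = (\<Sum>i<\<alpha>. poly_at fps_const ?Y (map_poly to_ac (G i)) * \<xi> ^ i)" by simp
      from arg_cong[OF this, of "\<lambda>f. f $ 0"]
      have "0 = (\<Sum>i<\<alpha>. poly (map_poly to_ac (G i)) b * a ^ i)"
        by (simp add: nth0 fps_sum_nth b \<Phi>(4) fps_nth_power_0)
      then show ?thesis by (simp add: N_def poly_sum poly_monom)
    qed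
    have "degree N < \<alpha>"
      unfolding N_def by (rule degree_sum_less) (auto simp: degree_pos intro: le_less_trans[OF degree_monom_le])
    then have "N = 0"
      using root card_roots by (intro poly_eqI_degree[of "{a. poly Ab a = 0}"]) auto
    have Gb: "poly (map_poly to_ac (G i)) b = 0" if "i < \<alpha>" for i
    proof -
      have "coeff N i = (\<Sum>j<\<alpha>. if j = i then poly (map_poly to_ac (G i)) b else 0)"
        unfolding N_def coeff_sum by (intro sum.cong) auto
      with that \<open>N = 0\<close> show ?thesis by simp
    qed
    \<comment> \<open>a generator of the annihilator of \<open>b\<close> over the constants divides \<open>h\<close> and all \<open>G i\<close>\<close>
    define ann where "ann p \<longleftrightarrow> p \<noteq> 0 \<and> poly (map_poly to_ac p) b = 0" for p
    have "ann h" using b \<open>h \<noteq> 0\<close> by (simp add: ann_def)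
    then obtain \<rho> where \<rho>: "ann \<rho>" "\<And>p. ann p \<Longrightarrow> degree \<rho> \<le> degree p"
      using ex_has_least_nat[of ann h degree] by blast
    have \<rho>_dvd: "\<rho> dvd p" if "poly (map_poly to_ac p) b = 0" for p
    proof -
      have hom: "unital_hom (poly_at to_ac b)" by (rule unital_hom_poly_at[OF unital_hom_to_ac])
      have "poly_at to_ac b (p div \<rho> * \<rho> + p mod \<rho>) = 0"
        using that by (simp add: poly_at_def)
      then have "poly_at to_ac b (p mod \<rho>) = 0"
        using \<rho>(1) by (simp only: unital_hom_add[OF hom] unital_hom_mult[OF hom]) (simp add: ann_def poly_at_def)
      then have "p mod \<rho> = 0"
        using \<rho>(1) \<rho>(2)[of "p mod \<rho>"] degree_mod_less[of \<rho> p]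
        by (cases "p mod \<rho> = 0") (auto simp: ann_def poly_at_def)
      then show ?thesis by (simp add: mod_eq_0_iff_dvd)
    qed
    obtain h' where h': "h = \<rho> * h'" using \<rho>_dvd[OF b] by (elim dvdE)
    have "\<forall>i. \<exists>p. i < \<alpha> \<longrightarrow> G i = \<rho> * p" using \<rho>_dvd[OF Gb] by (metis dvdE)
    then obtain G' where G': "\<And>i. i < \<alpha> \<Longrightarrow> G i = \<rho> * G' i" by metis
    have "\<rho> \<noteq> 0" using \<rho>(1) by (simp add: ann_def)
    have "poly_at \<iota> y \<rho> * (z * poly_at \<iota> y h') = poly_at \<iota> y \<rho> * ycomb G'"
      using G by (simp add: h' G' ycomb_def unital_hom_mult[OF hom_y] sum_distrib_left algebra_simps)
    then have "z * poly_at \<iota> y h' = ycomb G'" using y_poly_nonzero[OF \<open>\<rho> \<noteq> 0\<close>] by simp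
    then have "denom h'" using \<open>h \<noteq> 0\<close> by (auto simp: denom_def h')
    then have "degree h \<le> degree h'" by (rule min)
    moreover have "degree h = degree \<rho> + degree h'"
      using \<open>h \<noteq> 0\<close> unfolding h' by (intro degree_mult_eq) auto
    ultimately have "degree \<rho> = 0" by simp
    then obtain c where "\<rho> = [:c:]" by (metis degree_eq_zeroE)
    with \<rho>(1) show False by (simp add: ann_def map_poly_pCons)
  qed
  then obtain c where c: "h = [:c:]" by (metis degree_eq_zeroE)
  then have "c \<noteq> 0" using \<open>h \<noteq> 0\<close> by auto
  have "z = \<iota> (inverse c) * ycomb G"
    unfolding G[symmetric] using \<open>c \<noteq> 0\<close>
    by (simp add: c hom_\<iota> unital_hom_inverse[OF hom_\<iota>] \<iota>_simps)
  then show ?thesis by (auto intro: range_ev_closed const_in_range ycomb_in_range)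
qed

end

section \<open>The genus and the rational places\<close>

lemma valuation_ring_val_ge: "valuation_ring v = val_ge v 0"
  and valuation_ideal_val_ge: "valuation_ideal v = val_ge v 1"
  by (auto simp: valuation_ring_def valuation_ideal_def val_ge_def)

lemma vector_space_const_scale: "unital_hom \<iota> \<Longrightarrow> vector_space (const_scale \<iota>)"
  by unfold_locales (simp_all add: unital_hom_simps algebra_simps)

lemma subspace_val_ge:
  assumes "v \<in> places \<iota>" "unital_hom \<iota>"
  shows "module.subspace (const_scale \<iota>) (val_ge v m)"
proof -
  interpret vector_space "const_scale \<iota>" by (rule vector_space_const_scale[OF assms(2)])
  show ?thesis
  proof (rule subspaceI)
    show "\<iota> c * a \<in> val_ge v m" if "a \<in> val_ge v m" for c a
      using val_ge_mult[OF assms(1) val_ge_const[OF assms] that, of c] by simp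
  qed (auto intro: val_ge_add[OF assms(1)])
qed

lemma poly_at_congruent:
  assumes "v \<in> places \<iota>" "unital_hom \<iota>" "z \<in> val_ge v 0" "z - \<iota> a \<in> val_ge v 1"
  shows "poly_at \<iota> z p - \<iota> (poly p a) \<in> val_ge v 1"
proof -
  obtain u where u: "p = [:poly p a:] + [:- a, 1:] * u" by (rule poly_expand_at)
  have "poly_at \<iota> z p = \<iota> (poly p a) + (z - \<iota> a) * poly_at \<iota> z u"
    by (subst u) (simp add: poly_at_add poly_at_mult poly_at_pCons assms(2) unital_hom_simps[OF assms(2)]
        del: mult_pCons_left mult_pCons_right)
  moreover have "(z - \<iota> a) * poly_at \<iota> z u \<in> val_ge v (1 + 0)"
    by (intro val_ge_mult[OF assms(1)] assms poly_at_val_ge)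
  ultimately show ?thesis by simp
qed

context additive_curve
begin

lemma leading_at_infinity:
  assumes v: "v \<in> places \<iota>" "v x < 0" and r: "r \<in> range ev" "r \<noteq> 0"
  obtains p a where "snd p < \<beta>" "a \<noteq> 0" "v r = - int (weight p)"
    "r - \<iota> a * mon p \<in> val_ge v (v r + 1)"
proof -
  obtain p a s where p: "snd p < \<beta>" "a \<noteq> 0" "r = \<iota> a * mon p + s"
    and s: "s = 0 \<or> weight p > 0 \<and> s \<in> V (weight p - 1)"
    by (rule leading_monomial[OF r])
  have t: "\<iota> a * mon p \<noteq> 0" "v (\<iota> a * mon p) = - int (weight p)"
    using p mon_nonzero
    by (simp_all add: \<iota>_simps place_mult[OF v(1)] place_const[OF v(1)] place_at_infinity(6)[OF v])
  have s': "s \<in> val_ge v (- int (weight p) + 1)"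
  proof (cases "s = 0")
    case False
    with s have "weight p > 0" "s \<in> V (weight p - 1)" by auto
    then have "v s \<ge> - int (weight p - 1)"
      using place_at_infinity(5)[OF v, of s "weight p - 1"] False by (auto simp: range_ev)
    with \<open>weight p > 0\<close> show ?thesis by (simp add: val_ge_def of_nat_diff)
  qed simp
  then have "v r = - int (weight p)"
    unfolding p(3) using place_add_dominant(2)[OF v(1) t(1)] t(2) by metis
  with p s' show ?thesis by (intro that[of p a]) simp_all
qed

text \<open>
  Numerator and denominator of a unit have the same pole order, hence the same leading monomial,
  and the quotient of the leading coefficients is the residue.
\<close>

lemma residue_at_infinity:
  assumes v: "v \<in> places \<iota>" "v x < 0" and "z \<in> val_ge v 0"
  obtains c where "z - \<iota> c \<in> val_ge v 1"
proof (cases "z = 0 \<or> v z \<noteq> 0")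
  case True
  with assms(3) have "z - \<iota> 0 \<in> val_ge v 1" by (auto simp: val_ge_def \<iota>_simps)
  then show ?thesis by (rule that)
next
  case False
  obtain g h where gh: "ev h \<noteq> 0" "z = ev g / ev h" by (rule fraction)
  with False have g: "ev g \<noteq> 0" by auto
  have veq: "v (ev g) = v (ev h)" using False gh g by (simp add: place_divide[OF v(1)])
  obtain p a where p: "snd p < \<beta>" "a \<noteq> 0" "v (ev g) = - int (weight p)"
    "ev g - \<iota> a * mon p \<in> val_ge v (v (ev g) + 1)"
    using leading_at_infinity[OF v _ g] by blast
  obtain p' a' where p': "snd p' < \<beta>" "a' \<noteq> 0" "v (ev h) = - int (weight p')"
    "ev h - \<iota> a' * mon p' \<in> val_ge v (v (ev h) + 1)"
    using leading_at_infinity[OF v _ gh(1)] by blast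
  have "p' = p" using inj_onD[OF inj_on_weight, of p p'] p p' veq by simp
  let ?c = "a / a'"
  have "\<iota> ?c * \<iota> a' = \<iota> a" using p'(2) by (simp flip: unital_hom_mult[OF hom_\<iota>])
  then have "ev g - \<iota> ?c * ev h = (ev g - \<iota> a * mon p) - \<iota> ?c * (ev h - \<iota> a' * mon p')"
    by (simp add: \<open>p' = p\<close> algebra_simps)
  also have "\<dots> \<in> val_ge v (v (ev h) + 1)"
  proof (rule val_ge_diff[OF v(1)])
    show "ev g - \<iota> a * mon p \<in> val_ge v (v (ev h) + 1)" using p(4) by (simp add: veq)
    show "\<iota> ?c * (ev h - \<iota> a' * mon p') \<in> val_ge v (v (ev h) + 1)"
      using val_ge_mult[OF v(1) val_ge_const[OF v(1) hom_\<iota>] p'(4), of ?c] by simp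
  qed
  finally have "ev g - \<iota> ?c * ev h \<in> val_ge v (v (ev h) + 1)" .
  moreover have "z - \<iota> ?c = (ev g - \<iota> ?c * ev h) / ev h" using gh by (simp add: field_simps)
  ultimately have "z - \<iota> ?c \<in> val_ge v 1"
    using gh(1) place_divide[OF v(1), of "ev g - \<iota> ?c * ev h" "ev h"]
    by (cases "ev g - \<iota> ?c * ev h = 0") (simp_all add: val_ge_def)
  then show ?thesis by (rule that)
qed

lemma place_degree_infinity:
  assumes v: "v \<in> places \<iota>" "v x < 0"
  shows "place_degree \<iota> v > 0"
proof -
  interpret vector_space "const_scale \<iota>" by (rule vector_space_const_scale[OF hom_\<iota>])
  let ?P = "\<lambda>d. \<exists>B. finite B \<and> card B = d \<and> B \<subseteq> valuation_ring v \<and>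
     valuation_ring v \<subseteq> span (B \<union> valuation_ideal v)"
  have "valuation_ring v \<subseteq> span ({1} \<union> valuation_ideal v)"
  proof
    fix z assume "z \<in> valuation_ring v"
    then obtain c where c: "z - \<iota> c \<in> val_ge v 1"
      using residue_at_infinity[OF v] by (auto simp: valuation_ring_val_ge)
    have "\<iota> c * 1 + (z - \<iota> c) \<in> span ({1} \<union> valuation_ideal v)"
      using c by (intro span_add span_scale span_base) (auto simp: valuation_ideal_val_ge)
    then show "z \<in> span ({1} \<union> valuation_ideal v)" by simp
  qed
  then have "?P 1"
    by (intro exI[of _ "{1}"]) (auto simp: valuation_ring_def place_one[OF v(1)])
  then have "?P (place_degree \<iota> v)" unfolding place_degree_def by (rule LeastI)
  moreover have "\<not> ?P 0"
  proof
    assume "?P 0"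
    then have "valuation_ring v \<subseteq> span (valuation_ideal v)" by auto
    also have "\<dots> \<subseteq> valuation_ideal v"
      unfolding valuation_ideal_val_ge
      by (rule span_minimal) (simp_all add: subspace_val_ge[OF v(1) hom_\<iota>])
    finally have "valuation_ring v \<subseteq> valuation_ideal v" .
    moreover have "1 \<in> valuation_ring v" "1 \<notin> valuation_ideal v"
      using place_one[OF v(1)] by (simp_all add: valuation_ring_def valuation_ideal_def)
    ultimately show False by blast
  qed
  ultimately show ?thesis by (metis gr0I)
qed

text \<open>
  The divisor \<open>D = m P\<close> at the place \<open>P\<close> at infinity gives
  \<open>deg D - l(D) + 1 \<ge> m - dim V m + 1 = (\<alpha> - 1)(\<beta> - 1)/2\<close>.
\<close>

lemma genus_lower_bound:
  assumes "has_genus \<iota> g"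
  shows "(\<alpha> - 1) * (\<beta> - 1) \<le> 2 * g"
proof -
  interpret vector_space "const_scale \<iota>" by (rule vector_space_const_scale[OF hom_\<iota>])
  obtain v where v: "v \<in> places \<iota>" "v x < 0" by (rule infinite_place_exists)
  define m where "m = \<alpha> * (\<beta> - 1) + 1"
  define D where "D w = (if w = v then int m else 0)" for w
  have "m > 0" by (simp add: m_def)
  then have supp: "{w. D w \<noteq> 0} = {v}" by (auto simp: D_def)
  then have D: "D \<in> divisors \<iota>" using v(1) by (simp add: divisors_def)
  have deg: "divisor_degree \<iota> D \<ge> int m"
  proof -
    have "divisor_degree \<iota> D = int m * int (place_degree \<iota> v)"
      unfolding divisor_degree_def supp by (simp add: D_def)
    moreover have "int (place_degree \<iota> v) \<ge> 1" using place_degree_infinity[OF v] by simp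
    ultimately show ?thesis using mult_left_mono[of 1 "int (place_degree \<iota> v)" "int m"] by simp
  qed
  have "riemann_roch_space \<iota> D \<subseteq> V m"
  proof
    fix z assume z: "z \<in> riemann_roch_space \<iota> D"
    show "z \<in> V m"
    proof (cases "z = 0")
      case False
      with z have ge: "w z + D w \<ge> 0" if "w \<in> places \<iota>" for w
        using that by (auto simp: riemann_roch_space_def)
      have "z \<in> range ev"
      proof (rule regular_outside_infinity)
        fix w assume w: "w \<in> places \<iota>" "\<not> w x < 0"
        then have "D w = 0" using v(2) by (auto simp: D_def)
        with ge[OF w(1)] show "z \<in> val_ge w 0" by (simp add: val_ge_def)
      qed
      moreover have "v z \<ge> - int m" using ge[OF v(1)] by (simp add: D_def)
      ultimately show ?thesis using place_at_infinity(5)[OF v] False by simp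
    qed (simp add: V_0)
  qed
  also have "V m \<subseteq> span (mon ` reduced m)"
  proof
    fix u assume "u \<in> V m"
    then obtain c where "u = comb m c" by (auto simp: V_def)
    then show "u \<in> span (mon ` reduced m)"
      unfolding comb_def by (auto intro!: span_sum intro: span_scale span_base)
  qed
  finally have "riemann_roch_dim \<iota> D \<le> card (mon ` reduced m)"
    unfolding riemann_roch_dim_def by (rule dim_le_card) simp
  also have "\<dots> \<le> card (reduced m)" by (rule card_image_le) simp
  finally have dim: "riemann_roch_dim \<iota> D \<le> card (reduced m)" .
  have "divisor_degree \<iota> D - int (riemann_roch_dim \<iota> D) + 1 \<le> int g"
    using assms D by (simp add: has_genus_def)
  with deg dim have "m + 1 \<le> g + card (reduced m)" by linarith
  moreover have "2 * card (reduced m) + (\<alpha> - 1) * (\<beta> - 1) = 2 * (m + 1)"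
    by (rule card_reduced) (simp add: m_def)
  ultimately have "2 * card (reduced m) + (\<alpha> - 1) * (\<beta> - 1) \<le> 2 * card (reduced m) + 2 * g"
    by simp
  then show ?thesis by (rule add_le_imp_le_left)
qed

text \<open>
  Finite sets of representatives of distinct residue classes at \<open>v\<close>.
\<close>

definition residue_distinct :: "('f \<Rightarrow> int) \<Rightarrow> 'f set \<Rightarrow> bool" where
  "residue_distinct v E \<longleftrightarrow> finite E \<and> E \<subseteq> val_ge v 0 \<and>
     (\<forall>e\<in>E. \<forall>e'\<in>E. e \<noteq> e' \<longrightarrow> e - e' \<notin> val_ge v 1)"

lemma common_denominator:
  assumes "finite E"
  obtains H s where "H \<noteq> 0" "\<And>e. e \<in> E \<Longrightarrow> H * e \<in> V s"
proof -
  have "\<exists>H s. H \<noteq> 0 \<and> H \<in> range ev \<and> (\<forall>e\<in>E. H * e \<in> V s)"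
    using assms
  proof (induction E)
    case empty
    show ?case using const_in_range[of 1] by (intro exI[of _ 1]) (simp add: \<iota>_simps)
  next
    case (insert z E)
    then obtain H s where H: "H \<noteq> 0" "H \<in> range ev" "\<forall>e\<in>E. H * e \<in> V s" by blast
    obtain g h where gh: "ev h \<noteq> 0" "z = ev g / ev h" by (rule fraction)
    from H(2) obtain s1 where s1: "H \<in> V s1" by (auto simp: range_ev)
    obtain s2 where s2: "ev g \<in> V s2" using range_ev by blast
    obtain s3 where s3: "ev h \<in> V s3" using range_ev by blast
    define s' where "s' = max (s1 + s2) (s3 + s)"
    have "ev h * H * z \<in> V s'"
    proof -
      have "ev h * H * z = H * ev g" using gh by simp
      also have "\<dots> \<in> V (s1 + s2)" by (rule V_mult[OF s1 s2])
      also have "\<dots> \<subseteq> V s'" by (rule V_mono) (simp add: s'_def)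
      finally show ?thesis .
    qed
    moreover have "ev h * H * e \<in> V s'" if "e \<in> E" for e
    proof -
      have "ev h * (H * e) \<in> V (s3 + s)" using that H(3) by (intro V_mult s3) auto
      also have "\<dots> \<subseteq> V s'" by (rule V_mono) (simp add: s'_def)
      finally show ?thesis by (simp add: mult.assoc)
    qed
    ultimately have "ev h * H \<noteq> 0 \<and> ev h * H \<in> range ev \<and> (\<forall>e\<in>insert z E. ev h * H * e \<in> V s')"
      using gh(1) H(1,2) by (auto intro: range_ev_closed)
    then show ?case by blast
  qed
  then show ?thesis using that by blast
qed

text \<open>
  Distinct representatives give distinct polynomial expressions
  \<open>\<Sum> c\<^sub>i t\<^sup>i\<close> with \<open>i < M\<close> and \<open>c\<^sub>i \<in> E\<close>. After multiplication by a common denominator they all lie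
  in \<open>V (s + M w)\<close> for a fixed \<open>s\<close>, so \<open>|E|\<^sup>M\<close> is at most a constant times \<open>|k|\<^bsup>w M\<^esup>\<close> for
  every \<open>M\<close>.
\<close>

lemma card_residue_distinct_le:
  assumes v: "v \<in> places \<iota>" and t: "t \<in> V w" "t \<noteq> 0" "v t > 0" and E: "residue_distinct v E"
  shows "card E \<le> CARD('k) ^ w"
proof (rule ccontr)
  assume "\<not> card E \<le> CARD('k) ^ w"
  then have big: "real (card E) / real (CARD('k) ^ w) > 1"
    using card_k_gt_1 by (simp add: field_simps)
  have fin: "finite E" using E by (simp add: residue_distinct_def)
  obtain H s where H: "H \<noteq> 0" "\<And>e. e \<in> E \<Longrightarrow> H * e \<in> V s"
    using common_denominator[OF fin] by blast
  have count: "card E ^ M \<le> CARD('k) ^ (s + M * w + 1)" for M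
  proof -
    define F where "F c = (\<Sum>i<M. H * c i * t ^ i)" for c :: "nat \<Rightarrow> 'f"
    have "inj_on F ({..<M} \<rightarrow>\<^sub>E E)"
    proof (rule inj_onI)
      fix c d assume cd: "c \<in> {..<M} \<rightarrow>\<^sub>E E" "d \<in> {..<M} \<rightarrow>\<^sub>E E" "F c = F d"
      have sum0: "(\<Sum>i<M. (c i - d i) * t ^ i) = 0"
      proof -
        have "H * (\<Sum>i<M. (c i - d i) * t ^ i) = F c - F d"
          by (simp add: F_def sum_distrib_left algebra_simps sum_subtractf)
        with cd(3) H(1) show ?thesis by simp
      qed
      show "c = d"
      proof (rule ccontr)
        assume "c \<noteq> d"
        then have "\<exists>i. i < M \<and> c i \<noteq> d i" using cd(1,2) by (metis PiE_ext lessThan_iff)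
        then obtain i where i: "i < M" "c i \<noteq> d i" "\<And>j. j < i \<Longrightarrow> \<not> (j < M \<and> c j \<noteq> d j)"
          using exists_least_iff[of "\<lambda>i. i < M \<and> c i \<noteq> d i"] by blast
        have mem: "c j \<in> E" "d j \<in> E" if "j < M" for j using cd(1,2) that by auto
        have E0: "c j - d j \<in> val_ge v 0" if "j < M" for j
          using E mem[OF that] by (intro val_ge_diff[OF v]) (auto simp: residue_distinct_def)
        have unit: "v (c i - d i) = 0"
          using E0[OF i(1)] E mem[OF i(1)] i(2) by (fastforce simp: residue_distinct_def val_ge_def)
        have lead: "(c i - d i) * t ^ i \<noteq> 0" "v ((c i - d i) * t ^ i) = int i * v t"
          using i(2) t(2) unit by (simp_all add: place_mult[OF v] place_power[OF v])
        have "(c j - d j) * t ^ j \<in> val_ge v (int i * v t + 1)" if "j \<in> {..<M} - {i}" for j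
        proof (cases "j < i")
          case True
          with i(3) that have "c j = d j" by auto
          then show ?thesis by simp
        next
          case False
          with that have "j > i" by auto
          then have "int j * v t \<ge> (int i + 1) * v t" using t(3) by (intro mult_right_mono) auto
          then have "int i * v t + 1 \<le> int j * v t" using t(3) by (simp add: algebra_simps)
          moreover have "t ^ j \<in> val_ge v (int j * v t)"
            using t(2) by (simp add: val_ge_def place_power[OF v])
          then have "(c j - d j) * t ^ j \<in> val_ge v (0 + int j * v t)"
            using E0[of j] that by (intro val_ge_mult[OF v]) auto
          ultimately show ?thesis by (auto intro: val_ge_mono)
        qed
        then have "(\<Sum>j\<in>{..<M} - {i}. (c j - d j) * t ^ j) \<in> val_ge v (v ((c i - d i) * t ^ i) + 1)"
          unfolding lead by (rule val_ge_sum[OF v])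
        from place_add_dominant(1)[OF v lead(1) this]
        show False using sum0 i(1) by (simp add: sum.remove[of "{..<M}" i])
      qed
    qed
    moreover have "F ` ({..<M} \<rightarrow>\<^sub>E E) \<subseteq> V (s + M * w)"
    proof (clarsimp simp: F_def)
      fix c assume c: "c \<in> {..<M} \<rightarrow>\<^sub>E E"
      have tp: "t ^ i \<in> V (i * w)" for i
      proof (induction i)
        case 0
        then show ?case using const_in_V[of 1] by (simp add: \<iota>_simps)
      next
        case (Suc i)
        then show ?case using V_mult[OF t(1)] by simp
      qed
      have "H * c i * t ^ i \<in> V (s + M * w)" if "i < M" for i
      proof -
        have "H * c i * t ^ i \<in> V (s + i * w)" using c that by (intro V_mult tp H(2)) auto
        moreover have "V (s + i * w) \<subseteq> V (s + M * w)" using that by (intro V_mono) simp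
        ultimately show ?thesis by blast
      qed
      then show "(\<Sum>i<M. H * c i * t ^ i) \<in> V (s + M * w)" by (intro V_sum) auto
    qed
    ultimately have "card ({..<M} \<rightarrow>\<^sub>E E) \<le> card (V (s + M * w))"
      using finite_V by (intro card_inj_on_le)
    also have "\<dots> \<le> CARD('k) ^ (s + M * w + 1)"
      unfolding card_V using card_k_gt_1 card_reduced_le[of "s + M * w"] by (intro power_increasing) auto
    finally show ?thesis by (simp add: card_funcsetE)
  qed
  obtain M where M: "real (CARD('k) ^ (s + 1)) < (real (card E) / real (CARD('k) ^ w)) ^ M"
    using real_arch_pow[OF big] by blast
  have pos: "real (CARD('k) ^ w) ^ M > 0" using card_k_gt_1 by simp
  have "real (CARD('k) ^ (s + 1)) * real (CARD('k) ^ w) ^ M < real (card E) ^ M"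
    using M pos by (simp add: power_divide pos_less_divide_eq)
  also have "\<dots> \<le> real (CARD('k) ^ (s + M * w + 1))" using count[of M] by (metis of_nat_le_iff of_nat_power)
  also have "\<dots> = real (CARD('k) ^ (s + 1)) * real (CARD('k) ^ w) ^ M"
    by (simp add: power_add power_mult mult.commute[of M w])
  finally show False by simp
qed

lemma ev_val_ge:
  assumes v: "v \<in> places \<iota>" and "x \<in> val_ge v 0" and "y \<in> val_ge v 0"
  shows "ev g \<in> val_ge v 0"
  unfolding eval_bivariate_poly_at
  using val_ge_mult[OF v, of _ 0 _ 0] assms
  by (intro poly_at_closed[OF hom_x]) (auto intro: val_ge_add[OF v] poly_at_val_ge[OF v hom_\<iota>])

text \<open>
  The least number in the definition of the degree is meaningful only if some finite set
  generates the residue field. It exists because the residue field is finite.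
\<close>

lemma place_degree_attained:
  assumes v: "v \<in> places \<iota>" and "x \<in> val_ge v 0" and "y \<in> val_ge v 0"
  shows "\<exists>B. finite B \<and> card B = place_degree \<iota> v \<and> B \<subseteq> valuation_ring v \<and>
     valuation_ring v \<subseteq> module.span (const_scale \<iota>) (B \<union> valuation_ideal v)"
proof -
  interpret vector_space "const_scale \<iota>" by (rule vector_space_const_scale[OF hom_\<iota>])
  note ev_ge = ev_val_ge[OF assms]
  \<comment> \<open>the denominator of a function with a pole at \<open>v\<close> lies in the maximal ideal\<close>
  obtain z where z: "z \<noteq> 0" "v z = - 1" using place_surj[OF v, of "- 1"] .
  obtain g h where gh: "ev h \<noteq> 0" "z = ev g / ev h" by (rule fraction)
  with z have "ev g \<noteq> 0" by auto
  with gh z ev_ge[of g] have "v (ev h) > 0" by (simp add: place_divide[OF v] val_ge_def)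
  obtain w where w: "ev h \<in> V w" using range_ev by blast
  have "residue_distinct v {}" by (simp add: residue_distinct_def)
  then obtain E where E: "residue_distinct v E" "\<And>E'. residue_distinct v E' \<Longrightarrow> card E' \<le> card E"
    using ex_has_greatest_nat[of "residue_distinct v" "{}" card "CARD('k) ^ w + 1"]
      card_residue_distinct_le[OF v w gh(1) \<open>v (ev h) > 0\<close>]
    by (metis le_imp_less_Suc Suc_eq_plus1)
  have fin: "finite E" using E(1) by (simp add: residue_distinct_def)
  have rep: "\<exists>e\<in>E. u - e \<in> val_ge v 1" if u: "u \<in> val_ge v 0" for u
  proof (rule ccontr)
    assume neg: "\<not> (\<exists>e\<in>E. u - e \<in> val_ge v 1)"
    then have "u \<notin> E" by (metis diff_self val_ge_0)
    have "e - u \<notin> val_ge v 1" if "e \<in> E" for e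
      using neg that val_ge_uminus[OF v, of "e - u" 1] by auto
    with neg E(1) u have "residue_distinct v (insert u E)" by (auto simp: residue_distinct_def)
    from E(2)[OF this] show False using fin \<open>u \<notin> E\<close> by simp
  qed
  have "valuation_ring v \<subseteq> span (E \<union> valuation_ideal v)"
  proof
    fix u assume "u \<in> valuation_ring v"
    then obtain e where e: "e \<in> E" "u - e \<in> val_ge v 1" using rep by (auto simp: valuation_ring_val_ge)
    have "e + (u - e) \<in> span (E \<union> valuation_ideal v)"
      using e by (intro span_add span_base) (auto simp: valuation_ideal_val_ge)
    then show "u \<in> span (E \<union> valuation_ideal v)" by simp
  qed
  moreover have "E \<subseteq> valuation_ring v"
    using E(1) by (simp add: residue_distinct_def valuation_ring_val_ge)
  ultimately have "\<exists>d B. finite B \<and> card B = d \<and> B \<subseteq> valuation_ring v \<and>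
     valuation_ring v \<subseteq> span (B \<union> valuation_ideal v)"
    using fin by blast
  then show ?thesis unfolding place_degree_def by (rule LeastI_ex)
qed

definition centered_at :: "('f \<Rightarrow> int) \<Rightarrow> 'k \<times> 'k \<Rightarrow> bool" where
  "centered_at v P \<longleftrightarrow> x - \<iota> (fst P) \<in> val_ge v 1 \<and> y - \<iota> (snd P) \<in> val_ge v 1"

text \<open>
  At a place of degree one where \<open>x\<close> is regular, \<open>x\<close> and \<open>y\<close> have residues in \<open>k\<close>, and these
  satisfy the equation of the curve.
\<close>

lemma rational_place_centered:
  assumes v: "v \<in> rational_places \<iota>" and fin: "\<not> v x < 0"
  obtains P where "P \<in> affine_points" "centered_at v P"
proof -
  interpret vector_space "const_scale \<iota>" by (rule vector_space_const_scale[OF hom_\<iota>])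
  have vp: "v \<in> places \<iota>" and deg: "place_degree \<iota> v = 1" using v by (auto simp: rational_places_def)
  have x0: "x \<in> val_ge v 0" using fin by (simp add: val_ge_def)
  have y0: "y \<in> val_ge v 0"
  proof (rule ccontr)
    assume "y \<notin> val_ge v 0"
    then have "y \<noteq> 0" "v y < 0" by (auto simp: val_ge_def)
    then have "y ^ \<beta> \<noteq> 0" "v (y ^ \<beta>) < 0" using \<beta>_pos by (simp_all add: place_power[OF vp] mult_less_0_iff)
    moreover have "y ^ \<beta> \<in> val_ge v 0"
      unfolding curve_eq by (rule poly_at_val_ge[OF vp hom_\<iota> x0])
    ultimately show False by (simp add: val_ge_def)
  qed
  obtain B where B: "card B = 1" "valuation_ring v \<subseteq> span (B \<union> valuation_ideal v)"
    using place_degree_attained[OF vp x0 y0] deg by auto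
  from B(1) obtain e where e: "B = {e}" by (rule card_1_singletonE)
  let ?S = "{z. \<exists>s. z - \<iota> s * e \<in> val_ge v 1}"
  have "subspace ?S"
  proof (rule subspaceI)
    show "0 \<in> ?S" by (auto simp: \<iota>_simps intro!: exI[of _ 0])
  next
    fix a b assume "a \<in> ?S" "b \<in> ?S"
    then obtain s s' where "a - \<iota> s * e \<in> val_ge v 1" "b - \<iota> s' * e \<in> val_ge v 1" by auto
    then have "a - \<iota> s * e + (b - \<iota> s' * e) \<in> val_ge v 1" by (rule val_ge_add[OF vp])
    then have "a + b - \<iota> (s + s') * e \<in> val_ge v 1" by (simp add: \<iota>_simps algebra_simps)
    then show "a + b \<in> ?S" by blast
  next
    fix c a assume "a \<in> ?S"
    then obtain s where "a - \<iota> s * e \<in> val_ge v 1" by auto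
    from val_ge_mult[OF vp val_ge_const[OF vp hom_\<iota>] this, of c]
    have "\<iota> c * a - \<iota> (c * s) * e \<in> val_ge v 1" by (simp add: \<iota>_simps algebra_simps)
    then show "\<iota> c * a \<in> ?S" by blast
  qed
  moreover have "B \<union> valuation_ideal v \<subseteq> ?S"
    by (auto simp: e valuation_ideal_val_ge intro: exI[of _ 1] exI[of _ 0] simp: \<iota>_simps)
  ultimately have "span (B \<union> valuation_ideal v) \<subseteq> ?S" by (rule span_minimal[rotated])
  with B(2) have S: "z \<in> ?S" if "z \<in> val_ge v 0" for z using that by (auto simp: valuation_ring_val_ge)
  have one: "1 \<in> val_ge v 0" "1 \<notin> val_ge v 1" by (simp_all add: val_ge_def place_one[OF vp])
  obtain s0 where s0: "1 - \<iota> s0 * e \<in> val_ge v 1" using S[OF one(1)] by auto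
  have "s0 \<noteq> 0" using s0 one(2) by (auto simp: \<iota>_simps)
  have residue: "\<exists>c. z - \<iota> c \<in> val_ge v 1" if "z \<in> val_ge v 0" for z
  proof -
    obtain s where s: "z - \<iota> s * e \<in> val_ge v 1" using S[OF \<open>z \<in> val_ge v 0\<close>] by auto
    have "\<iota> (s / s0) * \<iota> s0 = \<iota> s" using \<open>s0 \<noteq> 0\<close> by (simp flip: unital_hom_mult[OF hom_\<iota>])
    then have "z - \<iota> (s / s0) = (z - \<iota> s * e) - \<iota> (s / s0) * (1 - \<iota> s0 * e)"
      by (simp add: algebra_simps)
    also have "\<dots> \<in> val_ge v 1"
      using val_ge_mult[OF vp val_ge_const[OF vp hom_\<iota>] s0, of "s / s0"]
      by (intro val_ge_diff[OF vp s]) simp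
    finally show ?thesis by blast
  qed
  obtain a b where a: "x - \<iota> a \<in> val_ge v 1" and b: "y - \<iota> b \<in> val_ge v 1"
    using residue[OF x0] residue[OF y0] by blast
  have "y ^ \<beta> - \<iota> (b ^ \<beta>) \<in> val_ge v 1"
    using poly_at_congruent[OF vp hom_\<iota> y0 b, of "Polynomial.monom 1 \<beta>"]
    by (simp add: poly_at_monom hom_\<iota> \<iota>_simps poly_monom)
  moreover have "y ^ \<beta> - \<iota> (poly A a) \<in> val_ge v 1"
    unfolding curve_eq by (rule poly_at_congruent[OF vp hom_\<iota> x0 a])
  ultimately have "(y ^ \<beta> - \<iota> (poly A a)) - (y ^ \<beta> - \<iota> (b ^ \<beta>)) \<in> val_ge v 1"
    by (rule val_ge_diff[OF vp, rotated])
  then have "\<iota> (b ^ \<beta> - poly A a) \<in> val_ge v 1" by (simp add: \<iota>_simps)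
  then have "b ^ \<beta> = poly A a"
    using place_const[OF vp, of "b ^ \<beta> - poly A a"]
    by (cases "b ^ \<beta> - poly A a = 0") (auto simp: val_ge_def unital_hom_eq_0_iff[OF hom_\<iota>])
  then show ?thesis using a b by (intro that[of "(a, b)"]) (simp_all add: affine_points_def centered_at_def)
qed

lemma ev_expand_at:
  obtains g1 g2 where "ev g = \<iota> (value_at (a, b) g) + (x - \<iota> a) * ev g1 + (y - \<iota> b) * ev g2"
proof -
  obtain g2 where g2: "g = [:poly g [:b:]:] + [:- [:b:], 1:] * g2" by (rule poly_expand_at)
  define c where "c = poly g [:b:]"
  obtain c1 where c1: "c = [:poly c a:] + [:- a, 1:] * c1" by (rule poly_expand_at)
  have ev_y: "ev [:- [:b:], 1:] = y - \<iota> b"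
    by (simp add: eval_bivariate_poly_at poly_at_pCons hom_x hom_\<iota> unital_hom_simps[OF hom_x] \<iota>_simps del: minus_pCons)
  have "ev g = poly_at \<iota> x c + (y - \<iota> b) * ev g2"
    by (subst g2) (simp add: unital_hom_add[OF hom_ev] unital_hom_mult[OF hom_ev] ev_const ev_y c_def
        del: mult_pCons_left mult_pCons_right minus_pCons)
  moreover have "poly_at \<iota> x c = \<iota> (poly c a) + (x - \<iota> a) * ev [:c1:]"
    by (subst c1) (simp add: poly_at_add poly_at_mult poly_at_pCons hom_\<iota> \<iota>_simps ev_const
        del: mult_pCons_left mult_pCons_right)
  ultimately show ?thesis by (intro that[of "[:c1:]" g2]) (simp add: value_at_def c_def)
qed

text \<open>
  At an affine point \<open>y - b\<close> is a uniformizer: the equation of the curve reads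
  \<open>(x - a) u(x) = (y - b) h(y)\<close>, where \<open>u(a) = A'(a) \<noteq> 0\<close>, so up to units every function
  vanishing at \<open>(a, b)\<close> is a multiple of \<open>y - b\<close>.
\<close>

lemma local_uniformizer:
  assumes P: "(a, b) \<in> affine_points" and "value_at (a, b) g = 0"
  obtains s g' where "value_at (a, b) s \<noteq> 0" "ev s * ev g = (y - \<iota> b) * ev g'"
proof -
  obtain u where u: "A = [:poly A a:] + [:- a, 1:] * u" "poly u a = poly (pderiv A) a"
    by (rule poly_expand_at)
  obtain h where h: "Polynomial.monom 1 \<beta> = [:poly (Polynomial.monom 1 \<beta>) b:] + [:- b, 1:] * h"
    by (rule poly_expand_at)
  have "poly_at \<iota> x A = \<iota> (poly A a) + (x - \<iota> a) * poly_at \<iota> x u"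
    by (subst u(1)) (simp add: poly_at_add poly_at_mult poly_at_pCons hom_\<iota> \<iota>_simps
        del: mult_pCons_left mult_pCons_right)
  moreover have "y ^ \<beta> = \<iota> (b ^ \<beta>) + (y - \<iota> b) * poly_at \<iota> y h"
  proof -
    have "y ^ \<beta> = poly_at \<iota> y (Polynomial.monom 1 \<beta>)" by (simp add: poly_at_monom hom_\<iota> \<iota>_simps)
    also have "\<dots> = \<iota> (b ^ \<beta>) + (y - \<iota> b) * poly_at \<iota> y h"
      by (subst h) (simp add: poly_at_add poly_at_mult poly_at_pCons hom_\<iota> \<iota>_simps poly_monom
          del: mult_pCons_left mult_pCons_right)
    finally show ?thesis .
  qed
  moreover have "b ^ \<beta> = poly A a" using P by (simp add: affine_points_def)
  ultimately have tangent: "(x - \<iota> a) * ev [:u:] = (y - \<iota> b) * poly_at \<iota> y h"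
    using curve_eq by (simp add: ev_const)
  obtain g1 g2 where g: "ev g = \<iota> (value_at (a, b) g) + (x - \<iota> a) * ev g1 + (y - \<iota> b) * ev g2"
    by (rule ev_expand_at)
  have "ev [:u:] * ev g = (x - \<iota> a) * ev [:u:] * ev g1 + (y - \<iota> b) * (ev [:u:] * ev g2)"
    unfolding g using assms(2) by (simp add: \<iota>_simps algebra_simps)
  also have "\<dots> = (y - \<iota> b) * (poly_at \<iota> y h * ev g1 + ev [:u:] * ev g2)"
    unfolding tangent by (simp add: algebra_simps)
  finally have eq: "ev [:u:] * ev g = (y - \<iota> b) * (poly_at \<iota> y h * ev g1 + ev [:u:] * ev g2)" .
  have "poly_at \<iota> y h * ev g1 + ev [:u:] * ev g2 \<in> range ev"
    by (intro range_ev_closed y_poly_in_range) auto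
  then obtain g' where "poly_at \<iota> y h * ev g1 + ev [:u:] * ev g2 = ev g'" by auto
  moreover have "value_at (a, b) [:u:] \<noteq> 0"
    using u(2) coeff_1_nonzero by (simp add: value_at_def pderiv_A)
  ultimately show ?thesis using eq that by metis
qed

lemma centered_val_ge:
  assumes v: "v \<in> places \<iota>" and c: "centered_at v P"
  shows "ev g \<in> val_ge v 0"
proof (rule ev_val_ge[OF v])
  have ge: "\<iota> a + r \<in> val_ge v 0" if "r \<in> val_ge v 1" for a r
    using that by (intro val_ge_add[OF v] val_ge_const[OF v hom_\<iota>]) (rule val_ge_mono[of 0 1], auto)
  show "x \<in> val_ge v 0" "y \<in> val_ge v 0"
    using ge[of "x - \<iota> (fst P)" "fst P"] ge[of "y - \<iota> (snd P)" "snd P"] c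
    by (simp_all add: centered_at_def)
qed

lemma centered_unit:
  assumes v: "v \<in> places \<iota>" and c: "centered_at v P" and "value_at P g \<noteq> 0"
  shows "ev g \<noteq> 0" and "v (ev g) = 0"
proof -
  note ev_ge = centered_val_ge[OF v c]
  obtain g1 g2 where g: "ev g = \<iota> (value_at P g) + (x - \<iota> (fst P)) * ev g1 + (y - \<iota> (snd P)) * ev g2"
    using ev_expand_at[of g "fst P" "snd P"] by auto
  have "(x - \<iota> (fst P)) * ev g1 + (y - \<iota> (snd P)) * ev g2 \<in> val_ge v (v (\<iota> (value_at P g)) + 1)"
    using c val_ge_mult[OF v _ ev_ge, of _ 1] assms(3)
    by (auto simp: centered_at_def place_const[OF v] intro!: val_ge_add[OF v])
  moreover have "\<iota> (value_at P g) \<noteq> 0" using assms(3) by (simp add: \<iota>_simps)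
  ultimately show "ev g \<noteq> 0" "v (ev g) = 0"
    using place_add_dominant[OF v] assms(3) unfolding g by (simp_all add: add.assoc place_const[OF v])
qed

text \<open>
  Each step of dividing by \<open>y - b\<close> lowers the value at \<open>v\<close>, so it ends. The resulting
  exponent does not depend on \<open>v\<close>, only on the centre.
\<close>

lemma centered_factorization:
  assumes v: "v \<in> places \<iota>" and c: "centered_at v (a, b)" and P: "(a, b) \<in> affine_points"
    and "ev g \<noteq> 0"
  shows "\<exists>n s g'. value_at (a, b) s \<noteq> 0 \<and> value_at (a, b) g' \<noteq> 0 \<and>
    ev s * ev g = (y - \<iota> b) ^ n * ev g'"
  using assms(4)
proof (induction "nat (v (ev g))" arbitrary: g rule: less_induct)
  case (less g)
  show ?case
  proof (cases "value_at (a, b) g = 0")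
    case False
    then show ?thesis
      by (intro exI[of _ 0] exI[of _ 1] exI[of _ g])
         (simp add: ev_simps unital_hom_one[OF hom_value_at])
  next
    case True
    obtain s g1 where s: "value_at (a, b) s \<noteq> 0" "ev s * ev g = (y - \<iota> b) * ev g1"
      by (rule local_uniformizer[OF P True])
    note su = centered_unit[OF v c s(1)]
    have nz: "y - \<iota> b \<noteq> 0" "ev g1 \<noteq> 0" using s(2) su(1) less.prems by auto
    have "v (ev s * ev g) = v ((y - \<iota> b) * ev g1)" using s(2) by simp
    then have "v (ev g) = v (y - \<iota> b) + v (ev g1)"
      using nz su less.prems by (simp add: place_mult[OF v])
    moreover have "v (y - \<iota> b) \<ge> 1" using c nz(1) by (simp add: centered_at_def val_ge_def)
    moreover have "v (ev g1) \<ge> 0" using centered_val_ge[OF v c, of g1] nz(2) by (simp add: val_ge_def)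
    ultimately have "nat (v (ev g1)) < nat (v (ev g))" by simp
    from less.hyps[OF this nz(2)] obtain n s' g' where
      "value_at (a, b) s' \<noteq> 0" "value_at (a, b) g' \<noteq> 0" "ev s' * ev g1 = (y - \<iota> b) ^ n * ev g'" by blast
    note IH = this
    have "ev (s' * s) * ev g = ev s' * (ev s * ev g)" by (simp add: ev_simps)
    also have "\<dots> = (y - \<iota> b) * (ev s' * ev g1)" by (simp add: s(2))
    also have "\<dots> = (y - \<iota> b) ^ Suc n * ev g'" by (simp add: IH(3))
    finally show ?thesis using s(1) IH(1,2)
      by (intro exI[of _ "Suc n"] exI[of _ "s' * s"] exI[of _ g']) (simp add: unital_hom_mult[OF hom_value_at])
  qed
qed

lemma centered_unique:
  assumes v: "v \<in> places \<iota>" "centered_at v (a, b)" and w: "w \<in> places \<iota>" "centered_at w (a, b)"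
    and P: "(a, b) \<in> affine_points"
  shows "v = w"
proof -
  have "poly_at \<iota> y [:- b, 1:] = y - \<iota> b"
    by (simp add: poly_at_pCons hom_\<iota> \<iota>_simps)
  then have nz: "y - \<iota> b \<noteq> 0" using y_poly_nonzero[of "[:- b, 1:]"] by auto
  have val: "u (ev g) = int n * u (y - \<iota> b)"
    if u: "u \<in> places \<iota>" "centered_at u (a, b)" and "ev g \<noteq> 0" and "value_at (a, b) s \<noteq> 0" "value_at (a, b) g' \<noteq> 0"
      "ev s * ev g = (y - \<iota> b) ^ n * ev g'" for u g s g' n
  proof -
    note units = centered_unit[OF u \<open>value_at (a, b) s \<noteq> 0\<close>] centered_unit[OF u \<open>value_at (a, b) g' \<noteq> 0\<close>]
    have "u (ev s * ev g) = u ((y - \<iota> b) ^ n * ev g')" using that(6) by simp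
    then show ?thesis
      using units \<open>ev g \<noteq> 0\<close> nz by (simp add: place_mult[OF u(1)] place_power[OF u(1)])
  qed
  \<comment> \<open>\<open>y - \<iota> b\<close> is a uniformizer, as all values are multiples of its value\<close>
  have one: "u (y - \<iota> b) = 1" if u: "u \<in> places \<iota>" "centered_at u (a, b)" for u
  proof -
    have dvd: "u (y - \<iota> b) dvd u (ev g)" if nz_g: "ev g \<noteq> 0" for g
    proof -
      obtain n s g' where "value_at (a, b) s \<noteq> 0" "value_at (a, b) g' \<noteq> 0" "ev s * ev g = (y - \<iota> b) ^ n * ev g'"
        using centered_factorization[OF u(1) u(2) P nz_g] by blast
      from val[OF u nz_g this] show ?thesis by simp
    qed
    obtain z where z: "z \<noteq> 0" "u z = 1" using place_surj[OF u(1), of 1] .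
    obtain g h where gh: "ev h \<noteq> 0" "z = ev g / ev h" by (rule fraction)
    with z have "ev g \<noteq> 0" by auto
    with gh z have "1 = u (ev g) - u (ev h)" by (simp add: place_divide[OF u(1)])
    then have "u (y - \<iota> b) dvd 1" using dvd[OF gh(1)] dvd[OF \<open>ev g \<noteq> 0\<close>] by (metis dvd_diff)
    moreover have "u (y - \<iota> b) \<ge> 1" using u(2) nz by (simp add: centered_at_def val_ge_def)
    ultimately show ?thesis by (simp add: zdvd1_eq)
  qed
  show ?thesis
  proof (rule place_eqI[OF v(1) w(1)])
    fix r assume "r \<in> range ev" "r \<noteq> 0"
    then obtain g where g: "r = ev g" "ev g \<noteq> 0" by auto
    obtain n s g' where f: "value_at (a, b) s \<noteq> 0" "value_at (a, b) g' \<noteq> 0" "ev s * ev g = (y - \<iota> b) ^ n * ev g'"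
      using centered_factorization[OF v(1) v(2) P g(2)] by blast
    show "v r = w r"
      using val[OF v g(2) f] val[OF w g(2) f] one[OF v] one[OF w] by (simp add: g(1))
  qed
qed

lemma card_rational_places_le: "card (rational_places \<iota>) \<le> card affine_points + 1"
proof -
  define c where "c v = (SOME P. P \<in> affine_points \<and> centered_at v P)" for v
  have c: "c v \<in> affine_points \<and> centered_at v (c v)" if "v \<in> rational_places \<iota>" "\<not> v x < 0" for v
    unfolding c_def
  proof (rule someI_ex)
    obtain P where "P \<in> affine_points" "centered_at v P" by (rule rational_place_centered[OF \<open>v \<in> _\<close> \<open>\<not> _\<close>])
    then show "\<exists>P. P \<in> affine_points \<and> centered_at v P" by blast
  qed
  define f where "f v = (if v x < 0 then None else Some (c v))" for v
  have places: "v \<in> places \<iota>" if "v \<in> rational_places \<iota>" for v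
    using that by (simp add: rational_places_def)
  have "inj_on f (rational_places \<iota>)"
  proof (rule inj_onI)
    fix v w assume v: "v \<in> rational_places \<iota>" and w: "w \<in> rational_places \<iota>" and eq: "f v = f w"
    show "v = w"
    proof (cases "v x < 0")
      case True
      with eq have "w x < 0" by (simp add: f_def split: if_splits)
      then show ?thesis by (rule place_at_infinity_unique[OF places[OF v] True places[OF w]])
    next
      case False
      with eq have "\<not> w x < 0" "c v = c w" by (simp_all add: f_def split: if_splits)
      with False show ?thesis using c[OF v] c[OF w] places[OF v] places[OF w]
        by (intro centered_unique[of v "fst (c v)" "snd (c v)" w]) auto
    qed
  qed
  moreover have "f ` rational_places \<iota> \<subseteq> insert None (Some ` affine_points)"
    using c by (auto simp: f_def)
  ultimately have "card (rational_places \<iota>) \<le> card (insert None (Some ` affine_points))"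
    by (intro card_inj_on_le) auto
  also have "\<dots> = card affine_points + 1" by (simp add: card_image)
  finally show ?thesis .
qed

text \<open>
  The upper bound for the number of affine points from the operator norm and the lower bound from
  maximality can agree only if \<open>A\<close> and \<open>z\<^sup>\<beta> - 1\<close> have all their roots in \<open>k\<close>.
\<close>

theorem maximal_curve_structure:
  assumes max: "maximal_curve \<iota> q" and q: "CARD('k) = q\<^sup>2" "q > 0"
    and big: "\<alpha> \<ge> 2" "\<beta> \<ge> 2"
  shows "card {w. poly A w = 0} = \<alpha>" and "card {z::'k. z ^ \<beta> = 1} = \<beta>"
    and "card affine_points = q\<^sup>2 + (\<alpha> - 1) * (\<beta> - 1) * q"
proof -
  obtain g where g: "has_genus \<iota> g" "card (rational_places \<iota>) = q\<^sup>2 + 1 + 2 * g * q"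
    using max by (auto simp: maximal_curve_def)
  let ?w = "card {w. poly A w = 0}" and ?\<kappa> = "card {z::'k. z ^ \<beta> = 1}"
  have "(\<alpha> - 1) * (\<beta> - 1) * q \<le> 2 * g * q"
    using genus_lower_bound[OF g(1)] by (rule mult_le_mono1)
  then have lower: "q\<^sup>2 + (\<alpha> - 1) * (\<beta> - 1) * q \<le> card affine_points"
    using card_rational_places_le g(2) by linarith
  have w: "?w \<le> \<alpha>" using big(1) by (intro card_poly_roots_bound) auto
  have \<kappa>: "?\<kappa> \<le> \<beta>"
  proof -
    let ?p = "Polynomial.monom 1 \<beta> - 1 :: 'k poly"
    have deg: "degree ?p = \<beta>"
      using degree_add_eq_left[of "- 1 :: 'k poly" "Polynomial.monom 1 \<beta>"] big(2)
      by (simp add: degree_monom_eq)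
    then have "?p \<noteq> 0" using big(2) by (metis degree_0 not_numeral_le_zero)
    from card_poly_roots_bound[OF this] show ?thesis by (simp add: deg poly_monom)
  qed
  have w1: "?w \<ge> 1"
  proof -
    have "0 \<in> {w. poly A w = 0}" using additive_poly_add[OF additive, of 0 0] by (simp only: mem_Collect_eq add_0_left) (metis add_cancel_right_right)
    then show ?thesis by (metis One_nat_def Suc_leI card_gt_0_iff empty_iff finite)
  qed
  have \<kappa>1: "?\<kappa> \<ge> 1"
  proof -
    have "1 \<in> {z::'k. z ^ \<beta> = 1}" by simp
    then show ?thesis by (metis One_nat_def Suc_leI card_gt_0_iff empty_iff finite)
  qed
  have upper: "card affine_points \<le> q\<^sup>2 + (?w - 1) * (?\<kappa> - 1) * q"
  proof -
    have "real (card affine_points)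
        \<le> real q ^ 2 + (real ?w - 1) * (real ?\<kappa> - 1) * real q"
      unfolding affine_points_def using big q
      by (intro card_power_eq_additive_le additive_poly_add[OF additive]) auto
    also have "\<dots> = real (q\<^sup>2 + (?w - 1) * (?\<kappa> - 1) * q)"
      using w1 \<kappa>1 by (simp add: of_nat_diff)
    finally show ?thesis by linarith
  qed
  have "(\<alpha> - 1) * (\<beta> - 1) * q \<le> (?w - 1) * (?\<kappa> - 1) * q" using lower upper by linarith
  then have le: "(\<alpha> - 1) * (\<beta> - 1) \<le> (?w - 1) * (?\<kappa> - 1)" using q(2) by simp
  show weq: "?w = \<alpha>"
  proof (rule ccontr)
    assume "?w \<noteq> \<alpha>"
    then have "?w - 1 < \<alpha> - 1" using w w1 by linarith
    then have "(?w - 1) * (\<beta> - 1) < (\<alpha> - 1) * (\<beta> - 1)" using big(2) by simp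
    moreover have "(?w - 1) * (?\<kappa> - 1) \<le> (?w - 1) * (\<beta> - 1)" using \<kappa> by (intro mult_le_mono2) simp
    ultimately show False using le by linarith
  qed
  show \<kappa>eq: "?\<kappa> = \<beta>"
    using le \<kappa> \<kappa>1 big by (simp add: weq)
  show "card affine_points = q\<^sup>2 + (\<alpha> - 1) * (\<beta> - 1) * q"
    using lower upper by (simp add: weq \<kappa>eq)
qed

end

section \<open>The evaluation code\<close>

lemma vector_space_word_scale: "vector_space (word_scale :: 'k::field \<Rightarrow> _)"
  by unfold_locales (auto simp: algebra_simps)

text \<open>
  The message polynomials are evaluated at the points \<open>pts l\<close>. Points with \<open>y = 0\<close> are omitted
  because there the line \<open>x = a\<close> contains only one point.
\<close>

locale evaluation_code = additive_curve A \<beta> \<iota> x y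
  for A :: "'k::{field, finite} poly" and \<beta> and \<iota> :: "'k \<Rightarrow> 'f::field" and x y +
  fixes t\<^sub>1 t\<^sub>2 :: nat and pts :: "nat \<Rightarrow> 'k \<times> 'k" and n :: nat
  assumes roots: "card {w. poly A w = 0} = degree A"
    and unity: "card {z::'k. z ^ \<beta> = 1} = \<beta>"
    and t\<^sub>1: "t\<^sub>1 + 2 \<le> \<beta>" and t\<^sub>2: "t\<^sub>2 + 2 \<le> degree A"
    and pts: "bij_betw pts {..<n} {P \<in> affine_points. snd P \<noteq> 0}"
    and n_pos: "n > 0"
begin

abbreviation "S \<equiv> {P \<in> affine_points. snd P \<noteq> 0}"

definition exponents :: "(nat \<times> nat) set" where
  "exponents = {..t\<^sub>2} \<times> {..t\<^sub>1}"

definition message_poly :: "(nat \<times> nat \<Rightarrow> 'k) \<Rightarrow> 'k poly poly" where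
  "message_poly u = (\<Sum>p\<in>exponents. Polynomial.monom (Polynomial.monom (u p) (fst p)) (snd p))"

definition codeword :: "(nat \<times> nat \<Rightarrow> 'k) \<Rightarrow> nat \<Rightarrow> 'k" where
  "codeword u l = (if l < n then value_at (pts l) (message_poly u) else 0)"

definition code :: "(nat \<Rightarrow> 'k) set" where
  "code = range codeword"

lemma finite_exponents [simp]: "finite exponents"
  by (simp add: exponents_def)

lemma pts_in: "l < n \<Longrightarrow> pts l \<in> S"
  using pts by (auto simp: bij_betw_def)

lemma value_message: "value_at P (message_poly u) = (\<Sum>p\<in>exponents. u p * fst P ^ fst p * snd P ^ snd p)"
  by (simp add: value_at_def message_poly_def poly_sum poly_monom poly_power)

text \<open>
  The restriction of a message polynomial to the line \<open>y = b\<close>.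
\<close>

definition row_poly :: "(nat \<times> nat \<Rightarrow> 'k) \<Rightarrow> 'k \<Rightarrow> 'k poly" where
  "row_poly u b = (\<Sum>i\<le>t\<^sub>2. Polynomial.monom (\<Sum>j\<le>t\<^sub>1. u (i, j) * b ^ j) i)"

text \<open>
  The restriction of a message polynomial to the line \<open>x = a\<close>.
\<close>

definition column_poly :: "(nat \<times> nat \<Rightarrow> 'k) \<Rightarrow> 'k \<Rightarrow> 'k poly" where
  "column_poly u a = (\<Sum>j\<le>t\<^sub>1. Polynomial.monom (\<Sum>i\<le>t\<^sub>2. u (i, j) * a ^ i) j)"

lemma degree_sum_monom_le:
  "degree (\<Sum>i\<le>m. Polynomial.monom (c i) i) \<le> m"
  by (intro degree_sum_le) (auto intro: order_trans[OF degree_monom_le])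

lemma value_row: "value_at (a, b) (message_poly u) = poly (row_poly u b) a"
  unfolding value_message exponents_def row_poly_def
  by (simp add: poly_sum poly_monom sum.cartesian_product sum_distrib_right sum_distrib_left
      case_prod_unfold mult_ac)

lemma value_column: "value_at (a, b) (message_poly u) = poly (column_poly u a) b"
proof -
  have "value_at (a, b) (message_poly u) = (\<Sum>i\<le>t\<^sub>2. \<Sum>j\<le>t\<^sub>1. u (i, j) * a ^ i * b ^ j)"
    unfolding value_message exponents_def by (simp add: sum.cartesian_product case_prod_unfold)
  also have "\<dots> = (\<Sum>j\<le>t\<^sub>1. \<Sum>i\<le>t\<^sub>2. u (i, j) * a ^ i * b ^ j)" by (rule sum.swap)
  also have "\<dots> = poly (column_poly u a) b"
    by (simp add: column_poly_def poly_sum poly_monom sum_distrib_right)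
  finally show ?thesis .
qed

lemma row_points: "(a, b) \<in> S \<Longrightarrow> poly A w = 0 \<Longrightarrow> (a + w, b) \<in> S"
  by (simp add: affine_points_def additive_poly_add[OF additive])

lemma column_points: "(a, b) \<in> S \<Longrightarrow> z ^ \<beta> = 1 \<Longrightarrow> (a, z * b) \<in> S"
  using \<beta>_pos by (auto simp: affine_points_def power_mult_distrib zero_power)

lemma card_row: "card {a'. (a', b) \<in> S} = \<alpha>" if "(a, b) \<in> S"
proof -
  have "{a'. (a', b) \<in> S} = (\<lambda>w. a + w) ` {w. poly A w = 0}"
  proof (intro equalityI subsetI)
    fix a' assume "a' \<in> {a'. (a', b) \<in> S}"
    then have "poly A a' = poly A a" using that by (simp add: affine_points_def)
    moreover have "poly A a' = poly A a + poly A (a' - a)"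
      using additive_poly_add[OF additive, of a "a' - a"] by simp
    ultimately have "poly A (a' - a) = 0" by simp
    then show "a' \<in> (\<lambda>w. a + w) ` {w. poly A w = 0}" by (intro image_eqI[of _ _ "a' - a"]) auto
  qed (use row_points[OF that] in auto)
  then show ?thesis by (simp add: card_image roots)
qed

lemma card_column: "card {b'. (a, b') \<in> S} = \<beta>" if "(a, b) \<in> S"
proof -
  have b: "b \<noteq> 0" using that by simp
  have "{b'. (a, b') \<in> S} = (\<lambda>z. z * b) ` {z. z ^ \<beta> = 1}"
  proof (intro equalityI subsetI)
    fix b' assume "b' \<in> {b'. (a, b') \<in> S}"
    then have "b' ^ \<beta> = b ^ \<beta>" using that by (simp add: affine_points_def)
    then have "(b' / b) ^ \<beta> = 1" using b by (simp add: power_divide)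
    then show "b' \<in> (\<lambda>z. z * b) ` {z. z ^ \<beta> = 1}" using b by (intro image_eqI[of _ _ "b' / b"]) auto
  qed (use column_points[OF that] in auto)
  then show ?thesis using b by (simp add: card_image inj_on_def unity)
qed

lemma codeword_add: "codeword (\<lambda>p. u p + v p) = codeword u + codeword v"
  by (rule ext) (simp add: codeword_def value_message algebra_simps sum.distrib)

lemma codeword_scale: "codeword (\<lambda>p. c * u p) = word_scale c (codeword u)"
  by (rule ext) (simp add: codeword_def value_message sum_distrib_left mult_ac)

lemma codeword_diff: "codeword (\<lambda>p. u p - v p) = codeword u - codeword v"
  using codeword_add[of u "\<lambda>p. - 1 * v p"] codeword_scale[of "- 1" v] by (simp add: fun_eq_iff)

lemma codeword_zero: "codeword (\<lambda>_. 0) = 0"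
  by (rule ext) (simp add: codeword_def value_message)

text \<open>
  If all values vanish, so do the restrictions to all rows, having degree at most \<open>t\<^sub>2 < \<alpha>\<close> and \<open>\<alpha>\<close> zeros.
  Each coefficient of a row is a polynomial in \<open>b\<close> of degree at most \<open>t\<^sub>1 < \<beta>\<close>, and it
  vanishes at the \<open>\<beta>\<close> points of one column.
\<close>

lemma codeword_eq_0:
  assumes "codeword u = 0" and "p \<in> exponents"
  shows "u p = 0"
proof -
  have val: "value_at P (message_poly u) = 0" if "P \<in> S" for P
  proof -
    have "P \<in> pts ` {..<n}" using pts that by (simp add: bij_betw_def)
    then obtain l where "l < n" "pts l = P" by auto
    with assms(1) show ?thesis by (auto simp: codeword_def fun_eq_iff split: if_splits)
  qed
  obtain a b where ab: "(a, b) \<in> S" using pts_in[OF n_pos] by (cases "pts 0") simp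
  have row: "(\<Sum>j\<le>t\<^sub>1. u (i, j) * b' ^ j) = 0" if "(a, b') \<in> S" "i \<le> t\<^sub>2" for b' i
  proof -
    have "row_poly u b' = 0"
    proof (rule poly_eqI_degree[of "{a'. (a', b') \<in> S}"])
      show "poly (row_poly u b') a' = poly 0 a'" if "a' \<in> {a'. (a', b') \<in> S}" for a'
        using val[of "(a', b')"] that by (simp add: value_row)
      show "degree (row_poly u b') < card {a'. (a', b') \<in> S}"
        unfolding card_row[OF that(1)] row_poly_def using degree_sum_monom_le[of _ t\<^sub>2] t\<^sub>2
        by (intro le_less_trans[OF degree_sum_monom_le]) simp
      show "degree (0 :: 'k poly) < card {a'. (a', b') \<in> S}"
        unfolding card_row[OF that(1)] using degree_pos by simp
    qed
    then have "coeff (row_poly u b') i = 0" by simp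
    then show ?thesis using that(2) by (simp add: row_poly_def coeff_sum)
  qed
  obtain i j where p: "p = (i, j)" "i \<le> t\<^sub>2" "j \<le> t\<^sub>1" using assms(2) by (auto simp: exponents_def)
  let ?p = "\<Sum>j\<le>t\<^sub>1. Polynomial.monom (u (i, j)) j"
  have "?p = 0"
  proof (rule poly_eqI_degree[of "{b'. (a, b') \<in> S}"])
    show "poly ?p b' = poly 0 b'" if "b' \<in> {b'. (a, b') \<in> S}" for b'
      using row[of b' i] that p(2) by (simp add: poly_sum poly_monom)
    show "degree ?p < card {b'. (a, b') \<in> S}"
      unfolding card_column[OF ab] using t\<^sub>1 by (intro le_less_trans[OF degree_sum_monom_le]) simp
    show "degree (0 :: 'k poly) < card {b'. (a, b') \<in> S}"
      unfolding card_column[OF ab] using \<beta>_pos by simp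
  qed
  then have "coeff ?p j = 0" by simp
  then show ?thesis using p by (simp add: coeff_sum)
qed

lemma code_subspace: "linear_code n code"
proof -
  interpret vector_space "word_scale :: 'k \<Rightarrow> _" by (rule vector_space_word_scale)
  have "subspace code"
  proof (rule subspaceI)
    show "0 \<in> code" unfolding code_def by (metis codeword_zero rangeI)
    show "c + d \<in> code" if "c \<in> code" "d \<in> code" for c d
      using that unfolding code_def by (auto simp flip: codeword_add)
    show "word_scale a c \<in> code" if "c \<in> code" for a c
      using that unfolding code_def by (auto simp flip: codeword_scale)
  qed
  then show ?thesis by (auto simp: linear_code_def code_def words_def codeword_def)
qed

lemma code_dimension: "code_dim code = (t\<^sub>1 + 1) * (t\<^sub>2 + 1)"
proof -
  interpret vector_space "word_scale :: 'k \<Rightarrow> _" by (rule vector_space_word_scale)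
  define e where "e p = codeword (\<lambda>r. if r = p then 1 else 0)" for p
  have sum_apply: "(\<Sum>p\<in>E. g p) l = (\<Sum>p\<in>E. g p l)" for g :: "nat \<times> nat \<Rightarrow> nat \<Rightarrow> 'k" and E l
    by (induction E rule: infinite_finite_induct) auto
  have expand: "codeword u = (\<Sum>p\<in>exponents. word_scale (u p) (e p))" for u
  proof
    fix l
    have "value_at P (message_poly (\<lambda>r. if r = p then 1 else 0)) = fst P ^ fst p * snd P ^ snd p"
      if "p \<in> exponents" for p and P :: "'k \<times> 'k"
    proof -
      have "value_at P (message_poly (\<lambda>r. if r = p then 1 else 0))
          = (\<Sum>r\<in>exponents. if r = p then fst P ^ fst p * snd P ^ snd p else 0)"
        unfolding value_message by (intro sum.cong) auto
      with that show ?thesis by simp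
    qed
    then show "codeword u l = (\<Sum>p\<in>exponents. word_scale (u p) (e p)) l"
      by (simp add: sum_apply e_def codeword_def value_message mult.assoc)
  qed
  have inj: "inj_on e exponents"
  proof (rule inj_onI, rule ccontr)
    fix p r assume pr: "p \<in> exponents" "r \<in> exponents" "e p = e r" "p \<noteq> r"
    then have "codeword (\<lambda>s. (if s = p then 1 else 0) - (if s = r then 1 else 0)) = 0"
      unfolding codeword_diff by (simp add: e_def)
    from codeword_eq_0[OF this pr(1)] pr(4) show False by simp
  qed
  have "independent (e ` exponents)"
  proof (rule independent_if_scalars_zero)
    fix f v assume sum: "(\<Sum>v\<in>e ` exponents. word_scale (f v) v) = 0" and "v \<in> e ` exponents"
    then obtain p where p: "p \<in> exponents" "v = e p" by auto
    have "codeword (\<lambda>p. f (e p)) = 0"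
      using sum by (simp add: expand sum.reindex[OF inj])
    from codeword_eq_0[OF this p(1)] show "f v = 0" by (simp add: p)
  qed simp
  moreover have "code = span (e ` exponents)"
  proof
    show "code \<subseteq> span (e ` exponents)"
      by (auto simp: code_def expand intro!: span_sum intro: span_scale span_base)
    show "span (e ` exponents) \<subseteq> code"
      using code_subspace by (intro span_minimal) (auto simp: e_def code_def linear_code_def)
  qed
  ultimately have "code_dim code = card (e ` exponents)"
    unfolding code_dim_def by (simp add: dim_eq_card_independent)
  also have "\<dots> = (t\<^sub>1 + 1) * (t\<^sub>2 + 1)"
    by (subst card_image[OF inj]) (simp add: exponents_def)
  finally show ?thesis .
qed

text \<open>
  Two words agree where the difference of their messages vanishes, a nonzero function in
  \<open>V (\<alpha> t\<^sub>1 + \<beta> t\<^sub>2)\<close>.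
\<close>

lemma code_distance:
  assumes "c \<in> code" "c' \<in> code" "c \<noteq> c'"
  shows "n \<le> hamming_dist n c c' + (\<alpha> * t\<^sub>1 + \<beta> * t\<^sub>2)"
proof -
  let ?s = "\<alpha> * t\<^sub>1 + \<beta> * t\<^sub>2"
  from assms obtain v w where vw: "c = codeword v" "c' = codeword w" by (auto simp: code_def)
  define u where "u p = v p - w p" for p
  have cu: "codeword u = c - c'" unfolding u_def codeword_diff vw ..
  have sub: "exponents \<subseteq> reduced ?s"
  proof
    fix p assume "p \<in> exponents"
    then have "fst p \<le> t\<^sub>2" "snd p \<le> t\<^sub>1" by (auto simp: exponents_def)
    moreover from this have "\<beta> * fst p + \<alpha> * snd p \<le> \<beta> * t\<^sub>2 + \<alpha> * t\<^sub>1"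
      by (intro add_mono mult_le_mono2)
    ultimately show "p \<in> reduced ?s" using t\<^sub>1 by (simp add: reduced_def weight_def add.commute)
  qed
  define u' where "u' p = (if p \<in> exponents then u p else 0)" for p
  have ev_u: "ev (message_poly u) = comb ?s u'"
  proof -
    have "ev (message_poly u) = (\<Sum>p\<in>exponents. \<iota> (u p) * mon p)"
      by (simp add: message_poly_def ev_simps mon_def)
         (simp add: eval_bivariate_poly_at poly_at_monom hom_x hom_\<iota> mult.assoc)
    also have "\<dots> = (\<Sum>p\<in>exponents. \<iota> (u' p) * mon p)" by (simp add: u'_def)
    also have "\<dots> = comb ?s u'"
      unfolding comb_def using sub by (intro sum.mono_neutral_left) (auto simp: u'_def \<iota>_simps)
    finally show ?thesis .
  qed
  have nz: "ev (message_poly u) \<noteq> 0"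
  proof
    assume "ev (message_poly u) = 0"
    then have "u p = 0" if "p \<in> exponents" for p
      using comb_eq_0[of ?s u' p] that sub by (auto simp: ev_u u'_def)
    then have "codeword u = 0" by (intro ext) (simp add: codeword_def value_message)
    with cu assms(3) show False by simp
  qed
  have "ev (message_poly u) \<in> V ?s" unfolding ev_u V_def by simp
  then have zeros: "card {P \<in> S. value_at P (message_poly u) = 0} \<le> ?s"
    by (intro card_zeros_le[OF nz]) auto
  have agree: "c l = c' l \<longleftrightarrow> value_at (pts l) (message_poly u) = 0" if "l < n" for l
  proof -
    have "codeword u l = c l - c' l" using fun_cong[OF cu, of l] by simp
    with that show ?thesis by (simp add: codeword_def)
  qed
  have "card {l. l < n \<and> c l = c' l} \<le> card {P \<in> S. value_at P (message_poly u) = 0}"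
  proof (rule card_inj_on_le)
    show "inj_on pts {l. l < n \<and> c l = c' l}"
      using pts by (auto simp: bij_betw_def intro: inj_on_subset)
    show "pts ` {l. l < n \<and> c l = c' l} \<subseteq> {P \<in> S. value_at P (message_poly u) = 0}"
      using agree pts_in by auto
  qed simp
  moreover have "n = card {l. l < n \<and> c l = c' l} + hamming_dist n c c'"
  proof -
    have "card {..<n} = card ({l. l < n \<and> c l = c' l} \<union> {l. l < n \<and> c l \<noteq> c' l})"
      by (rule arg_cong[of _ _ card]) auto
    also have "\<dots> = card {l. l < n \<and> c l = c' l} + hamming_dist n c c'"
      unfolding hamming_dist_def by (rule card_Un_disjoint) auto
    finally show ?thesis by simp
  qed
  ultimately show ?thesis using zeros by linarith
qed

text \<open>
  On the line through \<open>pts l\<close> where \<open>\<tau>\<close> is constant, \<open>\<pi>\<close> is a coordinate in which every word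
  is a polynomial of degree at most \<open>t\<close>, so its values at \<open>t + 1\<close> other points of the line
  determine the value at \<open>l\<close>.
\<close>

lemma recovery_on_line:
  assumes l: "l < n" and R: "R \<subseteq> {l'. l' < n \<and> l' \<noteq> l \<and> \<tau> (pts l') = \<tau> (pts l)}" "card R = t + 1"
    and coordinate: "\<And>P P'. \<tau> P = \<tau> P' \<Longrightarrow> \<pi> P = \<pi> P' \<Longrightarrow> P = P'"
    and interp: "\<And>u. \<exists>p. degree p \<le> t \<and> (\<forall>P. \<tau> P = \<tau> (pts l) \<longrightarrow> value_at P (message_poly u) = poly p (\<pi> P))"
  shows "recovery_set n code l R"
proof -
  have line: "l' < n" "l' \<noteq> l" "\<tau> (pts l') = \<tau> (pts l)" if "l' \<in> R" for l' using R(1) that by auto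
  have inj: "inj_on (\<lambda>l'. \<pi> (pts l')) R"
  proof (rule inj_onI)
    fix k k' assume k: "k \<in> R" "k' \<in> R" "\<pi> (pts k) = \<pi> (pts k')"
    then have "pts k = pts k'" by (intro coordinate) (simp_all add: line)
    then show "k = k'" using pts line(1)[OF k(1)] line(1)[OF k(2)] by (auto simp: bij_betw_def inj_on_def)
  qed
  have "\<gamma> = \<gamma>'" if "projected_fibre code R l \<gamma> \<inter> projected_fibre code R l \<gamma>' \<noteq> {}" for \<gamma> \<gamma>'
  proof -
    from that obtain u u' where eq: "restrict (codeword u) R = restrict (codeword u') R"
      and \<gamma>: "codeword u l = \<gamma>" "codeword u' l = \<gamma>'"
      by (auto simp: projected_fibre_def code_def)
    obtain p where p: "degree p \<le> t" "\<And>P. \<tau> P = \<tau> (pts l) \<Longrightarrow> value_at P (message_poly u) = poly p (\<pi> P)"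
      using interp[of u] by blast
    obtain p' where p': "degree p' \<le> t" "\<And>P. \<tau> P = \<tau> (pts l) \<Longrightarrow> value_at P (message_poly u') = poly p' (\<pi> P)"
      using interp[of u'] by blast
    have "p = p'"
    proof (rule poly_eqI_degree[of "(\<lambda>l'. \<pi> (pts l')) ` R"])
      fix a assume "a \<in> (\<lambda>l'. \<pi> (pts l')) ` R"
      then obtain l' where l': "l' \<in> R" "a = \<pi> (pts l')" by auto
      then have "codeword u l' = codeword u' l'" using fun_cong[OF eq, of l'] by simp
      then show "poly p a = poly p' a"
        using p(2)[OF line(3)] p'(2)[OF line(3)] l' line(1) by (simp add: codeword_def)
    qed (use p(1) p'(1) R(2) in \<open>simp_all add: card_image[OF inj]\<close>)
    then show "\<gamma> = \<gamma>'" using \<gamma> p(2)[of "pts l"] p'(2)[of "pts l"] l by (simp add: codeword_def)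
  qed
  moreover have "R \<noteq> {}" using R(2) by auto
  ultimately show ?thesis unfolding recovery_set_def using line by blast
qed

lemma recovery_row:
  assumes "l < n" "R \<subseteq> {l'. l' < n \<and> l' \<noteq> l \<and> snd (pts l') = snd (pts l)}" "card R = t\<^sub>2 + 1"
  shows "recovery_set n code l R"
proof (rule recovery_on_line[where \<pi> = fst, OF assms])
  fix u
  have "degree (row_poly u (snd (pts l))) \<le> t\<^sub>2"
    unfolding row_poly_def by (rule degree_sum_monom_le)
  then show "\<exists>p. degree p \<le> t\<^sub>2 \<and>
      (\<forall>P. snd P = snd (pts l) \<longrightarrow> value_at P (message_poly u) = poly p (fst P))"
    by (intro exI[of _ "row_poly u (snd (pts l))"]) (auto simp: value_row)
qed (simp add: prod_eq_iff)

lemma recovery_column: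
  assumes "l < n" "R \<subseteq> {l'. l' < n \<and> l' \<noteq> l \<and> fst (pts l') = fst (pts l)}" "card R = t\<^sub>1 + 1"
  shows "recovery_set n code l R"
proof (rule recovery_on_line[where \<pi> = snd, OF assms])
  fix u
  have "degree (column_poly u (fst (pts l))) \<le> t\<^sub>1"
    unfolding column_poly_def by (rule degree_sum_monom_le)
  then show "\<exists>p. degree p \<le> t\<^sub>1 \<and>
      (\<forall>P. fst P = fst (pts l) \<longrightarrow> value_at P (message_poly u) = poly p (snd P))"
    by (intro exI[of _ "column_poly u (fst (pts l))"]) (auto simp: value_column)
qed (simp add: prod_eq_iff)

text \<open>
  A row and a column through a point meet only in this point, so recovery sets chosen in
  them are disjoint.
\<close>

lemma two_recovery_sets:
  assumes l: "l < n"
  shows "\<exists>R. (\<forall>j<length [t\<^sub>2 + 1, t\<^sub>1 + 1]. recovery_set n code l (R j) \<and> card (R j) = [t\<^sub>2 + 1, t\<^sub>1 + 1] ! j) \<and>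
    disjoint_family_on R {..<length [t\<^sub>2 + 1, t\<^sub>1 + 1]}"
proof -
  obtain a b where ab: "pts l = (a, b)" "(a, b) \<in> S" using pts_in[OF l] by (cases "pts l") simp
  let ?row = "{l'. l' < n \<and> l' \<noteq> l \<and> snd (pts l') = snd (pts l)}"
  let ?col = "{l'. l' < n \<and> l' \<noteq> l \<and> fst (pts l') = fst (pts l)}"
  have inj: "inj_on pts {..<n}" and img: "pts ` {..<n} = S" using pts by (auto simp: bij_betw_def)
  have card_eq: "card {l'. l' < n \<and> l' \<noteq> l \<and> Q (pts l')} = card {P \<in> S. Q P} - 1" if "Q (a, b)" for Q
  proof -
    have "{P \<in> S. Q P} = pts ` {l'. l' < n \<and> Q (pts l')}" unfolding img[symmetric] by auto
    moreover have "inj_on pts {l'. l' < n \<and> Q (pts l')}" using inj by (rule inj_on_subset) auto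
    ultimately have "card {P \<in> S. Q P} = card {l'. l' < n \<and> Q (pts l')}" by (simp add: card_image)
    moreover have "{l'. l' < n \<and> l' \<noteq> l \<and> Q (pts l')} = {l'. l' < n \<and> Q (pts l')} - {l}" by auto
    ultimately show ?thesis using l that ab(1) by (simp add: card_Diff_singleton)
  qed
  have "{P \<in> S. snd P = b} = (\<lambda>a'. (a', b)) ` {a'. (a', b) \<in> S}" by (auto simp: image_iff)
  then have "card {P \<in> S. snd P = b} = \<alpha>" using card_row[OF ab(2)] by (simp add: card_image inj_on_def)
  then have "card ?row \<ge> t\<^sub>2 + 1" using card_eq[of "\<lambda>P. snd P = b"] ab t\<^sub>2 by simp
  then obtain R0 where R0: "R0 \<subseteq> ?row" "card R0 = t\<^sub>2 + 1" by (rule obtain_subset_with_card_n)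
  have "{P \<in> S. fst P = a} = (\<lambda>b'. (a, b')) ` {b'. (a, b') \<in> S}" by (auto simp: image_iff)
  then have "card {P \<in> S. fst P = a} = \<beta>" using card_column[OF ab(2)] by (simp add: card_image inj_on_def)
  then have "card ?col \<ge> t\<^sub>1 + 1" using card_eq[of "\<lambda>P. fst P = a"] ab t\<^sub>1 by simp
  then obtain R1 where R1: "R1 \<subseteq> ?col" "card R1 = t\<^sub>1 + 1" by (rule obtain_subset_with_card_n)
  have "R0 \<inter> R1 = {}"
  proof (rule ccontr)
    assume "R0 \<inter> R1 \<noteq> {}"
    then obtain k where "k \<in> R0" "k \<in> R1" by auto
    then have "k < n" "k \<noteq> l" "pts k = pts l" using R0(1) R1(1) by (auto simp: prod_eq_iff)
    then show False using inj l by (auto simp: inj_on_def)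
  qed
  then show ?thesis
    using recovery_row[OF l R0] recovery_column[OF l R1] R0(2) R1(2)
    by (intro exI[of _ "\<lambda>j. if j = 0 then R0 else R1"])
       (auto simp: disjoint_family_on_def less_Suc_eq)
qed

theorem evaluation_code_is_lrc:
  obtains d where "n \<le> d + (\<alpha> * t\<^sub>1 + \<beta> * t\<^sub>2)"
    "is_lrc n ((t\<^sub>1 + 1) * (t\<^sub>2 + 1)) d [t\<^sub>2 + 1, t\<^sub>1 + 1] code"
proof -
  let ?P = "\<lambda>d. \<exists>c\<in>code. \<exists>c'\<in>code. c \<noteq> c' \<and> hamming_dist n c c' = d"
  have "codeword (\<lambda>_. 1) \<noteq> codeword (\<lambda>_. 0)"
  proof
    assume "codeword (\<lambda>_. 1) = codeword (\<lambda>_. 0)"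
    then have "codeword (\<lambda>_. 1) = 0" by (simp add: codeword_zero)
    from codeword_eq_0[OF this, of "(0, 0)"] show False by (simp add: exponents_def)
  qed
  then have "\<exists>d. ?P d" unfolding code_def by blast
  then have least: "?P (LEAST d. ?P d)" by (rule LeastI_ex)
  define d where "d = (LEAST d. ?P d)"
  have dist: "has_min_dist n code d"
    using least unfolding has_min_dist_def d_def by (auto intro: Least_le)
  moreover have "n \<le> d + (\<alpha> * t\<^sub>1 + \<beta> * t\<^sub>2)"
    using least code_distance unfolding d_def[symmetric] by auto
  ultimately show ?thesis
    using two_recovery_sets
    by (intro that[of d]) (auto simp: is_lrc_def code_subspace code_dimension)
qed

end

theorem corollary3p1p4:
  fixes q \<alpha> \<beta> :: nat and t\<^sub>1 t\<^sub>2 :: int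
    and A :: "'k::{field, finite} poly"
    and \<iota> :: "'k \<Rightarrow> 'f::field" and x y :: 'f
  assumes "primepow q" and "card (UNIV :: 'k set) = q\<^sup>2"
    and "additive_poly A" and "separable_poly A" and "degree A = \<alpha>"
    and "coprime \<alpha> \<beta>"
    and "absolutely_irreducible (separated_curve_poly \<beta> A)"
    and "is_function_field_of (separated_curve_poly \<beta> A) \<iota> x y"
    and "maximal_curve \<iota> q"
    and "t\<^sub>1 \<ge> 0" and "t\<^sub>2 \<ge> 0"
    and "t\<^sub>1 \<le> int \<beta> - 2" and "t\<^sub>2 \<le> int \<alpha> - 2"
  shows "\<exists>n d. \<exists>C :: (nat \<Rightarrow> 'k) set.
    int n = (int q)\<^sup>2 + (int \<alpha> - 1) * (int \<beta> - 1) * int q - int \<alpha> \<and>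
    int d \<ge> int n - int \<alpha> * t\<^sub>1 - int \<beta> * t\<^sub>2 \<and>
    is_lrc n (nat ((t\<^sub>1 + 1) * (t\<^sub>2 + 1))) d [nat (t\<^sub>2 + 1), nat (t\<^sub>1 + 1)] C"
proof -
  have big: "degree A \<ge> 2" "\<beta> \<ge> 2" using assms by simp_all
  interpret additive_curve A \<beta> \<iota> x y
    using assms big by unfold_locales simp_all
  have "q > 0" using assms(1) by (simp add: primepow_gt_0_nat)
  note maximal = maximal_curve_structure[OF assms(9,2) \<open>q > 0\<close> big]
  define S where "S = {P \<in> affine_points. snd P \<noteq> 0}"
  define n where "n = card S"
  have "card affine_points = n + degree A"
  proof -
    have "affine_points = S \<union> (\<lambda>w. (w, 0)) ` {w. poly A w = 0}"
      using \<beta>_pos by (auto simp: S_def affine_points_def image_iff zero_power)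
    moreover have "S \<inter> (\<lambda>w. (w, 0)) ` {w. poly A w = 0} = {}" by (auto simp: S_def)
    ultimately have "card affine_points = n + card ((\<lambda>w. (w, 0 :: 'k)) ` {w. poly A w = 0})"
      unfolding n_def by (metis card_Un_disjoint finite)
    then show ?thesis by (simp add: card_image inj_on_def maximal(1))
  qed
  with maximal(3) have n: "n + \<alpha> = q\<^sup>2 + (\<alpha> - 1) * (\<beta> - 1) * q" by (simp add: assms(5))
  have "\<alpha> \<le> q\<^sup>2"
    unfolding assms(2)[symmetric] assms(5)[symmetric] maximal(1)[symmetric] by (rule card_mono) auto
  moreover have "(\<alpha> - 1) * (\<beta> - 1) * q > 0" using big \<open>q > 0\<close> assms(5) by simp
  ultimately have "n > 0" using n by linarith
  obtain pts where "bij_betw pts {0..<n} S"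
    using ex_bij_betw_nat_finite[OF finite[of S]] unfolding n_def by (elim exE)
  then have pts: "bij_betw pts {..<n} S" by (simp add: atLeast0LessThan)
  interpret evaluation_code A \<beta> \<iota> x y "nat t\<^sub>1" "nat t\<^sub>2" pts n
    using assms maximal pts \<open>n > 0\<close> by unfold_locales (auto simp: S_def)
  obtain d where d: "n \<le> d + (degree A * nat t\<^sub>1 + \<beta> * nat t\<^sub>2)"
    "is_lrc n ((nat t\<^sub>1 + 1) * (nat t\<^sub>2 + 1)) d [nat t\<^sub>2 + 1, nat t\<^sub>1 + 1] code"
    by (rule evaluation_code_is_lrc)
  have "int n + int \<alpha> = (int q)\<^sup>2 + (int \<alpha> - 1) * (int \<beta> - 1) * int q"
    using arg_cong[OF n, of int] big assms(5) by (simp add: of_nat_diff)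
  then have 1: "int n = (int q)\<^sup>2 + (int \<alpha> - 1) * (int \<beta> - 1) * int q - int \<alpha>" by simp
  have "int n \<le> int (d + (degree A * nat t\<^sub>1 + \<beta> * nat t\<^sub>2))" using d(1) by (rule of_nat_mono)
  then have 2: "int d \<ge> int n - int \<alpha> * t\<^sub>1 - int \<beta> * t\<^sub>2"
    using assms by simp
  have 3: "nat ((t\<^sub>1 + 1) * (t\<^sub>2 + 1)) = (nat t\<^sub>1 + 1) * (nat t\<^sub>2 + 1)"
    "nat (t\<^sub>2 + 1) = nat t\<^sub>2 + 1" "nat (t\<^sub>1 + 1) = nat t\<^sub>1 + 1"
    using assms by (simp_all add: nat_mult_distrib nat_add_distrib)
  show ?thesis using 1 2 d(2) unfolding 3 by blast
qed

end
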